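(* Let $f\colon[0,1]\to[0,1]$ be continuous and of type $2^\infty$, and let $f$ have a maximal infinite $\omega$-limit set $\tilde{\omega}$. Assume that the minimal closed invariant interval $V$ containing $\tilde{\omega}$ contains exactly one periodic orbit of period $2^n$ for each $n\in\mathbb{N}$, and this periodic orbit is not attractive. Let $f_{0,\infty}=(f_0,f_1,\ldots)$ be a sequence of continuous self-maps of $[0,1]$ converging uniformly to $f$. Then there exist $K\in\mathbb{N}$ and $\delta>0$ such that for each integer $k>K$, every point $x\in\tilde{\omega}$ is $(f_{k,\infty},\delta)$-recurrent.
   Context: $I=[0,1]$. The $\omega$-limit set of $x$ under $f$ is the set of limit points of $(f^n(x))_{n\ge0}$. An $\omega$-limit set $\tilde\omega$ is maximal if for every $\omega$-limit set $\tilde\omega_1$ of $f$, either $\tilde\omega_1\subseteq\tilde\omega$ or $\tilde\omega_1\cap\tilde\omega=\emptyset$. $f$ is of type $2^\infty$ if it has a periodic point of period $2^n$ for every $n\in\mathbb{N}$ and no periodic points of other periods. A set $A$ is invariant if $f(A)\subseteq A$. A periodic point of period $n$ is attractive if it is an attractive fixed point of $f^n$ (there is a neighborhood $U$ of it such that $(f^n)^j(y)$ converges to it for all $y\in U$); a periodic orbit is attractive if its points are. For a sequence $g_{0,\infty}$ and $k\in\mathbb{N}_0$, $g_{k,\infty}=(g_k,g_{k+1},\ldots)$. Each map $g$ in the sequence is extended continuously to $\mathbb{R}$ so that $g(\mathbb{R}\setminus I)\subseteq g(\{0,1\})$. Fix a probability space $(\Omega,\Sigma,P)$. For $\delta>0$,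 a $(g_{0,\infty},\delta)$-process beginning at $x_0$ is given by $X_0=x_0$, $X_{n+1}=g_n(X_n)+\xi_n$, where $\xi_0,\xi_1,\ldots$ are independent with uniform continuous distribution on $[-\delta,\delta]$. A point $x\in I$ is $(g_{0,\infty},\delta)$-recurrent if for each open neighborhood $U$ of $x$ and each $\delta'\in(0,\delta)$, $P\big(\bigcap_{n=1}^\infty\bigcup_{k=n}^\infty\{X_k\in U\}\big)=1$ for every $(g_{0,\infty},\delta')$-process $(X_n)$ beginning at $x$. *)

theory Defs
  imports "HOL-Analysis.Analysis" "HOL-Probability.Probability"
begin

text \<open>Maps are real functions; only their values on I = [0,1] matter.\<close>

definition omega_limit :: "(real \<Rightarrow> real) \<Rightarrow> real \<Rightarrow> real set" where
  "omega_limit f x = {y. \<forall>e>0. \<forall>N. \<exists>n\<ge>N. dist ((f ^^ n) x) y < e}"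

definition is_omega_limit_set :: "(real \<Rightarrow> real) \<Rightarrow> real set \<Rightarrow> bool" where
  "is_omega_limit_set f W \<longleftrightarrow> (\<exists>x\<in>{0..1}. W = omega_limit f x)"

definition maximal_omega_limit_set :: "(real \<Rightarrow> real) \<Rightarrow> real set \<Rightarrow> bool" where
  "maximal_omega_limit_set f W \<longleftrightarrow> is_omega_limit_set f W \<and>
     (\<forall>W1. is_omega_limit_set f W1 \<longrightarrow> W1 \<subseteq> W \<or> W1 \<inter> W = {})"

definition periodic_point :: "(real \<Rightarrow> real) \<Rightarrow> real \<Rightarrow> nat \<Rightarrow> bool" where
  "periodic_point f p n \<longleftrightarrow> p \<in> {0..1} \<and> n > 0 \<and> (f ^^ n) p = p \<and>
     (\<forall>m. 0 < m \<and> m < n \<longrightarrow> (f ^^ m) p \<noteq> p)"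

definition type_two_infty :: "(real \<Rightarrow> real) \<Rightarrow> bool" where
  "type_two_infty f \<longleftrightarrow> (\<forall>n::nat. \<exists>p. periodic_point f p (2 ^ n)) \<and>
     (\<forall>p m. periodic_point f p m \<longrightarrow> (\<exists>n::nat. m = 2 ^ n))"

definition periodic_orbit :: "(real \<Rightarrow> real) \<Rightarrow> real set \<Rightarrow> nat \<Rightarrow> bool" where
  "periodic_orbit f Orb n \<longleftrightarrow> (\<exists>p. periodic_point f p n \<and> Orb = {(f ^^ j) p | j. j < n})"

definition attractive_point :: "(real \<Rightarrow> real) \<Rightarrow> real \<Rightarrow> nat \<Rightarrow> bool" where
  "attractive_point f p n \<longleftrightarrow> (\<exists>U. open U \<and> p \<in> U \<and>
     (\<forall>y\<in>U \<inter> {0..1}. (\<lambda>j. ((f ^^ n) ^^ j) y) \<longlonglongrightarrow> p))"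

definition attractive_orbit :: "(real \<Rightarrow> real) \<Rightarrow> real set \<Rightarrow> nat \<Rightarrow> bool" where
  "attractive_orbit f Orb n \<longleftrightarrow> (\<forall>p\<in>Orb. attractive_point f p n)"

definition invariant :: "(real \<Rightarrow> real) \<Rightarrow> real set \<Rightarrow> bool" where
  "invariant f A \<longleftrightarrow> f ` A \<subseteq> A"

definition min_inv_interval :: "(real \<Rightarrow> real) \<Rightarrow> real set \<Rightarrow> real set" where
  "min_inv_interval f W = \<Inter>{J. (\<exists>a b. 0 \<le> a \<and> a \<le> b \<and> b \<le> 1 \<and> J = {a..b}) \<and>
       invariant f J \<and> W \<subseteq> J}"

text \<open>The continuous extension of g to the real line with g(R - I) in g({0,1}).\<close>
definition ext :: "(real \<Rightarrow> real) \<Rightarrow> real \<Rightarrow> real" where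
  "ext g x = g (max 0 (min 1 x))"

fun proc :: "(nat \<Rightarrow> real \<Rightarrow> real) \<Rightarrow> (nat \<Rightarrow> 'a \<Rightarrow> real) \<Rightarrow> real \<Rightarrow> nat \<Rightarrow> 'a \<Rightarrow> real" where
  "proc g \<xi> x0 0 \<omega> = x0"
| "proc g \<xi> x0 (Suc n) \<omega> = ext (g n) (proc g \<xi> x0 n \<omega>) + \<xi> n \<omega>"

definition noise :: "'a measure \<Rightarrow> real \<Rightarrow> (nat \<Rightarrow> 'a \<Rightarrow> real) \<Rightarrow> bool" where
  "noise M d \<xi> \<longleftrightarrow> prob_space.indep_vars M (\<lambda>_. borel) \<xi> UNIV \<and>
     (\<forall>n. \<xi> n \<in> borel_measurable M \<and> distr M lborel (\<xi> n) = uniform_measure lborel {-d..d})"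

definition recurrent :: "'a measure \<Rightarrow> (nat \<Rightarrow> real \<Rightarrow> real) \<Rightarrow> real \<Rightarrow> real \<Rightarrow> bool" where
  "recurrent M g d x \<longleftrightarrow> x \<in> {0..1} \<and> (\<forall>U d'. open U \<and> x \<in> U \<and> 0 < d' \<and> d' < d \<longrightarrow>
     (\<forall>\<xi>. noise M d' \<xi> \<longrightarrow>
        measure M {\<omega> \<in> space M. \<forall>n\<ge>1. \<exists>k\<ge>n. proc g \<xi> x k \<omega> \<in> U} = 1))"

end

theory Submission
  imports Defs
begin

text \<open>
  Renormalization: on an interval with a single fixed point \<open>p\<close> of \<open>h\<close> and no odd periods, a
  nonconvergent orbit eventually alternates between the two sides of \<open>p\<close>, and then enters an
  interval on one side of \<open>p\<close> that \<open>h\<^sup>2\<close> maps into itself. Iterating this from the minimal interval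
  \<open>V\<close> gives, for every \<open>n\<close>, a cycle of \<open>2 ^ n\<close> disjoint intervals meeting the \<open>\<omega>\<close>-limit set; each
  of them contains a point of the orbit of period \<open>2 ^ n\<close>, and one of them has length at most
  \<open>2 ^ -n\<close>. Hence these periodic orbits come arbitrarily close to the \<open>\<omega>\<close>-limit set.

  Let \<open>R\<close> be the set reachable from a point near \<open>V\<close> by chains with errors below \<open>\<epsilon>\<close>. Some component
  of \<open>R\<close> is mapped into itself by an iterate of \<open>f\<close>. If \<open>R\<close> met only finitely many of the periodic
  orbits, a suitable iterate would have finitely many fixed points and no points of period 2 there,
  and one of the fixed points would be attractive. So \<open>R\<close> contains orbits of arbitrarily large
  period, therefore a point of the \<open>\<omega>\<close>-limit set, and then all of it by chain transitivity.

  Finally \<open>V\<close> has neighbourhoods that \<open>f\<close> maps into their interior, so that small noise cannot leave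
  them, and by compactness the process hits a given neighbourhood of a point of the \<open>\<omega>\<close>-limit set
  within a bounded time with probability bounded below, whatever its past.
\<close>

text \<open>The obstacle is that the cycles of intervals are not known to shrink to points: only
  some pair of a periodic point and a limit point gets close, and it is not controlled which one.
  Uniqueness of the orbit of period \<open>2 ^ n\<close> repairs this, because a chain that reaches
  any point of that orbit can follow it to the close pair and spend one admissible error there. The
  maps are extended to the line because the noise can leave the unit interval and \<open>V\<close>
  may touch its ends. Near \<open>V\<close> two exact steps lead back into \<open>V\<close>; hence
  periodic points found in the neighbourhood lie in \<open>V\<close>, where the hypotheses on
  periodic orbits apply. The chains are chains of the limit map only. Since their errors are
  strictly below the bound, each chain leaves room for a small change of the starting point, the
  maps and the noise; the given maps fit into this room from some time on, and recurrence ignores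
  what happens before. The final \<delta> is half of the margin by which the neighbourhood is mapped
  into itself; the other half pays for the distance of the maps from the limit, which determines
  \<open>K\<close>.\<close>

lemma funpow_mem: "h ` S \<subseteq> S \<Longrightarrow> z \<in> S \<Longrightarrow> (h ^^ n) z \<in> S"
  by (induction n) auto

lemma continuous_on_funpow:
  "continuous_on S h \<Longrightarrow> h ` S \<subseteq> S \<Longrightarrow> continuous_on S (h ^^ n)"
proof (induction n)
  case (Suc n)
  have "(h ^^ n) ` S \<subseteq> S" using funpow_mem[OF Suc.prems(2)] by blast
  then have "continuous_on ((h ^^ n) ` S) h" using Suc.prems(1) continuous_on_subset by blast
  then show ?case using Suc by (metis funpow.simps(2) continuous_on_compose)
qed (simp add: id_def)

lemma fixed_point_between:
  fixes h :: "real \<Rightarrow> real"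
  assumes "continuous_on {u..v} h" "u \<le> v" "h u \<ge> u \<and> h v \<le> v \<or> h u \<le> u \<and> h v \<ge> v"
  shows "\<exists>q\<in>{u..v}. h q = q"
proof -
  have c: "continuous_on {u..v} (\<lambda>z. h z - z)"
    using assms(1) by (intro continuous_intros)
  from assms(3) show ?thesis
  proof
    assume "h u \<ge> u \<and> h v \<le> v"
    then show ?thesis using IVT2'[of "\<lambda>z. h z - z" v 0 u] c assms(2) by auto
  next
    assume "h u \<le> u \<and> h v \<ge> v"
    then show ?thesis using IVT'[of "\<lambda>z. h z - z" u 0 v] c assms(2) by auto
  qed
qed

section \<open>Renormalization of interval maps\<close>

text \<open>Since \<open>a\<close> is not moved below itself, a failure would give a fixed point of
  the odd iterate in \<open>{a..z}\<close>. By \<open>od\<close> it would be fixed by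
  \<open>h\<close>, hence equal to \<open>p\<close>, which lies beyond \<open>z\<close>.\<close>

lemma odd_iterate_greater:
  fixes h :: "real \<Rightarrow> real"
  assumes cont: "continuous_on {a..b} h" and maps: "h ` {a..b} \<subseteq> {a..b}"
    and uniq: "\<And>q. q \<in> {a..b} \<Longrightarrow> h q = q \<Longrightarrow> q = p"
    and od: "\<And>q m. q \<in> {a..b} \<Longrightarrow> odd m \<Longrightarrow> (h ^^ m) q = q \<Longrightarrow> h q = q"
    and z: "z \<in> {a..b}" "z < p" and m: "odd m"
  shows "z < (h ^^ m) z"
proof (rule ccontr)
  assume n: "\<not> z < (h ^^ m) z"
  have "(h ^^ m) a \<in> {a..b}" using funpow_mem[OF maps, of a m] z by auto
  moreover have "continuous_on {a..z} (h ^^ m)"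
    by (rule continuous_on_subset[OF continuous_on_funpow[OF cont maps]]) (use z in auto)
  ultimately obtain q where "q \<in> {a..z}" "(h ^^ m) q = q"
    using fixed_point_between[of a z "h ^^ m"] z n by auto
  then show False using od[OF _ m, of q] uniq[of q] z by auto
qed

text \<open>A time \<open>k\<close> with two consecutive points left of \<open>p\<close> is a
  barrier: for \<open>l > k\<close> one of \<open>l - k\<close> and \<open>l - Suc k\<close> is odd,
  so \<open>odd_iterate_greater\<close> from \<open>X k\<close> or \<open>X (Suc k)\<close> keeps
  every later point above \<open>X k\<close>. Infinitely many barriers must climb to
  \<open>p\<close>, and right of \<open>p\<close> every point moves left.\<close>

lemma same_side_infinitely_often_imp_convergent:
  fixes h :: "real \<Rightarrow> real"
  assumes cont: "continuous_on {a..b} h" and maps: "h ` {a..b} \<subseteq> {a..b}"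
    and p: "p \<in> {a..b}" "h p = p"
    and uniq: "\<And>q. q \<in> {a..b} \<Longrightarrow> h q = q \<Longrightarrow> q = p"
    and od: "\<And>q m. q \<in> {a..b} \<Longrightarrow> odd m \<Longrightarrow> (h ^^ m) q = q \<Longrightarrow> h q = q"
    and x: "x \<in> {a..b}"
    and inf: "infinite {k. (h ^^ k) x < p \<and> (h ^^ Suc k) x < p}"
  shows "(\<lambda>k. (h ^^ k) x) \<longlonglongrightarrow> p"
proof -
  define X where "X k = (h ^^ k) x" for k
  define S where "S = {k. X k < p \<and> X (Suc k) < p}"
  have XS: "X (Suc k) = h (X k)" for k by (simp add: X_def)
  have Xadd: "X (n + k) = (h ^^ n) (X k)" for n k by (simp add: X_def funpow_add)
  have Xin: "X k \<in> {a..b}" for k unfolding X_def using funpow_mem[OF maps x] .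
  have gt: "z < (h ^^ m) z" if "z \<in> {a..b}" "z < p" "odd m" for z m
    using odd_iterate_greater[OF cont maps uniq od that] .
  have gt1: "z < h z" if "z \<in> {a..b}" "z < p" for z using gt[OF that, of 1] by simp
  have lt1: "h z < z" if z: "z \<in> {a..b}" "p < z" for z
  proof (rule ccontr)
    assume "\<not> h z < z"
    moreover have "h b \<le> b" using maps z by (auto simp: image_subset_iff)
    moreover have "continuous_on {z..b} h" using cont z(1) by (auto elim: continuous_on_subset)
    ultimately obtain q where "q \<in> {z..b}" "h q = q"
      using fixed_point_between[of z b h] z by auto
    then show False using uniq[of q] z by auto
  qed
  have even_ret: "X (Suc k) < X l" if "k \<in> S" "k < l" "even (l - k)" for k l
  proof -
    have o: "odd (l - Suc k)" and e: "l = (l - Suc k) + Suc k" using that(2,3) by presburger+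
    show ?thesis using gt[OF Xin _ o, of "Suc k"] that(1) Xadd[of "l - Suc k" "Suc k"] e
      by (simp add: S_def)
  qed
  have later: "X k < X l" if "k \<in> S" "k < l" for k l
  proof (cases "even (l - k)")
    case True
    then show ?thesis using even_ret[OF that] gt1[OF Xin, of k] that(1) XS by (force simp: S_def)
  next
    case False
    then show ?thesis using gt[OF Xin _ False, of k] that Xadd[of "l - k" k] by (simp add: S_def)
  qed
  have Sinf: "infinite S" using inf by (simp add: S_def X_def)
  define r where "r = enumerate S"
  have r: "strict_mono r" "\<And>i. r i \<in> S"
    unfolding r_def using Sinf strict_mono_enumerate enumerate_in_set by blast+
  have inc: "incseq (\<lambda>i. X (r i))"
  proof (rule incseq_SucI)
    fix i
    have "r i < r (Suc i)" using r(1) by (simp add: strict_mono_Suc_iff)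
    then show "X (r i) \<le> X (r (Suc i))" using later[OF r(2)] less_imp_le by blast
  qed
  have "X (r i) \<le> p" for i using r(2)[of i] by (simp add: S_def)
  then obtain w where w: "(\<lambda>i. X (r i)) \<longlonglongrightarrow> w" using incseq_convergent[OF inc] by blast
  have wp: "w \<le> p" using w \<open>\<And>i. X (r i) \<le> p\<close> LIMSEQ_le_const2 by blast
  have win: "w \<in> {a..b}" using w Xin closed_sequentially[of "{a..b}" "\<lambda>i. X (r i)"] by auto
  have Xw: "X (r i) \<le> w" for i using incseq_le[OF inc w] .
  \<comment> \<open>If \<open>w < p\<close>, continuity puts the late successors
    \<open>X (Suc (r i))\<close> above \<open>w\<close>, while no \<open>X (r j)\<close> exceeds
    \<open>w\<close>; by \<open>even_ret\<close> the gaps between late barrier times are then odd.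
    Three times cannot have pairwise odd gaps.\<close>
  have "w = p"
  proof (rule ccontr)
    assume "w \<noteq> p"
    then have "w < h w" using wp gt1[OF win] by simp
    moreover have "(\<lambda>i. h (X (r i))) \<longlonglongrightarrow> h w"
      using continuous_on_tendsto_compose[OF cont w win] Xin by simp
    ultimately have "\<forall>\<^sub>F i in sequentially. w < h (X (r i))" using order_tendstoD(1) by blast
    then obtain I where I: "\<And>i. i \<ge> I \<Longrightarrow> w < X (Suc (r i))"
      unfolding eventually_sequentially XS by blast
    have no: "odd (r j - r i)" if "I \<le> i" "i < j" for i j
    proof
      assume "even (r j - r i)"
      then have "X (Suc (r i)) < X (r j)" using even_ret[OF r(2)] r(1) that(2) strict_monoD by blast
      then show False using I[OF that(1)] Xw[of j] by simp
    qed
    have "r I < r (I+1)" "r (I+1) < r (I+2)" using r(1) strict_monoD by (metis add_strict_left_mono less_add_one one_less_numeral_iff semiring_norm(76))+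
    then show False using no[of I "I+1"] no[of "I+1" "I+2"] no[of I "I+2"] by auto
  qed
  have low: "\<exists>n0. \<forall>n\<ge>n0. X n > p - e" if "e > 0" for e
  proof -
    have "\<forall>\<^sub>F i in sequentially. p - e < X (r i)" using order_tendstoD(1)[OF w] \<open>w = p\<close> that by simp
    then obtain i where "p - e < X (r i)" by (auto simp: eventually_sequentially)
    then have "\<forall>n\<ge>Suc (r i). X n > p - e" using later[OF r(2)[of i]] by (meson Suc_le_lessD less_trans)
    then show ?thesis by blast
  qed
  have "\<exists>n0. \<forall>n\<ge>n0. dist (X n) p < e" if e: "e > 0" for e
  proof -
    obtain d0 where d0: "d0 > 0" "\<And>z. z \<in> {a..b} \<Longrightarrow> \<bar>z - p\<bar> < d0 \<Longrightarrow> \<bar>h z - p\<bar> < e"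
      using cont p e unfolding continuous_on_iff dist_real_def by metis
    define d where "d = min d0 e"
    have d: "d > 0" "d \<le> e" "\<And>z. z \<in> {a..b} \<Longrightarrow> \<bar>z - p\<bar> < d \<Longrightarrow> \<bar>h z - p\<bar> < e"
      using d0 e by (auto simp: d_def)
    obtain n0 where n0: "\<And>n. n \<ge> n0 \<Longrightarrow> X n > p - d" using low[OF d(1)] by blast
    \<comment> \<open>Otherwise the tail would decrease to a fixed point right of
      \<open>p\<close>.\<close>
    have "\<exists>n\<ge>n0. X n < p + d"
    proof (rule ccontr)
      assume "\<not> (\<exists>n\<ge>n0. X n < p + d)"
      then have ge: "X (n + n0) \<ge> p + d" for n by (metis le_add2 not_less)
      have "decseq (\<lambda>n. X (n + n0))"
      proof (rule decseq_SucI)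
        fix n show "X (Suc n + n0) \<le> X (n + n0)"
          using lt1[OF Xin, of "n + n0"] ge[of n] d(1) XS[of "n + n0"] by simp
      qed
      then obtain v where v: "(\<lambda>n. X (n + n0)) \<longlonglongrightarrow> v" using decseq_convergent ge by metis
      have vin: "v \<in> {a..b}" using v Xin closed_sequentially[of "{a..b}" "\<lambda>n. X (n + n0)"] by auto
      have "(\<lambda>n. h (X (n + n0))) \<longlonglongrightarrow> h v"
        using continuous_on_tendsto_compose[OF cont v vin] Xin by simp
      moreover have "(\<lambda>n. h (X (n + n0))) \<longlonglongrightarrow> v"
        using LIMSEQ_Suc[OF v] by (simp add: XS)
      ultimately have "h v = v" using LIMSEQ_unique by blast
      then have "v = p" using uniq[OF vin] by simp
      moreover have "v \<ge> p + d" using LIMSEQ_le_const[OF v] ge by blast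
      ultimately show False using d(1) by simp
    qed
    then obtain n1 where n1: "n1 \<ge> n0" "X n1 < p + d" by blast
    \<comment> \<open>Below \<open>p + d\<close> the next point is within \<open>e\<close> of
      \<open>p\<close> by continuity; from \<open>p + d\<close> on it moves left. So
      \<open>p + e\<close> is never crossed.\<close>
    have "X n < p + e" if "n \<ge> n1" for n using that
    proof (induction n rule: dec_induct)
      case base then show ?case using n1 d by simp
    next
      case (step n)
      show ?case
      proof (cases "X n < p + d")
        case True
        then show ?thesis using d(3)[OF Xin, of n] n0[of n] step n1 XS by (auto simp: abs_less_iff)
      next
        case False
        then show ?thesis using lt1[OF Xin, of n] XS step.IH d(1) by simp
      qed
    qed
    moreover have "X n > p - e" if "n \<ge> n1" for n using n0[of n] n1 d that by simp
    ultimately have "\<forall>n\<ge>n1. dist (X n) p < e" by (simp add: dist_real_def abs_less_iff algebra_simps)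
    then show ?thesis by blast
  qed
  then show ?thesis unfolding LIMSEQ_def X_def by blast
qed


text \<open>By the preceding lemma and its mirror image, a nonconvergent orbit has only finitely
  many consecutive pairs on one side of \<open>p\<close>, and it never hits
  \<open>p\<close>.\<close>

lemma eventually_alternates:
  fixes h :: "real \<Rightarrow> real"
  assumes cont: "continuous_on {a..b} h" and maps: "h ` {a..b} \<subseteq> {a..b}"
    and p: "p \<in> {a..b}" "h p = p"
    and uniq: "\<And>q. q \<in> {a..b} \<Longrightarrow> h q = q \<Longrightarrow> q = p"
    and od: "\<And>q m. q \<in> {a..b} \<Longrightarrow> odd m \<Longrightarrow> (h ^^ m) q = q \<Longrightarrow> h q = q"
    and x: "x \<in> {a..b}"
    and nonconv: "\<not> (\<lambda>k. (h ^^ k) x) \<longlonglongrightarrow> p"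
  shows "\<exists>K. (h ^^ K) x < p \<and> (\<forall>j. (h ^^ (2 * j)) ((h ^^ K) x) < p)"
proof -
  define X where "X k = (h ^^ k) x" for k
  have XS: "X (Suc k) = h (X k)" for k by (simp add: X_def)
  have Xadd: "X (n + k) = (h ^^ n) (X k)" for n k by (simp add: X_def funpow_add)
  have nep: "X k \<noteq> p" for k
  proof
    assume "X k = p"
    then have "X (n + k) = p" for n using p(2) by (induction n) (simp_all add: XS)
    then have "(\<lambda>n. X (n + k)) \<longlonglongrightarrow> p" by simp
    then show False using nonconv LIMSEQ_offset[of X k p] unfolding X_def[abs_def] by blast
  qed
  have finL: "finite {k. X k < p \<and> X (Suc k) < p}"
  proof (rule ccontr)
    assume i: "infinite {k. X k < p \<and> X (Suc k) < p}"
    have "(\<lambda>k. (h ^^ k) x) \<longlonglongrightarrow> p"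
      by (rule same_side_infinitely_often_imp_convergent[of a b h p x])
        (fact cont maps p uniq od x i[unfolded X_def])+
    then show False using nonconv by simp
  qed
  define h' where "h' z = - h (- z)" for z
  have pow: "(h' ^^ n) z = - (h ^^ n) (- z)" for n z
    by (induction n) (simp_all add: h'_def)
  have finR: "finite {k. X k > p \<and> X (Suc k) > p}"
  proof (rule ccontr)
    assume i: "infinite {k. X k > p \<and> X (Suc k) > p}"
    have "(\<lambda>k. (h' ^^ k) (- x)) \<longlonglongrightarrow> - p"
    proof (rule same_side_infinitely_often_imp_convergent[of "- b" "- a" h' "- p"])
      show "continuous_on {- b..- a} h'" unfolding h'_def
        by (intro continuous_intros continuous_on_compose2[OF cont]) auto
      show "h' ` {- b..- a} \<subseteq> {- b..- a}" using maps
        by (auto simp: h'_def image_subset_iff minus_le_iff le_minus_iff)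
      show "infinite {k. (h' ^^ k) (- x) < - p \<and> (h' ^^ Suc k) (- x) < - p}"
        using i unfolding pow X_def by simp
      show "h' q = q" if "q \<in> {- b..- a}" "odd m" "(h' ^^ m) q = q" for q m
      proof -
        have "(h ^^ m) (- q) = - q" using that(3) unfolding pow by simp
        then show ?thesis using od[of "- q" m] that(1,2) by (auto simp: h'_def)
      qed
      show "q = - p" if "q \<in> {- b..- a}" "h' q = q" for q
        using uniq[of "- q"] that by (auto simp: h'_def)
    qed (use p x in \<open>auto simp: h'_def\<close>)
    then have "(\<lambda>k. - (h' ^^ k) (- x)) \<longlonglongrightarrow> - (- p)" by (rule tendsto_minus)
    then show False using nonconv by (simp add: pow)
  qed
  have "finite ({k. X k < p \<and> X (Suc k) < p} \<union> {k. X k > p \<and> X (Suc k) > p})"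
    using finL finR by simp
  then obtain N where N: "\<forall>k \<in> {k. X k < p \<and> X (Suc k) < p} \<union> {k. X k > p \<and> X (Suc k) > p}. k < N"
    unfolding finite_nat_set_iff_bounded by blast
  have flip: "X k < p \<longleftrightarrow> X (Suc k) > p" if "k \<ge> N" for k
  proof -
    have "\<not> (X k < p \<and> X (Suc k) < p)" "\<not> (X k > p \<and> X (Suc k) > p)"
      using N that by (auto dest: bspec)
    then show ?thesis using nep[of k] nep[of "Suc k"] by linarith
  qed
  have "\<exists>K\<ge>N. X K < p"
  proof (cases "X N < p")
    case False
    then have "X (Suc N) < p" using flip[of N] nep[of "Suc N"] by simp
    then show ?thesis by (intro exI[of _ "Suc N"]) simp
  qed auto
  then obtain K where K: "K \<ge> N" "X K < p" by blast
  have "X (2 * j + K) < p" for j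
  proof (induction j)
    case (Suc j)
    have "X (Suc (2 * j + K)) > p" using flip[of "2 * j + K"] Suc K by simp
    then have "X (Suc (Suc (2 * j + K))) < p"
      using flip[of "Suc (2 * j + K)"] K nep[of "Suc (Suc (2 * j + K))"] by force
    then show ?case by simp
  qed (use K in simp)
  then show ?thesis using K(2) Xadd unfolding X_def by (intro exI[of _ K]) (auto simp: funpow_add)
qed

lemma bounded_monotone_convergent:
  fixes Y :: "nat \<Rightarrow> real"
  assumes Y: "\<And>j. Y j \<in> {a..b}"
    and mono: "(\<forall>j. Y j \<le> Y (Suc j)) \<or> (\<forall>j. Y (Suc j) \<le> Y j)"
  shows "convergent Y"
proof -
  have "Y j \<le> b" "a \<le> Y j" for j using Y by auto
  from mono show ?thesis
  proof
    assume "\<forall>j. Y j \<le> Y (Suc j)"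
    then show ?thesis using incseq_convergent[OF incseq_SucI, of Y b] \<open>\<And>j. Y j \<le> b\<close>
      by (metis convergent_def)
  next
    assume "\<forall>j. Y (Suc j) \<le> Y j"
    then show ?thesis using decseq_convergent[OF decseq_SucI, of Y a] \<open>\<And>j. a \<le> Y j\<close>
      by (metis convergent_def)
  qed
qed

text \<open>The orbit alternates between the two sides of the fixed point; on the left side the second
  iterate \<open>G\<close> has one more fixed point \<open>r\<close>. The interval is spanned by extrema of \<open>G\<close>; if it reached
  \<open>p\<close>, then \<open>G\<close> would have a point of period 3.\<close>

lemma renormalization_step:
  fixes h :: "real \<Rightarrow> real"
  assumes cont: "continuous_on {a..b} h" and maps: "h ` {a..b} \<subseteq> {a..b}"
    and p: "p \<in> {a..b}" "h p = p"
    and uniq: "\<And>q. q \<in> {a..b} \<Longrightarrow> h q = q \<Longrightarrow> q = p"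
    and od: "\<And>q m. q \<in> {a..b} \<Longrightarrow> odd m \<Longrightarrow> (h ^^ m) q = q \<Longrightarrow> h q = q"
    and three: "\<And>q. q \<in> {a..b} \<Longrightarrow> (h ^^ 6) q = q \<Longrightarrow> h (h q) = q"
    and two: "\<And>u v. u \<in> {a..b} \<Longrightarrow> v \<in> {a..b} \<Longrightarrow> h (h u) = u \<Longrightarrow> h (h v) = v \<Longrightarrow> u \<noteq> p \<Longrightarrow> v \<noteq> p
       \<Longrightarrow> v = u \<or> v = h u"
    and x: "x \<in> {a..b}"
    and nonconv: "\<And>k. \<not> convergent (\<lambda>j. (h ^^ (2 * j)) ((h ^^ k) x))"
  shows "\<exists>a' b' k r. a \<le> a' \<and> a' \<le> b' \<and> b' < p \<and> (\<lambda>z. h (h z)) ` {a'..b'} \<subseteq> {a'..b'} \<and>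
    (h ^^ k) x \<in> {a'..b'} \<and> h ` {a'..b'} \<inter> {a'..b'} = {} \<and> a < r \<and> r < p \<and> h (h r) = r"
proof -
  define G where "G z = h (h z)" for z
  have nc: "\<not> (\<lambda>k. (h ^^ k) x) \<longlonglongrightarrow> p"
  proof
    assume "(\<lambda>k. (h ^^ k) x) \<longlonglongrightarrow> p"
    then have "((\<lambda>k. (h ^^ k) x) \<circ> (\<lambda>j. 2 * j)) \<longlonglongrightarrow> p"
      by (rule LIMSEQ_subseq_LIMSEQ) (simp add: strict_mono_def)
    then show False using nonconv[of 0] by (auto simp: convergent_def o_def)
  qed
  have "\<exists>K. (h ^^ K) x < p \<and> (\<forall>j. (h ^^ (2 * j)) ((h ^^ K) x) < p)"
    by (rule eventually_alternates[of a b h p x]) (fact cont maps p uniq od x nc)+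
  then obtain K where K: "\<And>j. (h ^^ (2 * j)) ((h ^^ K) x) < p" by blast
  define Y where "Y j = (h ^^ (2 * j)) ((h ^^ K) x)" for j
  have Yp: "Y j < p" for j using K by (simp add: Y_def)
  have Yin: "Y j \<in> {a..b}" for j unfolding Y_def using funpow_mem[OF maps] x by blast
  have YS: "Y (Suc j) = G (Y j)" for j by (simp add: Y_def G_def)
  have Ync: "\<not> convergent (\<lambda>j. Y (j + i))" for i
    using nonconv[of K] convergent_ignore_initial_segment[of Y i] by (simp add: Y_def[abs_def])
  have hin: "h z \<in> {a..b}" if "z \<in> {a..b}" for z using maps that by blast
  have Gin: "G z \<in> {a..b}" if "z \<in> {a..b}" for z unfolding G_def using hin that by blast
  have contG: "continuous_on {a..b} G" unfolding G_def
    by (rule continuous_on_compose2[OF cont cont maps])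
  have contG': "continuous_on {u..v} G" if "a \<le> u" "v \<le> b" for u v
    using contG that by (auto elim: continuous_on_subset)
  have gt1: "z < h z" if z: "z \<in> {a..b}" "z < p" for z
  proof -
    have "z < (h ^^ 1) z"
      by (rule odd_iterate_greater[of a b h p z 1]) (fact cont maps uniq od z | simp)+
    then show ?thesis by simp
  qed
  \<comment> \<open>\<open>two\<close> leaves only \<open>v = h u\<close>; but left of
    \<open>p\<close> the map \<open>h\<close> moves right, so
    \<open>u < h u = v < h v = u\<close>.\<close>
  have Guniq: "u = v" if "u \<in> {a..b}" "v \<in> {a..b}" "G u = u" "G v = v" "u < p" "v < p" for u v
    using two[of u v] that gt1[of u] gt1[of v] unfolding G_def by force
  have inc: "\<not> (\<forall>j. Y (j + i) \<le> Y (Suc j + i))" for i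
    using bounded_monotone_convergent[of "\<lambda>j. Y (j + i)" a b] Ync[of i] Yin by auto
  have dec: "\<not> (\<forall>j. Y (Suc j + i) \<le> Y (j + i))" for i
    using bounded_monotone_convergent[of "\<lambda>j. Y (j + i)" a b] Ync[of i] Yin by auto
  have aG: "a \<le> G a" using Gin[of a] p by auto
  \<comment> \<open>Without such a point \<open>G - id\<close> keeps the sign it has at
    \<open>a\<close>, and \<open>Y\<close> would be monotone. A similar argument fixes the sign
    right of \<open>r\<close>.\<close>
  have "\<exists>r\<in>{a..b}. G r = r \<and> r < p"
  proof (rule ccontr)
    assume n: "\<not> ?thesis"
    have "z \<le> G z" if z: "z \<in> {a..b}" "z < p" for z
    proof (rule ccontr)
      assume "\<not> z \<le> G z"
      then obtain q where "q \<in> {a..z}" "G q = q"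
        using fixed_point_between[of a z G] contG'[of a z] z aG by auto
      then show False using n z by auto
    qed
    then show False using inc[of 0] Yin Yp YS by simp
  qed
  then obtain r where r: "r \<in> {a..b}" "G r = r" "r < p" by blast
  have lr: "z < G z" if z: "z \<in> {a..b}" "z < r" for z
  proof (rule ccontr)
    assume "\<not> z < G z"
    then obtain q where "q \<in> {a..z}" "G q = q"
      using fixed_point_between[of a z G] contG'[of a z] z aG by auto
    then show False using Guniq[of q r] r z by auto
  qed
  have rp: "G z < z" if z: "r < z" "z < p" for z
  proof (rule ccontr)
    assume n: "\<not> G z < z"
    have "y \<le> G y" if y: "y \<in> {a..b}" "y < p" for y
    proof (cases "y \<le> r")
      case True
      then show ?thesis using lr[OF y(1)] r by (cases "y = r") auto
    next
      case False
      show ?thesis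
      proof (rule ccontr)
        assume "\<not> y \<le> G y"
        then obtain q where "q \<in> {min y z..max y z}" "G q = q"
          using fixed_point_between[of "min y z" "max y z" G] contG'[of "min y z" "max y z"] n y z p r
          by (cases "y \<le> z") (auto simp: min_def max_def)
        then show False using Guniq[of q r] r y z p False
          by (auto simp: min_def max_def split: if_splits)
      qed
    qed
    then show False using inc[of 0] Yin Yp YS by simp
  qed
  have Gp: "G p = p" using p by (simp add: G_def)
  obtain c0 where c0: "c0 \<in> {r..p}" "\<And>z. z \<in> {r..p} \<Longrightarrow> G c0 \<le> G z"
    using continuous_attains_inf[of "{r..p}" G] contG'[of r p] r p by auto
  define s0 where "s0 = G c0"
  have s0a: "a \<le> s0" using Gin[of c0] c0(1) r p by (auto simp: s0_def)
  \<comment> \<open>Otherwise \<open>G\<close> maps the points from \<open>r\<close> up to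
    \<open>p\<close> to points not below \<open>r\<close>: an orbit that enters this part decreases
    from then on, and one that never does increases. Either way \<open>Y\<close> would
    converge.\<close>
  have s0r: "s0 < r"
  proof (rule ccontr)
    assume n: "\<not> s0 < r"
    have rinv: "r \<le> G z" if "r \<le> z" "z < p" for z using c0(2)[of z] that n by (auto simp: s0_def)
    show False
    proof (cases "\<exists>i. r \<le> Y i")
      case True
      then obtain i where i: "r \<le> Y i" by blast
      have ge: "r \<le> Y (j + i)" for j by (induction j) (use i rinv Yp YS in auto)
      have "Y (Suc j + i) \<le> Y (j + i)" for j
        using ge[of j] rp[of "Y (j + i)"] Yp[of "j + i"] YS[of "j + i"] r by (cases "r = Y (j + i)") auto
      then show False using dec[of i] by blast
    next
      case False
      then have "Y j \<le> Y (Suc j)" for j using lr[OF Yin, of j] YS by (metis less_imp_le linorder_not_le)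
      then show False using inc[of 0] by simp
    qed
  qed
  have c0': "r < c0" "c0 < p" using c0(1) s0r Gp r(2,3) unfolding s0_def
    by (metis atLeastAtMost_iff less_irrefl order_le_less, metis atLeastAtMost_iff less_asym order_le_less)
  obtain u0 where u0: "u0 \<in> {s0..r}" "\<And>z. z \<in> {s0..r} \<Longrightarrow> G z \<le> G u0"
    using continuous_attains_sup[of "{s0..r}" G] contG'[of s0 r] r p s0r s0a by auto
  define M0 where "M0 = G u0"
  have M0r: "r \<le> M0" using u0(2)[of r] s0r r by (simp add: M0_def)
  \<comment> \<open>Suppose some \<open>u\<close> in \<open>{s0..r}\<close> has
    \<open>G u = p\<close>. Pulling back inside \<open>{c0..p}\<close> yields \<open>du\<close>,
    \<open>eu\<close>, \<open>u\<close>, \<open>p\<close> and \<open>dr\<close>, \<open>er\<close>,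
    \<open>r\<close>, \<open>r\<close> as successive images under \<open>G\<close>. So the third
    iterate of \<open>G\<close> takes \<open>du\<close> up to \<open>p\<close> and \<open>dr\<close>
    down to \<open>r\<close>, and it has a fixed point between them.\<close>
  have M0p: "M0 < p"
  proof (rule ccontr)
    assume "\<not> M0 < p"
    then obtain u where u: "u \<ge> s0" "u \<le> r" "G u = p"
      using IVT2'[of G r p u0] contG'[of u0 r] r p u0(1) s0a unfolding M0_def
      by (metis atLeastAtMost_iff less_imp_le linorder_not_less order_trans)
    have cc: "continuous_on {y..p} G" if "c0 \<le> y" for y using contG'[of y p] that c0' r p by auto
    have le: "c0 \<le> p" using c0' by simp
    obtain eu where eu: "c0 \<le> eu" "eu \<le> p" "G eu = u"
      using IVT'[of G c0 u p] cc[of c0] u Gp r le by (auto simp: s0_def)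
    obtain er where er: "eu \<le> er" "er \<le> p" "G er = r"
      using IVT'[of G eu r p] cc[of eu] u Gp r eu by auto
    obtain du where du: "c0 \<le> du" "du \<le> p" "G du = eu"
      using IVT'[of G c0 eu p] cc[of c0] eu Gp s0r c0' by (auto simp: s0_def)
    obtain dr where dr: "du \<le> dr" "dr \<le> p" "G dr = er"
      using IVT'[of G du er p] cc[of du] eu er du Gp by auto
    have pow3: "(h ^^ 6) z = G (G (G z))" for z by (simp add: G_def numeral_eq_Suc)
    have sub: "{du..dr} \<subseteq> {a..b}" using du dr c0' r p by auto
    have "continuous_on {du..dr} (h ^^ 6)"
      using continuous_on_funpow[OF cont maps] sub by (rule continuous_on_subset)
    moreover have "(h ^^ 6) du = p" "(h ^^ 6) dr = r" using du eu u dr er r by (simp_all add: pow3)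
    ultimately obtain q where q: "q \<in> {du..dr}" "(h ^^ 6) q = q"
      using fixed_point_between[of du dr "h ^^ 6"] du dr c0' by auto
    \<comment> \<open>Being fixed by \<open>G\<close> and right of \<open>r\<close>, the point
      \<open>q\<close> is \<open>p\<close>. This squeezes \<open>dr\<close> to \<open>p\<close>, but
      \<open>p\<close> never reaches \<open>r\<close>.\<close>
    have "G q = q" using three[of q] q sub by (auto simp: G_def)
    moreover have "q > r" using q(1) du c0' by auto
    ultimately have "q = p" using Guniq[of q r] q(1) sub r dr by force
    then have "dr = p" using q(1) dr by simp
    then show False using dr er Gp r by simp
  qed
  have V0: "G z \<in> {s0..M0}" if z: "z \<in> {s0..M0}" for z
  proof (cases "z \<le> r")
    case True
    then show ?thesis using lr[of z] r u0(2)[of z] z s0a p by (cases "z = r") (auto simp: M0_def)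
  next
    case False
    then show ?thesis using rp[of z] c0(2)[of z] M0p z by (auto simp: s0_def)
  qed
  have r0: "r \<in> {s0..M0}" using s0r M0r by simp
  \<comment> \<open>Some \<open>Y i\<close> lies right of \<open>r\<close>, since \<open>Y\<close>
    is not increasing throughout. From there each image is at least \<open>s0\<close>, so avoiding
    the interval means staying above \<open>M0 \<ge> r\<close>, where \<open>Y\<close>
    decreases.\<close>
  have "\<exists>j. Y j \<in> {s0..M0}"
  proof (rule ccontr)
    assume n: "\<not> ?thesis"
    obtain i where i: "\<not> Y i \<le> Y (Suc i)" using inc[of 0] by auto
    then have "r < Y i" using lr[OF Yin, of i] r YS by (metis less_imp_le linorder_neqE_linordered_idom order_refl)
    have "r < Y (j + i)" for j
    proof (induction j)
      case (Suc j)
      have "s0 \<le> Y (Suc j + i)" using c0(2)[of "Y (j + i)"] Suc Yp[of "j + i"] YS by (auto simp: s0_def)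
      then show ?case using n M0r by (metis atLeastAtMost_iff linorder_not_le order_trans)
    qed (use \<open>r < Y i\<close> in simp)
    then have "Y (Suc j + i) \<le> Y (j + i)" for j using rp[of "Y (j + i)"] Yp YS by (simp add: less_imp_le)
    then show False using dec[of i] by blast
  qed
  then obtain j where j: "(h ^^ (2 * j + K)) x \<in> {s0..M0}" by (auto simp: Y_def funpow_add)
  have sub: "{s0..M0} \<subseteq> {a..b}" using s0a M0p p by auto
  have pnot: "h z \<noteq> p" if "z \<in> {s0..M0}" for z
    using V0[OF that] p M0p by (auto simp: G_def)
  have hr: "h r > p"
  proof -
    have "h (h (h r)) = h r" using r(2) by (simp add: G_def)
    moreover have "h r \<noteq> r" using uniq[of r] r by auto
    ultimately have "\<not> h r < p" using Guniq[of "h r" r] hin r by (auto simp: G_def)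
    then show ?thesis using pnot[OF r0] by simp
  qed
  \<comment> \<open>\<open>G\<close> keeps the interval below \<open>p\<close>, so \<open>h\<close>
    cannot take the value \<open>p\<close> on it; its connected image lies on the side of
    \<open>h r\<close>.\<close>
  have "p < h z" if z: "z \<in> {s0..M0}" for z
  proof (rule ccontr)
    assume "\<not> p < h z"
    have "connected (h ` {s0..M0})"
      using connected_continuous_image[OF continuous_on_subset[OF cont sub]] by simp
    then have "p \<in> h ` {s0..M0}"
      using connectedD_interval[of "h ` {s0..M0}" "h z" "h r" p] z r0 hr \<open>\<not> p < h z\<close> by auto
    then show False using pnot by blast
  qed
  then have "h ` {s0..M0} \<inter> {s0..M0} = {}" using M0p by force
  moreover have "(\<lambda>z. h (h z)) ` {s0..M0} \<subseteq> {s0..M0}" using V0 by (auto simp: G_def)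
  moreover have "a < r" "s0 \<le> M0" using s0a s0r M0r by auto
  ultimately show ?thesis using s0a M0p j r(2,3) unfolding G_def by blast
qed

section \<open>Limit sets and attractive fixed points\<close>

text \<open>The times need only tend to infinity, not increase strictly, so shifted times such as
  \<open>r i - 1\<close> can be used directly.\<close>

lemma omega_limit_iff_subsequence:
  "y \<in> omega_limit F x \<longleftrightarrow>
    (\<exists>r. filterlim r at_top sequentially \<and> (\<lambda>i. (F ^^ r i) x) \<longlonglongrightarrow> y)"
proof
  assume "y \<in> omega_limit F x"
  then have "\<forall>i. \<exists>n\<ge>i. dist ((F ^^ n) x) y < inverse (real (Suc i))"
    by (simp add: omega_limit_def)
  from choice[OF this] obtain r
    where r: "\<And>i. r i \<ge> i" "\<And>i. dist ((F ^^ r i) x) y < inverse (real (Suc i))" by blast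
  have "filterlim r at_top sequentially"
    using r(1) by (intro filterlim_at_top_mono[OF filterlim_ident] always_eventually) blast
  moreover have "(\<lambda>i. (F ^^ r i) x) \<longlonglongrightarrow> y"
    by (rule tendsto_dist_iff[THEN iffD2], rule tendsto_sandwich[OF _ _ tendsto_const LIMSEQ_inverse_real_of_nat])
      (intro always_eventually allI zero_le_dist less_imp_le[OF r(2)])+
  ultimately show "\<exists>r. filterlim r at_top sequentially \<and> (\<lambda>i. (F ^^ r i) x) \<longlonglongrightarrow> y" by blast
next
  assume "\<exists>r. filterlim r at_top sequentially \<and> (\<lambda>i. (F ^^ r i) x) \<longlonglongrightarrow> y"
  then obtain r where r: "filterlim r at_top sequentially" "(\<lambda>i. (F ^^ r i) x) \<longlonglongrightarrow> y" by blast
  show "y \<in> omega_limit F x"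
    unfolding omega_limit_def
  proof (intro CollectI allI impI)
    fix e :: real and N :: nat assume "e > 0"
    then have "\<forall>\<^sub>F i in sequentially. dist ((F ^^ r i) x) y < e" using tendstoD[OF r(2)] by blast
    moreover have "\<forall>\<^sub>F i in sequentially. N \<le> r i" using r(1) by (simp add: filterlim_at_top)
    ultimately have "\<forall>\<^sub>F i in sequentially. dist ((F ^^ r i) x) y < e \<and> N \<le> r i"
      by (rule eventually_conj)
    then show "\<exists>n\<ge>N. dist ((F ^^ n) x) y < e"
      by (auto simp: eventually_sequentially)
  qed
qed

lemma compact_orbit_limit_point:
  fixes F :: "real \<Rightarrow> real"
  assumes "compact C" "\<And>i. (F ^^ r i) x \<in> C" "filterlim r at_top sequentially"
  shows "\<exists>q s. strict_mono s \<and> q \<in> C \<and> q \<in> omega_limit F x \<and> (\<lambda>i. (F ^^ r (s i)) x) \<longlonglongrightarrow> q"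
proof -
  obtain q s where qs: "q \<in> C" "strict_mono (s :: nat \<Rightarrow> nat)" "((\<lambda>i. (F ^^ r i) x) \<circ> s) \<longlonglongrightarrow> q"
    using assms(1,2) unfolding compact_def by metis
  have "filterlim (\<lambda>i. r (s i)) at_top sequentially"
    using filterlim_compose[OF assms(3) filterlim_subseq[OF qs(2)]] .
  then have "q \<in> omega_limit F x" using qs(3) by (auto simp: omega_limit_iff_subsequence o_def)
  then show ?thesis using qs by (auto simp: o_def)
qed

lemma omega_limit_subset:
  assumes "closed C" "\<And>n. n \<ge> N \<Longrightarrow> (F ^^ n) x \<in> C"
  shows "omega_limit F x \<subseteq> C"
proof
  fix y assume "y \<in> omega_limit F x"
  then have "\<forall>e>0. \<exists>z\<in>C. dist z y < e" using assms(2) unfolding omega_limit_def by blast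
  then show "y \<in> C" using assms(1) closure_approachable[of y C] by simp
qed

lemma omega_limitD: "y \<in> omega_limit F x \<Longrightarrow> e > 0 \<Longrightarrow> \<exists>n\<ge>N. dist ((F ^^ n) x) y < e"
  unfolding omega_limit_def by blast

lemma closed_omega_limit: "closed (omega_limit F x)"
proof -
  have "y \<in> omega_limit F x" if y: "y \<in> closure (omega_limit F x)" for y
    unfolding omega_limit_def
  proof (intro CollectI allI impI)
    fix e :: real and N :: nat assume e: "e > 0"
    then obtain z where z: "z \<in> omega_limit F x" "dist z y < e/2"
      using y unfolding closure_approachable by (meson half_gt_zero)
    then have "\<exists>n\<ge>N. dist ((F ^^ n) x) z < e/2" using z(1) e omega_limitD[of z F x "e/2" N] by simp
    then obtain n where "n \<ge> N" "dist ((F ^^ n) x) z < e/2" by blast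
    then show "\<exists>n\<ge>N. dist ((F ^^ n) x) y < e"
      using z(2) dist_triangle_half_r[of z "(F ^^ n) x" e y] by (auto simp: dist_commute)
  qed
  then show ?thesis using closure_subset_eq by blast
qed

lemma omega_limit_nonempty:
  fixes F :: "real \<Rightarrow> real"
  assumes "compact C" "\<And>n. (F ^^ n) x \<in> C"
  shows "omega_limit F x \<noteq> {}"
  using compact_orbit_limit_point[of C "\<lambda>n. n" F x] assms filterlim_ident by blast

text \<open>One inclusion is continuity; the other takes a limit of the predecessors of the
  approximating orbit points.\<close>

lemma image_omega_limit:
  fixes F :: "real \<Rightarrow> real"
  assumes C: "compact C" "\<And>n. (F ^^ n) x \<in> C" and F: "continuous_on UNIV F"
  shows "F ` omega_limit F x = omega_limit F x"
proof (rule set_eqI, rule iffI)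
  fix y assume "y \<in> F ` omega_limit F x"
  then obtain z r where z: "y = F z" "filterlim r at_top sequentially" "(\<lambda>i. (F ^^ r i) x) \<longlonglongrightarrow> z"
    by (auto simp: omega_limit_iff_subsequence)
  have "(\<lambda>i. F ((F ^^ r i) x)) \<longlonglongrightarrow> F z"
    using continuous_on_tendsto_compose[OF F z(3)] by simp
  then have "(\<lambda>i. (F ^^ Suc (r i)) x) \<longlonglongrightarrow> y" using z(1) by simp
  moreover have "filterlim (\<lambda>i. Suc (r i)) at_top sequentially"
    using filterlim_compose[OF filterlim_Suc z(2)] .
  ultimately show "y \<in> omega_limit F x" unfolding omega_limit_iff_subsequence by blast
next
  fix y assume "y \<in> omega_limit F x"
  then obtain r where r: "filterlim r at_top sequentially" "(\<lambda>i. (F ^^ r i) x) \<longlonglongrightarrow> y"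
    by (auto simp: omega_limit_iff_subsequence)
  have r1: "filterlim (\<lambda>i. r i - 1) at_top sequentially"
    using filterlim_compose[OF filterlim_minus_const_nat_at_top r(1)] .
  obtain q s where qs: "strict_mono s" "q \<in> omega_limit F x" "(\<lambda>i. (F ^^ (r (s i) - 1)) x) \<longlonglongrightarrow> q"
    using compact_orbit_limit_point[OF C(1) _ r1, of F x] C(2) by blast
  have "(\<lambda>i. F ((F ^^ (r (s i) - 1)) x)) \<longlonglongrightarrow> F q"
    using continuous_on_tendsto_compose[OF F qs(3)] by simp
  moreover have "\<forall>\<^sub>F i in sequentially. F ((F ^^ (r (s i) - 1)) x) = (F ^^ r (s i)) x"
  proof -
    have "\<forall>\<^sub>F i in sequentially. 1 \<le> r (s i)"
      using filterlim_compose[OF r(1) filterlim_subseq[OF qs(1)]] by (simp add: filterlim_at_top)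
    then show ?thesis
    proof eventually_elim
      case (elim i)
      then show ?case by (cases "r (s i)") auto
    qed
  qed
  ultimately have "(\<lambda>i. (F ^^ r (s i)) x) \<longlonglongrightarrow> F q" by (rule Lim_transform_eventually)
  moreover have "(\<lambda>i. (F ^^ r (s i)) x) \<longlonglongrightarrow> y"
    using LIMSEQ_subseq_LIMSEQ[OF r(2) qs(1)] by (simp add: o_def)
  ultimately have "y = F q" using LIMSEQ_unique by blast
  then show "y \<in> F ` omega_limit F x" using qs(2) by blast
qed

lemma orbit_tendsto_if_omega_limit_singleton:
  fixes F :: "real \<Rightarrow> real"
  assumes C: "compact C" "\<And>n. (F ^^ n) x \<in> C" and om: "omega_limit F x \<subseteq> {p}"
  shows "(\<lambda>n. (F ^^ n) x) \<longlonglongrightarrow> p"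
proof (rule ccontr)
  assume "\<not> ?thesis"
  then obtain e where e: "e > 0" "\<And>N. \<exists>n\<ge>N. \<not> dist ((F ^^ n) x) p < e"
    unfolding LIMSEQ_def by blast
  then obtain r where r: "\<And>N. r N \<ge> N" "\<And>N. \<not> dist ((F ^^ r N) x) p < e" by metis
  have rt: "filterlim r at_top sequentially"
    using r(1) by (intro filterlim_at_top_mono[OF filterlim_ident] always_eventually) blast
  obtain q s where qs: "q \<in> omega_limit F x" "(\<lambda>i. (F ^^ r (s i)) x) \<longlonglongrightarrow> q"
    using compact_orbit_limit_point[OF C(1) _ rt, of F x] C(2) by blast
  then have "(\<lambda>i. (F ^^ r (s i)) x) \<longlonglongrightarrow> p" using om by auto
  then have "\<forall>\<^sub>F i in sequentially. dist ((F ^^ r (s i)) x) p < e" using e(1) tendstoD by blast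
  then show False using r(2) by (auto simp: eventually_sequentially)
qed

section \<open>Attractive fixed points on an interval\<close>

lemma orbit_tendsto_fixed_point:
  fixes F :: "real \<Rightarrow> real"
  assumes F: "continuous_on UNIV F" and maps: "F ` {s..t} \<subseteq> {s..t}"
    and p: "p \<in> {s..t}" "F p = p"
    and left: "\<And>z. s \<le> z \<Longrightarrow> z < p \<Longrightarrow> z < F z \<and> z < F (F z)"
    and right: "\<And>z. p < z \<Longrightarrow> z \<le> t \<Longrightarrow> F z < z \<and> F (F z) < z"
    and y: "y \<in> {s..t}"
  shows "(\<lambda>j. (F ^^ j) y) \<longlonglongrightarrow> p"
proof -
  define O' where "O' = omega_limit F y"
  have orb: "(F ^^ n) y \<in> {s..t}" for n using funpow_mem[OF maps y] .
  have sub: "O' \<subseteq> {s..t}" unfolding O'_def using omega_limit_subset[of "{s..t}" 0] orb by blast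
  have comp: "compact O'" using sub closed_omega_limit[of F y]
    by (metis O'_def bounded_closed_interval bounded_subset compact_eq_bounded_closed)
  have ne: "O' \<noteq> {}" using omega_limit_nonempty[of "{s..t}" F y] orb by (simp add: O'_def)
  have im: "F ` O' = O'" unfolding O'_def by (rule image_omega_limit[of "{s..t}"]) (use orb F in auto)
  obtain al where al: "al \<in> O'" "\<And>z. z \<in> O' \<Longrightarrow> al \<le> z" using compact_attains_inf[OF comp ne] by blast
  obtain be where be: "be \<in> O'" "\<And>z. z \<in> O' \<Longrightarrow> z \<le> be" using compact_attains_sup[OF comp ne] by blast
  have "al \<in> F ` O'" "be \<in> F ` O'" using al(1) be(1) im by simp_all
  then obtain u v where u: "u \<in> O'" "F u = al" and v: "v \<in> O'" "F v = be"
    by (auto elim!: imageE)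
  \<comment> \<open>The extremes of \<open>O'\<close> have preimages in \<open>O'\<close>. If the
    minimum \<open>al\<close> is left of \<open>p\<close>, then its preimage \<open>u\<close> is
    right of \<open>p\<close> and the preimage \<open>v\<close> of the maximum is left of it. Some
    \<open>w\<close> in \<open>{v..p}\<close> maps to \<open>u\<close>, and
    \<open>w < F (F w) = al \<le> v\<close> is absurd.\<close>
  have alp: "al \<ge> p"
  proof (rule ccontr)
    assume n: "\<not> al \<ge> p"
    have up: "u > p"
    proof (rule ccontr)
      assume "\<not> u > p"
      then have "u < p" using u n p by (cases "u = p") auto
      then show False using left[of u] u al(2)[of u] sub by auto
    qed
    have vp: "v < p"
    proof (rule ccontr)
      assume "\<not> v < p"
      then have "v > p" using v be(2)[of u] u up p by (cases "v = p") auto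
      then show False using right[of v] v be(2)[of v] sub by auto
    qed
    have "continuous_on {v..p} F" using F continuous_on_subset by blast
    then obtain w where w: "v \<le> w" "w \<le> p" "F w = u"
      using IVT2'[of F p u v] v be(2)[of u] u up vp p by auto
    then have "w < p" using p up by (cases "w = p") auto
    then have "w < al" using left[of w] w u v sub by auto
    then show False using al(2)[of v] v w by simp
  qed
  have "be \<le> p"
  proof (rule ccontr)
    assume n: "\<not> be \<le> p"
    have "v > p" using al(2)[of v] v alp n p by (cases "v = p") auto
    then show False using right[of v] v be(2)[of v] sub by auto
  qed
  then have "omega_limit F y \<subseteq> {p}" using alp al(2) be(2) unfolding O'_def by force
  then show ?thesis using orbit_tendsto_if_omega_limit_singleton[of "{s..t}"] orb by blast
qed

text \<open>\<open>F (F z) - z\<close> cannot change sign on the gap, so one point right of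
  \<open>z\<close> with negative sign suffices: \<open>t0\<close> itself, or a point so close to a
  fixed \<open>t0\<close> that its image is still in the gap and both applications of
  \<open>F\<close> decrease.\<close>

lemma second_iterate_below_on_gap:
  fixes F :: "real \<Rightarrow> real"
  assumes F: "continuous_on UNIV F" and below: "\<And>z. p < z \<Longrightarrow> z < t0 \<Longrightarrow> F z < z"
    and nofix: "\<And>z. p < z \<Longrightarrow> z < t0 \<Longrightarrow> F (F z) \<noteq> z"
    and right: "F t0 = t0 \<or> F (F t0) < t0" and z: "p < z" "z < t0"
  shows "F (F z) < z"
proof (rule ccontr)
  assume n: "\<not> F (F z) < z"
  have "\<exists>w. z < w \<and> w \<le> t0 \<and> F (F w) < w"
  proof (cases "F t0 = t0")
    case True
    have "isCont F t0" using F continuous_on_eq_continuous_at by blast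
    then obtain d where d: "d > 0" "\<And>w. \<bar>w - t0\<bar> < d \<Longrightarrow> \<bar>F w - t0\<bar> < t0 - p"
      using True z unfolding continuous_at_eps_delta dist_real_def by (metis diff_gt_0_iff_gt order_less_trans)
    define w where "w = max ((z + t0) / 2) (t0 - d / 2)"
    have w: "z < w" "w < t0" "\<bar>w - t0\<bar> < d" using z d(1) by (auto simp: w_def max_def field_simps)
    then have "p < F w" "F w < w" using d(2)[of w] below[of w] z by (auto simp: abs_less_iff)
    then have "F (F w) < w" using below[of "F w"] w by auto
    then show ?thesis using w by force
  qed (use right z in auto)
  then obtain w where w: "z < w" "w \<le> t0" "F (F w) < w" by blast
  have "continuous_on {z..w} (\<lambda>z. F (F z))"
    by (rule continuous_on_compose2[OF F continuous_on_subset[OF F]]) auto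
  then obtain q where q: "q \<in> {z..w}" "F (F q) = q"
    using fixed_point_between[of z w "\<lambda>z. F (F z)"] w n by auto
  then have "q < t0" using w by (cases "q = w") auto
  then show False using nofix[of q] q z by auto
qed

text \<open>If \<open>F\<close> takes a point of \<open>{p..t1}\<close> below \<open>p\<close>, with
  minimum \<open>F m\<close>, then \<open>{F m..t1}\<close> works: a point of it left of
  \<open>p\<close> is \<open>F w\<close> for some \<open>w\<close> in \<open>{p..m}\<close>, so its
  image \<open>F (F w)\<close> is at most \<open>w\<close>. The left side is symmetric, and if
  neither side crosses \<open>p\<close>, then \<open>{s1..t1}\<close> itself is invariant.\<close>

lemma local_invariant_interval:
  fixes F :: "real \<Rightarrow> real"
  assumes F: "continuous_on UNIV F" and p: "s0 < p" "p < t0" "F p = p"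
    and left: "\<And>z. s0 < z \<Longrightarrow> z < p \<Longrightarrow> z < F z \<and> z < F (F z)"
    and right: "\<And>z. p < z \<Longrightarrow> z < t0 \<Longrightarrow> F z < z \<and> F (F z) < z"
  shows "\<exists>s t. s0 < s \<and> s < p \<and> p < t \<and> t < t0 \<and> F ` {s..t} \<subseteq> {s..t}"
proof -
  have ct: "continuous_on A F" for A using F continuous_on_subset by blast
  have "isCont F p" using F continuous_on_eq_continuous_at by blast
  then obtain d where "d > 0" and d': "\<And>z. \<bar>z - p\<bar> < d \<Longrightarrow> \<bar>F z - p\<bar> < min (p - s0) (t0 - p)"
    using p unfolding continuous_at_eps_delta dist_real_def by (metis diff_gt_0_iff_gt min_less_iff_conj)
  have d: "d > 0" "\<And>z. \<bar>z - p\<bar> < d \<Longrightarrow> F z \<in> {s0<..<t0}"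
    using \<open>d > 0\<close> d' by (force simp: abs_less_iff)+
  define t1 where "t1 = min ((p + t0) / 2) (p + d / 2)"
  define s1 where "s1 = max ((p + s0) / 2) (p - d / 2)"
  have t1: "p < t1" "t1 < t0" "t1 < p + d" using p d(1) by (auto simp: t1_def min_def)
  have s1: "s1 < p" "s0 < s1" "p - d < s1" using p d(1) by (auto simp: s1_def max_def)
  have Fin: "F z \<in> {s0<..<t0}" if "z \<in> {s1..t1}" for z
    using d(2)[of z] t1 s1 that by (auto simp: abs_less_iff)
  obtain m where m: "m \<in> {p..t1}" "\<And>z. z \<in> {p..t1} \<Longrightarrow> F m \<le> F z"
    using continuous_attains_inf[of "{p..t1}" F] ct t1 by auto
  obtain n where n: "n \<in> {s1..p}" "\<And>z. z \<in> {s1..p} \<Longrightarrow> F z \<le> F n"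
    using continuous_attains_sup[of "{s1..p}" F] ct s1 by auto
  have mp: "F m \<le> p" "s0 < F m" using m(2)[of p] p t1 Fin[of m] m(1) s1 by auto
  have np: "F n \<ge> p" "F n < t0" using n(2)[of p] p s1 Fin[of n] n(1) t1 by auto
  have right': "F z \<le> z" if "z \<in> {p..t1}" for z using right[of z] p t1 that by (cases "z = p") auto
  have left': "z \<le> F z" if "z \<in> {s1..p}" for z using left[of z] p s1 that by (cases "z = p") auto
  consider "F m < p" | "F n > p" | "F m = p" "F n = p" using mp np by linarith
  then show ?thesis
  proof cases
    case 1
    have "F z \<in> {F m..t1}" if z: "z \<in> {F m..t1}" for z
    proof (cases "p \<le> z")
      case True
      then show ?thesis using m(2)[of z] right'[of z] z by auto
    next
      case False
      then obtain w where w: "p \<le> w" "w \<le> m" "F w = z"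
        using IVT2'[of F m z p] m(1) ct p z by auto
      then have "F z \<le> t1" using right[of w] m(1) t1 False p by (cases "w = p") auto
      then show ?thesis using left[of z] z False mp by auto
    qed
    then show ?thesis using 1 mp t1 by blast
  next
    case 2
    have "F z \<in> {s1..F n}" if z: "z \<in> {s1..F n}" for z
    proof (cases "z \<le> p")
      case True
      then show ?thesis using n(2)[of z] left'[of z] z by auto
    next
      case False
      then obtain w where w: "n \<le> w" "w \<le> p" "F w = z"
        using IVT2'[of F p z n] n(1) ct p z by auto
      then have "s1 \<le> F z" using left[of w] n(1) s1 False p by (cases "w = p") auto
      then show ?thesis using right[of z] z False np by auto
    qed
    then show ?thesis using 2 np s1 by blast
  next
    case 3
    have "F z \<in> {s1..t1}" if z: "z \<in> {s1..t1}" for z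
    proof (cases "z \<le> p")
      case True
      then show ?thesis using n(2)[of z] left'[of z] z 3 t1 by auto
    next
      case False
      then show ?thesis using m(2)[of z] right'[of z] z 3 s1 by auto
    qed
    then show ?thesis using s1 t1 by blast
  qed
qed

text \<open>The first point where \<open>F - id\<close> changes sign from + to - is attractive: without points of
  period 2 the signs of \<open>F\<^sup>2 - id\<close> and \<open>F - id\<close> agree next to it.\<close>

lemma exists_attractive_fixed_point:
  fixes F :: "real \<Rightarrow> real"
  assumes F: "continuous_on UNIV F" and cd: "c < d" and maps: "F ` {c..d} \<subseteq> {c<..<d}"
    and fin: "finite {z \<in> {c..d}. F z = z}"
    and two: "\<And>z. z \<in> {c..d} \<Longrightarrow> F (F z) = z \<Longrightarrow> F z = z"
  shows "\<exists>p\<in>{c<..<d}. F p = p \<and> (\<exists>e>0. \<forall>y. \<bar>y - p\<bar> < e \<longrightarrow> (\<lambda>j. (F ^^ j) y) \<longlonglongrightarrow> p)"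
proof -
  have ct: "continuous_on A F" for A using F continuous_on_subset by blast
  define S where "S = {z \<in> {c..d}. F z = z}"
  define A where "A = {z \<in> {c..d}. F z < z}"
  define p where "p = Inf A"
  have Fin: "c < F z \<and> F z < d" if "z \<in> {c..d}" for z using maps that by (auto simp: image_subset_iff)
  have dA: "d \<in> A" using Fin[of d] cd by (simp add: A_def)
  have bdd: "bdd_below A" by (rule bdd_belowI[of _ c]) (simp add: A_def)
  have plow: "p \<le> z" if "z \<in> A" for z unfolding p_def using cInf_lower[OF that bdd] .
  have "c \<le> p" unfolding p_def by (rule cInf_greatest) (use dA in \<open>auto simp: A_def\<close>)
  then have pin: "p \<in> {c..d}" using plow[OF dA] by simp
  have "closed {z. F z \<le> z}" using F by (intro closed_Collect_le continuous_intros)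
  moreover have "A \<subseteq> {z. F z \<le> z}" by (auto simp: A_def)
  ultimately have "closure A \<subseteq> {z. F z \<le> z}" by (intro closure_minimal)
  moreover have "p \<in> closure A" unfolding p_def using closure_contains_Inf[of A] dA bdd by blast
  ultimately have "F p \<le> p" by blast
  moreover have "\<not> F p < p"
  proof
    assume lt: "F p < p"
    have "open {z. F z < z}" using F by (intro open_Collect_less continuous_intros)
    from this[unfolded open_dist, rule_format, of p]
    obtain e where e: "e > 0" "\<And>z. \<bar>z - p\<bar> < e \<Longrightarrow> F z < z"
      using lt by (auto simp: dist_real_def)
    have "c < p" using lt Fin[OF pin] pin by auto
    define z where "z = max c (p - e / 2)"
    have "z < p" "F z < z" "z \<in> {c..d}" using e(2)[of z] e(1) \<open>c < p\<close> pin by (auto simp: z_def)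
    then show False using plow[of z] by (simp add: A_def)
  qed
  ultimately have Fp: "F p = p" by simp
  have cpd: "c < p" "p < d" using Fin[OF pin] Fp by auto
  have Sfin: "finite S" using fin by (simp add: S_def)
  have FF: "F (F z) \<noteq> z" if "z \<in> {c..d}" "z \<notin> S" for z using two[OF that(1)] that by (auto simp: S_def)
  \<comment> \<open>Finiteness isolates \<open>p\<close>: the gap on its right ends at the next
    fixed point or else at \<open>d\<close>, which the second iterate moves left.\<close>
  have "\<exists>t0>p. t0 \<le> d \<and> (F t0 = t0 \<or> F (F t0) < t0) \<and> (\<forall>z. p < z \<and> z < t0 \<longrightarrow> z \<notin> S)"
  proof (cases "S \<inter> {p<..} = {}")
    case True
    then show ?thesis using cpd Fin[of d] Fin[of "F d"] by (intro exI[of _ d]) auto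
  next
    case False
    define m where "m = Min (S \<inter> {p<..})"
    have m: "m \<in> S" "p < m" "\<And>z. z \<in> S \<Longrightarrow> p < z \<Longrightarrow> m \<le> z"
      using Min_in[of "S \<inter> {p<..}"] False Sfin by (auto simp: m_def)
    then have "\<forall>z. p < z \<and> z < m \<longrightarrow> z \<notin> S" by (meson linorder_not_less)
    then show ?thesis using m(1,2) by (intro exI[of _ m]) (simp add: S_def)
  qed
  then obtain t0 where t0: "p < t0" "t0 \<le> d" "F t0 = t0 \<or> F (F t0) < t0"
    "\<And>z. p < z \<Longrightarrow> z < t0 \<Longrightarrow> z \<notin> S" by blast
  have "\<exists>s0<p. c \<le> s0 \<and> (F s0 = s0 \<or> s0 < F (F s0)) \<and> (\<forall>z. s0 < z \<and> z < p \<longrightarrow> z \<notin> S)"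
  proof (cases "S \<inter> {..<p} = {}")
    case True
    then show ?thesis using cpd Fin[of c] Fin[of "F c"] by (intro exI[of _ c]) auto
  next
    case False
    define m where "m = Max (S \<inter> {..<p})"
    have m: "m \<in> S" "m < p" "\<And>z. z \<in> S \<Longrightarrow> z < p \<Longrightarrow> z \<le> m"
      using Max_in[of "S \<inter> {..<p}"] False Sfin by (auto simp: m_def)
    then have "\<forall>z. m < z \<and> z < p \<longrightarrow> z \<notin> S" by (meson linorder_not_less)
    then show ?thesis using m(1,2) by (intro exI[of _ m]) (simp add: S_def)
  qed
  then obtain s0 where s0: "s0 < p" "c \<le> s0" "F s0 = s0 \<or> s0 < F (F s0)"
    "\<And>z. s0 < z \<Longrightarrow> z < p \<Longrightarrow> z \<notin> S" by blast
  have left1: "z < F z" if "s0 < z" "z < p" for z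
  proof -
    have "z \<notin> A" using plow[of z] that by auto
    then have "\<not> F z < z" "F z \<noteq> z" using s0(4)[OF that] that s0(2) cpd by (auto simp: A_def S_def)
    then show ?thesis by simp
  qed
  obtain z1 where z1: "z1 \<in> A" "z1 < t0" using cInf_lessD[of A t0] dA t0(1) by (auto simp: p_def)
  then have pz1: "p < z1" using plow[OF z1(1)] Fp by (cases "z1 = p") (auto simp: A_def)
  have right1: "F z < z" if z: "p < z" "z < t0" for z
  proof (rule ccontr)
    assume n: "\<not> F z < z"
    have "F z1 < z1" using z1 by (simp add: A_def)
    then obtain q where "q \<in> {min z z1..max z z1}" "F q = q"
      using fixed_point_between[of "min z z1" "max z z1" F] ct n
      by (cases "z \<le> z1") (auto simp: min_def max_def)
    then show False using t0(4)[of q] t0(2) z z1 pz1 cpd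
      by (auto simp: S_def min_def max_def split: if_splits)
  qed
  have right2: "F (F z) < z" if "p < z" "z < t0" for z
    using second_iterate_below_on_gap[of F p t0 z] F right1 FF t0 that cpd by auto
  have left2: "z < F (F z)" if z: "s0 < z" "z < p" for z
  proof -
    define F' where "F' y = - F (- y)" for y
    have "F' (F' (- z)) < - z"
    proof (rule second_iterate_below_on_gap[of F' "- p" "- s0"])
      show "continuous_on UNIV F'" unfolding F'_def
        by (intro continuous_intros continuous_on_compose2[OF F]) auto
      show "F' y < y" if "- p < y" "y < - s0" for y using left1[of "- y"] that by (simp add: F'_def)
      show "F' (F' y) \<noteq> y" if "- p < y" "y < - s0" for y
        using FF[of "- y"] s0(4)[of "- y"] that s0 cpd by (auto simp: F'_def)
    qed (use s0 z in \<open>auto simp: F'_def\<close>)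
    then show ?thesis by (simp add: F'_def)
  qed
  obtain s t where st: "s0 < s" "s < p" "p < t" "t < t0" "F ` {s..t} \<subseteq> {s..t}"
    using local_invariant_interval[of F s0 p t0] F s0 t0 Fp left1 left2 right1 right2 by metis
  have "(\<lambda>j. (F ^^ j) y) \<longlonglongrightarrow> p" if y: "\<bar>y - p\<bar> < min (p - s) (t - p)" for y
  proof -
    have "y \<in> {s..t}" using y by (auto simp: abs_less_iff)
    then show ?thesis using orbit_tendsto_fixed_point[of F s t p y] F st Fp left1 left2 right1 right2 by auto
  qed
  then show ?thesis using cpd Fp st by (intro bexI[of _ p] conjI exI[of _ "min (p - s) (t - p)"]) auto
qed

section \<open>Cycles of intervals\<close>

lemma funpow_funpow: "(F ^^ m) ((F ^^ n) z) = (F ^^ (m + n)) z"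
  by (simp add: funpow_add)

lemma funpow_multiple_fixed: "(F ^^ n) q = q \<Longrightarrow> (F ^^ (n * m)) q = q"
  by (induction m) (simp_all add: funpow_add)

lemma period_dvd:
  assumes "periodic_point F q d" "(F ^^ n) q = q"
  shows "d dvd n"
proof (rule ccontr)
  assume "\<not> d dvd n"
  moreover have "d > 0" "(F ^^ d) q = q" using assms(1) by (auto simp: periodic_point_def)
  ultimately have "0 < n mod d" "n mod d < d" "(F ^^ (n mod d)) q = q"
    using funpow_mod_eq[of d F q n] assms(2) by (auto simp: dvd_eq_mod_eq_0)
  then show False using assms(1) unfolding periodic_point_def by blast
qed

lemma exists_period:
  assumes "q \<in> {0..1}" "(F ^^ n) q = q" "n > 0"
  shows "\<exists>d. periodic_point F q d"
proof -
  define d where "d = (LEAST d. d > 0 \<and> (F ^^ d) q = q)"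
  have "d > 0 \<and> (F ^^ d) q = q" unfolding d_def by (rule LeastI[of _ n]) (use assms in auto)
  moreover have "\<not> (m > 0 \<and> (F ^^ m) q = q)" if "m < d" for m
    using not_less_Least that unfolding d_def by blast
  ultimately show ?thesis using assms(1) unfolding periodic_point_def by blast
qed

lemma periodic_point_funpow:
  assumes q: "periodic_point F q n" and i: "(F ^^ i) q \<in> {0..1}"
  shows "periodic_point F ((F ^^ i) q) n"
proof -
  have n: "n > 0" "(F ^^ n) q = q" "\<And>m. 0 < m \<Longrightarrow> m < n \<Longrightarrow> (F ^^ m) q \<noteq> q"
    using q by (auto simp: periodic_point_def)
  have "(F ^^ n) ((F ^^ i) q) = (F ^^ i) ((F ^^ n) q)" by (simp add: funpow_funpow add.commute)
  then have 1: "(F ^^ n) ((F ^^ i) q) = (F ^^ i) q" using n by simp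
  have "(F ^^ m) ((F ^^ i) q) \<noteq> (F ^^ i) q" if m: "0 < m" "m < n" for m
  proof
    assume eq: "(F ^^ m) ((F ^^ i) q) = (F ^^ i) q"
    have le: "i \<le> n * i" using n by simp
    have e: "n * i - i + (m + i) = m + n * i" "n * i - i + i = n * i" using le by simp_all
    \<comment> \<open>Completing to time \<open>n * i\<close>, a multiple of the period, turns an
      early return of the image into an early return of \<open>q\<close>.\<close>
    have "(F ^^ (n * i - i)) ((F ^^ m) ((F ^^ i) q)) = (F ^^ (n * i - i)) ((F ^^ i) q)"
      using eq by simp
    then have "(F ^^ (m + n * i)) q = (F ^^ (n * i)) q" using e by (simp only: funpow_funpow)
    then have "(F ^^ m) q = q" using funpow_multiple_fixed[OF n(2), of i] by (simp add: funpow_add)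
    then show False using n(3) m by blast
  qed
  then show ?thesis using 1 n(1) i unfolding periodic_point_def by blast
qed

lemma eventually_residues:
  assumes m: "m > 0" and ev: "\<And>i. i < m \<Longrightarrow> \<forall>\<^sub>F j in sequentially. P (m * j + i)"
  shows "\<forall>\<^sub>F n::nat in sequentially. P n"
proof -
  have "\<forall>i. \<exists>J. i < m \<longrightarrow> (\<forall>j\<ge>J. P (m * j + i))"
    using ev by (auto simp: eventually_sequentially)
  from choice[OF this] obtain J where J: "\<And>i j. i < m \<Longrightarrow> J i \<le> j \<Longrightarrow> P (m * j + i)" by blast
  \<comment> \<open>The factor \<open>m\<close> makes \<open>n div m\<close> at least every
    \<open>J i\<close> at once.\<close>
  have "P n" if n: "n \<ge> m * (\<Sum>i<m. J i)" for n
  proof -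
    have i: "n mod m < m" using m by simp
    have "J (n mod m) \<le> (\<Sum>i<m. J i)" using i by (intro member_le_sum) auto
    also have "\<dots> = m * (\<Sum>i<m. J i) div m" using m by simp
    also have "\<dots> \<le> n div m" using n by (rule div_le_mono)
    finally show ?thesis using J[OF i] by fastforce
  qed
  then show ?thesis by (auto simp: eventually_sequentially)
qed

text \<open>Along each residue class modulo \<open>m\<close> the orbit converges to one of the
  points \<open>(F ^^ i) q\<close>, so nothing else is a limit point. Contrapositively, an infinite
  omega-limit set supplies the nonconvergence that renormalization requires.\<close>

lemma subsequence_convergent_imp_finite_omega_limit:
  fixes F :: "real \<Rightarrow> real"
  assumes F: "continuous_on UNIV F" and m: "m > 0"
    and conv: "convergent (\<lambda>j. (F ^^ (m * j)) ((F ^^ k) x))"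
  shows "finite (omega_limit F x)"
proof -
  obtain q where q: "(\<lambda>j. (F ^^ (m * j)) ((F ^^ k) x)) \<longlonglongrightarrow> q" using conv by (auto simp: convergent_def)
  have cF: "continuous_on UNIV (F ^^ i)" for i by (rule continuous_on_funpow) (use F in auto)
  have lim: "(\<lambda>j. (F ^^ i) ((F ^^ (m * j)) ((F ^^ k) x))) \<longlonglongrightarrow> (F ^^ i) q" for i
    using continuous_on_tendsto_compose[OF cF q] by simp
  have "omega_limit F x \<subseteq> (\<lambda>i. (F ^^ i) q) ` {..<m}"
  proof (rule ccontr)
    assume "\<not> ?thesis"
    then obtain w where w: "w \<in> omega_limit F x" "w \<notin> (\<lambda>i. (F ^^ i) q) ` {..<m}" by blast
    obtain e where e0: "e > 0" "\<forall>y\<in>(\<lambda>i. (F ^^ i) q) ` {..<m}. y \<noteq> w \<longrightarrow> e \<le> dist w y"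
      using finite_set_avoid[of "(\<lambda>i. (F ^^ i) q) ` {..<m}" w] by blast
    have e: "e > 0" "e \<le> dist w ((F ^^ i) q)" if "i < m" for i
      using e0 w(2) that by auto
    have "\<forall>\<^sub>F n in sequentially. \<exists>l<m. dist ((F ^^ (n + k)) x) ((F ^^ l) q) < e / 2"
    proof (rule eventually_residues[OF m])
      fix i assume i: "i < m"
      have "(F ^^ (m * j + i + k)) x = (F ^^ i) ((F ^^ (m * j)) ((F ^^ k) x))" for j
        unfolding funpow_funpow by (simp add: ac_simps)
      then have "\<forall>\<^sub>F j in sequentially. dist ((F ^^ (m * j + i + k)) x) ((F ^^ i) q) < e / 2"
        using tendstoD[OF lim, of "e / 2" i] e0(1) by simp
      then show "\<forall>\<^sub>F j in sequentially. \<exists>l<m. dist ((F ^^ (m * j + i + k)) x) ((F ^^ l) q) < e / 2"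
        by eventually_elim (use i in blast)
    qed
    then obtain N where N: "\<And>n. n \<ge> N \<Longrightarrow> \<exists>i<m. dist ((F ^^ (n + k)) x) ((F ^^ i) q) < e / 2"
      by (auto simp: eventually_sequentially)
    obtain n where n: "n \<ge> N + k" "dist ((F ^^ n) x) w < e / 2"
      using omega_limitD[OF w(1), of "e / 2" "N + k"] e0(1) by auto
    have nk: "n - k \<ge> N" "n - k + k = n" using n(1) by simp_all
    obtain i where i: "i < m" "dist ((F ^^ n) x) ((F ^^ i) q) < e / 2"
      using N[OF nk(1)] unfolding nk(2) by blast
    then have "dist w ((F ^^ i) q) < e"
      using n(2) dist_triangle_half_r[of "(F ^^ n) x" w e "(F ^^ i) q"] by simp
    then show False using e(2)[OF i(1)] by simp
  qed
  then show ?thesis using finite_surj by blast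
qed

text \<open>An end not mapped to the opposite end goes into the open interval, so a collar there is
  still mapped into \<open>{a..b}\<close>. The collar at the other end is then taken so small that
  its image exceeds \<open>{a..b}\<close> by less than the first collar; this gives the clause on
  second images.\<close>

lemma trapping_neighbourhood:
  fixes F :: "real \<Rightarrow> real"
  assumes F: "continuous_on UNIV F" and ab: "a < b" and maps: "F ` {a..b} \<subseteq> {a..b}"
    and ends: "a < F a" "F b < b" "\<not> (F a = b \<and> F b = a)"
  shows "\<exists>a' b' e. a' < a \<and> b < b' \<and> 0 < e \<and> F ` {a'..b'} \<subseteq> {a' + e..b' - e} \<and>
    (\<forall>z\<in>{a'..b'}. F (F z) \<in> {a..b})"
proof -
  have near: "\<exists>d>0. \<forall>z. \<bar>z - y\<bar> \<le> d \<longrightarrow> l < F z \<and> F z < u" if lu: "l < F y" "F y < u" for y l u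
  proof -
    have "open {z. l < F z}" "open {z. F z < u}"
      using F by (auto intro!: open_Collect_less continuous_intros)
    then have "open ({z. l < F z} \<inter> {z. F z < u})" by blast
    from this[unfolded open_contains_cball, rule_format, of y] lu
    obtain d where "d > 0" "cball y d \<subseteq> {z. l < F z} \<inter> {z. F z < u}" by auto
    then show ?thesis by (intro exI[of _ d]) (auto simp: subset_iff dist_real_def abs_minus_commute)
  qed
  have mab: "a \<le> F z \<and> F z \<le> b" if "a \<le> z" "z \<le> b" for z
    using maps that by (auto simp: image_subset_iff)
  \<comment> \<open>Compactness upgrades the strict inclusion to a margin \<open>e\<close>.\<close>
  have fin: ?thesis if h: "a' < a" "b < b'" "\<And>z. z \<in> {a'..b'} \<Longrightarrow> a' < F z \<and> F z < b'"
    "\<And>z. z \<in> {a'..b'} \<Longrightarrow> F (F z) \<in> {a..b}" for a' b'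
  proof -
    have c: "continuous_on {a'..b'} F" using F continuous_on_subset by blast
    have ne: "{a'..b'} \<noteq> {}" using h(1,2) ab by auto
    obtain m where m: "m \<in> {a'..b'}" "\<And>z. z \<in> {a'..b'} \<Longrightarrow> F m \<le> F z"
      using continuous_attains_inf[OF compact_Icc ne c] by blast
    obtain n where n: "n \<in> {a'..b'}" "\<And>z. z \<in> {a'..b'} \<Longrightarrow> F z \<le> F n"
      using continuous_attains_sup[OF compact_Icc ne c] by blast
    define e where "e = min (F m - a') (b' - F n)"
    have "e > 0" using h(3)[OF m(1)] h(3)[OF n(1)] by (simp add: e_def)
    moreover have "F ` {a'..b'} \<subseteq> {a' + e..b' - e}"
    proof
      fix y assume "y \<in> F ` {a'..b'}"
      then obtain z where "z \<in> {a'..b'}" "y = F z" by blast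
      then show "y \<in> {a' + e..b' - e}" using m(2)[of z] n(2)[of z] by (auto simp: e_def)
    qed
    ultimately show ?thesis using h by blast
  qed
  show ?thesis
  proof (cases "F b = a")
    case False
    then have "a < F b" using mab[of b] ab by auto
    then obtain d where d: "d > 0" "\<And>z. \<bar>z - b\<bar> \<le> d \<Longrightarrow> a < F z \<and> F z < b"
      using near[of a b b] ends by blast
    obtain e where e: "e > 0" "\<And>z. \<bar>z - a\<bar> \<le> e \<Longrightarrow> a < F z \<and> F z < b + d"
      using near[of a a "b + d"] ends mab[of a] ab d(1) by force
    have r: "a \<le> F z \<and> F z < b + d" if "z \<in> {a - e..b + d}" for z
    proof -
      consider "z < a" | "a \<le> z" "z \<le> b" | "b < z" by linarith
      then show ?thesis
      proof cases
        case 1 then show ?thesis using e(2)[of z] that by auto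
      next
        case 2 then show ?thesis using mab[of z] d(1) by auto
      next
        case 3 then show ?thesis using d(2)[of z] d(1) that by auto
      qed
    qed
    have r2: "F y \<in> {a..b}" if "a \<le> y" "y < b + d" for y
    proof (cases "y \<le> b")
      case True then show ?thesis using mab[of y] that by auto
    next
      case False then show ?thesis using d(2)[of y] that by auto
    qed
    show ?thesis
    proof (rule fin[of "a - e" "b + d"])
      show "a - e < F z \<and> F z < b + d" if "z \<in> {a - e..b + d}" for z using r[OF that] e(1) by auto
      show "F (F z) \<in> {a..b}" if "z \<in> {a - e..b + d}" for z using r2 r[OF that] by blast
    qed (use d e in auto)
  next
    case True
    then have "F a < b" using mab[of a] ab ends by auto
    then obtain d where d: "d > 0" "\<And>z. \<bar>z - a\<bar> \<le> d \<Longrightarrow> a < F z \<and> F z < b"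
      using near[of a a b] ends by blast
    obtain e where e: "e > 0" "\<And>z. \<bar>z - b\<bar> \<le> e \<Longrightarrow> a - d < F z \<and> F z < b"
      using near[of "a - d" b b] ends mab[of b] ab d(1) by force
    have r: "a - d < F z \<and> F z \<le> b" if "z \<in> {a - d..b + e}" for z
    proof -
      consider "z < a" | "a \<le> z" "z \<le> b" | "b < z" by linarith
      then show ?thesis
      proof cases
        case 1 then show ?thesis using d(2)[of z] d(1) that by auto
      next
        case 2 then show ?thesis using mab[of z] d(1) by auto
      next
        case 3 then show ?thesis using e(2)[of z] that by auto
      qed
    qed
    have r2: "F y \<in> {a..b}" if "a - d < y" "y \<le> b" for y
    proof (cases "a \<le> y")
      case True then show ?thesis using mab[of y] that by auto
    next
      case False then show ?thesis using d(2)[of y] that by auto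
    qed
    show ?thesis
    proof (rule fin[of "a - d" "b + e"])
      show "a - d < F z \<and> F z < b + e" if "z \<in> {a - d..b + e}" for z using r[OF that] e(1) by auto
      show "F (F z) \<in> {a..b}" if "z \<in> {a - d..b + e}" for z using r2 r[OF that] by blast
    qed (use d e in auto)
  qed
qed

section \<open>Cycles of intervals in the presence of unique periodic orbits\<close>

locale unique_periodic_orbits =
  fixes F :: "real \<Rightarrow> real" and a b x :: real
  assumes cont: "continuous_on UNIV F"
    and range01: "F z \<in> {0..1}"
    and V: "0 \<le> a" "a \<le> b" "b \<le> 1" "F ` {a..b} = {a..b}"
    and period_pow2: "periodic_point F q d \<Longrightarrow> \<exists>n. d = 2 ^ n"
    and orbit_unique: "u \<in> {a..b} \<Longrightarrow> v \<in> {a..b} \<Longrightarrow> periodic_point F u (2 ^ n) \<Longrightarrow>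
      periodic_point F v (2 ^ n) \<Longrightarrow> \<exists>i. v = (F ^^ i) u"
    and x: "x \<in> {a..b}" and infW: "infinite (omega_limit F x)"
begin

text \<open>The last clause asks for a single visit; by invariance it recurs every
  \<open>2 ^ n\<close> steps, so the interval contains points of the omega-limit set.\<close>

definition cycle :: "nat \<Rightarrow> real \<Rightarrow> real \<Rightarrow> bool" where
  "cycle n c d \<longleftrightarrow> a \<le> c \<and> c \<le> d \<and> d \<le> b \<and> (F ^^ 2 ^ n) ` {c..d} \<subseteq> {c..d} \<and>
    (\<forall>i j. i < j \<longrightarrow> j < 2 ^ n \<longrightarrow> (F ^^ i) ` {c..d} \<inter> (F ^^ j) ` {c..d} = {}) \<and>
    (\<exists>k. (F ^^ k) x \<in> {c..d})"

lemma cont_funpow: "continuous_on S (F ^^ i)"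
proof -
  have "continuous_on UNIV (F ^^ i)" by (rule continuous_on_funpow) (use cont in auto)
  then show ?thesis using continuous_on_subset by blast
qed

lemma funpow_in_V: "z \<in> {a..b} \<Longrightarrow> (F ^^ i) z \<in> {a..b}"
  using funpow_mem[of F "{a..b}"] V(4) by blast

lemma V_subset: "z \<in> {a..b} \<Longrightarrow> z \<in> {0..1}"
  using V by auto

text \<open>The period is a power of 2, hence coprime to \<open>m\<close>, hence a divisor of
  \<open>2 ^ j\<close>. With \<open>m = 3\<close> this excludes points of period 3 for the second
  iterate in \<open>renormalization_step\<close>.\<close>

lemma odd_factor:
  assumes q: "q \<in> {a..b}" "(F ^^ (2 ^ j * m)) q = q" "odd m"
  shows "(F ^^ 2 ^ j) q = q"
proof -
  have "2 ^ j * m > 0" using q(3) odd_pos by simp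
  then obtain d where d: "periodic_point F q d" using exists_period[OF V_subset[OF q(1)] q(2)] by blast
  then obtain n where n: "d = 2 ^ n" using period_pow2 by blast
  have "coprime d m" using n q(3) by (simp add: coprime_power_left_iff)
  then have "d dvd 2 ^ j" using period_dvd[OF d q(2)] by (simp add: coprime_dvd_mult_left_iff)
  then show ?thesis using d funpow_multiple_fixed[of d F q] by (auto simp: periodic_point_def dvd_def)
qed

lemma cycle_period:
  assumes c: "cycle n c d" and q: "q \<in> {c..d}" "(F ^^ 2 ^ n) q = q"
  shows "periodic_point F q (2 ^ n)"
proof -
  have "(F ^^ m) q \<noteq> q" if "0 < m" "m < 2 ^ n" for m
  proof
    assume "(F ^^ m) q = q"
    then have "q \<in> (F ^^ 0) ` {c..d} \<inter> (F ^^ m) ` {c..d}" using q(1) by force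
    then show False using c that unfolding cycle_def by blast
  qed
  moreover have "q \<in> {0..1}" using c q(1) V by (auto simp: cycle_def)
  ultimately show ?thesis using q(2) by (simp add: periodic_point_def)
qed

lemma cycle_return:
  assumes c: "cycle n c d" and u: "u \<in> {c..d}" "(F ^^ i) u \<in> {c..d}"
  shows "2 ^ n dvd i"
proof (rule ccontr)
  assume n: "\<not> 2 ^ n dvd i"
  define i0 where "i0 = i mod 2 ^ n"
  have i0: "0 < i0" "i0 < 2 ^ n" using n by (auto simp: i0_def dvd_eq_mod_eq_0)
  have "(F ^^ (2 ^ n * (i div 2 ^ n))) u \<in> {c..d}"
    using funpow_mem[of "F ^^ 2 ^ n" "{c..d}" u] c u by (simp add: cycle_def funpow_mult)
  moreover have "(F ^^ i) u = (F ^^ i0) ((F ^^ (2 ^ n * (i div 2 ^ n))) u)"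
    by (simp add: funpow_funpow i0_def)
  ultimately have "(F ^^ i) u \<in> (F ^^ 0) ` {c..d} \<inter> (F ^^ i0) ` {c..d}" using u(2) by auto
  then show False using c i0 unfolding cycle_def by blast
qed

text \<open>Both points lie on the one orbit of period \<open>2 ^ n\<close>, and by disjointness of
  the images a return to the interval takes a multiple of \<open>2 ^ n\<close> steps.\<close>

lemma cycle_fixed_unique:
  assumes c: "cycle n c d" and p: "p \<in> {c..d}" "(F ^^ 2 ^ n) p = p"
    and q: "q \<in> {c..d}" "(F ^^ 2 ^ n) q = q"
  shows "q = p"
proof -
  have sub: "{c..d} \<subseteq> {a..b}" using c by (auto simp: cycle_def)
  obtain i where i: "q = (F ^^ i) p"
    using orbit_unique[of p q n] cycle_period[OF c p] cycle_period[OF c q] p q sub by blast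
  then have "2 ^ n dvd i" using cycle_return[OF c p(1), of i] q(1) by simp
  then show ?thesis using i funpow_multiple_fixed[OF p(2)] by (auto simp: dvd_def)
qed

text \<open>The exact period of such points divides \<open>2 ^ Suc n\<close> but not
  \<open>2 ^ n\<close>, so they share one orbit. Returns take multiples of \<open>2 ^ n\<close>
  steps, so this orbit has only two points in the interval.\<close>

lemma cycle_two_periodic_unique:
  assumes c: "cycle n c d" and u: "u \<in> {c..d}" "(F ^^ 2 ^ n) ((F ^^ 2 ^ n) u) = u"
    "(F ^^ 2 ^ n) u \<noteq> u"
    and v: "v \<in> {c..d}" "(F ^^ 2 ^ n) ((F ^^ 2 ^ n) v) = v" "(F ^^ 2 ^ n) v \<noteq> v"
  shows "v = u \<or> v = (F ^^ 2 ^ n) u"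
proof -
  have sub: "{c..d} \<subseteq> {a..b}" using c by (auto simp: cycle_def)
  have per: "periodic_point F z (2 ^ Suc n)"
    if z: "z \<in> {c..d}" "(F ^^ 2 ^ n) ((F ^^ 2 ^ n) z) = z" "(F ^^ 2 ^ n) z \<noteq> z" for z
  proof -
    have z2: "(F ^^ 2 ^ Suc n) z = z" using z(2) by (simp add: funpow_funpow mult_2)
    obtain e where e: "periodic_point F z e"
      using exists_period[of z "2 ^ Suc n" F] z2 V_subset sub z(1) by auto
    obtain k where k: "e = 2 ^ k" using period_pow2[OF e] by blast
    have "(2::nat) ^ k dvd 2 ^ Suc n" using period_dvd[OF e z2] unfolding k .
    then have "k \<le> Suc n" by (rule power_dvd_imp_le) simp
    moreover have "\<not> k \<le> n"
    proof
      assume "k \<le> n"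
      then have "2 ^ n = e * 2 ^ (n - k)" using k by (simp add: power_add[symmetric])
      then show False using z(3) e funpow_multiple_fixed[of e F z] by (simp add: periodic_point_def)
    qed
    ultimately show ?thesis using e k by (simp add: le_Suc_eq)
  qed
  obtain i where i: "v = (F ^^ i) u"
    using orbit_unique[of u v "Suc n"] per[OF u] per[OF v] u v sub by blast
  then have "2 ^ n dvd i" using cycle_return[OF c u(1), of i] v(1) by simp
  then obtain l where l: "i = 2 ^ n * l" by (auto simp: dvd_def)
  have u2: "(F ^^ (2 ^ n * 2)) u = u" using u(2) by (simp add: funpow_funpow mult_2_right)
  have *: "i = 2 ^ n * (l mod 2) + 2 ^ n * 2 * (l div 2)"
  proof -
    have "2 ^ n * (l mod 2) + 2 ^ n * 2 * (l div 2) = 2 ^ n * (l mod 2 + 2 * (l div 2))"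
      by (simp only: distrib_left mult.assoc)
    then show ?thesis by (simp only: l mod_mult_div_eq)
  qed
  then have "v = (F ^^ (2 ^ n * (l mod 2))) ((F ^^ (2 ^ n * 2 * (l div 2))) u)"
    unfolding i funpow_funpow using * by simp
  then have "v = (F ^^ (2 ^ n * (l mod 2))) u" using funpow_multiple_fixed[OF u2] by simp
  then show ?thesis by (cases "even l") (auto simp: odd_iff_mod_2_eq_one even_iff_mod_2_eq_zero)
qed

lemma not_convergent:
  assumes "m > 0"
  shows "\<not> convergent (\<lambda>j. (F ^^ (m * j)) ((F ^^ k) x))"
  using subsequence_convergent_imp_finite_omega_limit[OF cont assms] infW by blast

lemma cycle_step:
  assumes c: "cycle n c d"
  defines "h \<equiv> F ^^ 2 ^ n"
  shows "\<exists>p c' d' k r. p \<in> {c..d} \<and> h p = p \<and> c \<le> c' \<and> c' \<le> d' \<and> d' < p \<and>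
    (\<lambda>z. h (h z)) ` {c'..d'} \<subseteq> {c'..d'} \<and> (F ^^ k) x \<in> {c'..d'} \<and>
    h ` {c'..d'} \<inter> {c'..d'} = {} \<and> c < r \<and> r < p \<and> h (h r) = r"
proof -
  have cd: "a \<le> c" "c \<le> d" "d \<le> b" "h ` {c..d} \<subseteq> {c..d}" using c by (auto simp: cycle_def h_def)
  have sub: "{c..d} \<subseteq> {a..b}" using cd by auto
  obtain k0 where k0: "(F ^^ k0) x \<in> {c..d}" using c by (auto simp: cycle_def)
  have ch: "continuous_on {c..d} h" unfolding h_def by (rule cont_funpow)
  have "h c \<in> {c..d}" "h d \<in> {c..d}" using cd by (auto simp: image_subset_iff)
  then obtain p where p: "p \<in> {c..d}" "h p = p" using fixed_point_between[OF ch cd(2)] by auto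
  have hm: "h ^^ m = F ^^ (2 ^ n * m)" for m by (simp add: h_def funpow_mult)
  have uniq: "q = p" if "q \<in> {c..d}" "h q = q" for q
    using cycle_fixed_unique[OF c p(1) _ that(1)] p(2) that(2) by (simp add: h_def)
  have "\<exists>a' b' k r. c \<le> a' \<and> a' \<le> b' \<and> b' < p \<and> (\<lambda>z. h (h z)) ` {a'..b'} \<subseteq> {a'..b'} \<and>
    (h ^^ k) ((F ^^ k0) x) \<in> {a'..b'} \<and> h ` {a'..b'} \<inter> {a'..b'} = {} \<and> c < r \<and> r < p \<and> h (h r) = r"
  proof (rule renormalization_step[OF ch cd(4) p])
    show "q = p" if "q \<in> {c..d}" "h q = q" for q using uniq that .
    show "h q = q" if "q \<in> {c..d}" "odd m" "(h ^^ m) q = q" for q m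
      using odd_factor[of q n m] that sub unfolding hm by (auto simp: h_def)
    \<comment> \<open>The sixth iterate of \<open>h\<close> is the iterate of \<open>F\<close> of
      order \<open>2 ^ Suc n * 3\<close>.\<close>
    show "h (h q) = q" if "q \<in> {c..d}" "(h ^^ 6) q = q" for q
      using odd_factor[of q "Suc n" 3] that sub unfolding hm
      by (auto simp: h_def funpow_funpow mult_2 mult.commute[of 6] mult.assoc)
    show "v = u \<or> v = h u" if "u \<in> {c..d}" "v \<in> {c..d}" "h (h u) = u" "h (h v) = v" "u \<noteq> p" "v \<noteq> p" for u v
      using cycle_two_periodic_unique[OF c, of u v] uniq[of u] uniq[of v] that unfolding h_def by blast
    show "(F ^^ k0) x \<in> {c..d}" by (rule k0)
    show "\<not> convergent (\<lambda>j. (h ^^ (2 * j)) ((h ^^ k) ((F ^^ k0) x)))" for k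
    proof -
      have "(h ^^ (2 * j)) ((h ^^ k) ((F ^^ k0) x)) = (F ^^ (2 ^ n * 2 * j)) ((F ^^ (2 ^ n * k + k0)) x)" for j
        unfolding hm funpow_funpow by (simp add: mult.assoc)
      then show ?thesis using not_convergent[of "2 ^ n * 2" "2 ^ n * k + k0"] by simp
    qed
  qed
  then obtain c' d' k r where *: "c \<le> c'" "c' \<le> d'" "d' < p" "(\<lambda>z. h (h z)) ` {c'..d'} \<subseteq> {c'..d'}"
    "(h ^^ k) ((F ^^ k0) x) \<in> {c'..d'}" "h ` {c'..d'} \<inter> {c'..d'} = {}" "c < r" "r < p" "h (h r) = r"
    by blast
  have "(F ^^ (2 ^ n * k + k0)) x \<in> {c'..d'}" using *(5) unfolding hm funpow_funpow .
  then show ?thesis using * p by blast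
qed

lemma cycle_0: "cycle 0 a b"
  using V x unfolding cycle_def by (auto intro!: exI[of _ 0])

lemma cycle_exists: "\<exists>c d. cycle n c d"
proof (induction n)
  case 0
  then show ?case using cycle_0 by blast
next
  case (Suc n)
  then obtain c d where c: "cycle n c d" by blast
  define h where "h = F ^^ 2 ^ n"
  obtain p c' d' k where s: "p \<in> {c..d}" "c \<le> c'" "c' \<le> d'" "d' < p"
    "(\<lambda>z. h (h z)) ` {c'..d'} \<subseteq> {c'..d'}" "(F ^^ k) x \<in> {c'..d'}" "h ` {c'..d'} \<inter> {c'..d'} = {}"
    using cycle_step[OF c] unfolding h_def by blast
  have sub: "{c'..d'} \<subseteq> {c..d}" using s by auto
  have hh: "(F ^^ 2 ^ Suc n) z = h (h z)" for z by (simp add: h_def funpow_funpow mult_2)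
  have "(F ^^ i) ` {c'..d'} \<inter> (F ^^ j) ` {c'..d'} = {}" if ij: "i < j" "j < 2 ^ Suc n" for i j
  proof (rule ccontr)
    assume "(F ^^ i) ` {c'..d'} \<inter> (F ^^ j) ` {c'..d'} \<noteq> {}"
    then obtain u v where uv: "u \<in> {c'..d'}" "v \<in> {c'..d'}" "(F ^^ i) u = (F ^^ j) v" by blast
    \<comment> \<open>\<open>m\<close> completes \<open>j\<close> to a full turn. A common point of
      two images gives a return to \<open>{c..d}\<close> after \<open>m + i < 2 ^ Suc n\<close>
      steps, which must be \<open>2 ^ n\<close> steps; but \<open>h\<close> moves
      \<open>{c'..d'}\<close> off itself.\<close>
    define m where "m = 2 ^ Suc n - j"
    have m: "m + j = 2 ^ Suc n" using ij by (simp add: m_def)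
    have "(F ^^ (m + i)) u = (F ^^ (m + j)) v" using uv(3) by (simp add: funpow_add)
    then have e: "(F ^^ (m + i)) u = h (h v)" unfolding m hh .
    have hv: "h (h v) \<in> {c'..d'}" using s(5) uv(2) by blast
    then have "(F ^^ (m + i)) u \<in> {c..d}" using e sub by auto
    then have "2 ^ n dvd m + i" using cycle_return[OF c, of u "m + i"] uv(1) sub by blast
    then obtain t where t: "m + i = 2 ^ n * t" by (auto simp: dvd_def)
    have "m + i < 2 ^ n * 2" "m + i > 0" using m ij by auto
    then have "t < 2" "t > 0" unfolding t by simp_all
    then have "m + i = 2 ^ n" using t by (cases "t = 1") auto
    then have "h u \<in> {c'..d'}" using e hv by (simp add: h_def)
    then show False using s(7) uv(1) by blast
  qed
  moreover have "(F ^^ 2 ^ Suc n) ` {c'..d'} \<subseteq> {c'..d'}" using s(5) hh by auto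
  ultimately have "cycle (Suc n) c' d'" using c s unfolding cycle_def by auto
  then show ?case by blast
qed

lemma trapping: "\<exists>a' b' e. a' < a \<and> b < b' \<and> 0 < e \<and> F ` {a'..b'} \<subseteq> {a' + e..b' - e} \<and>
    (\<forall>z\<in>{a'..b'}. F (F z) \<in> {a..b})"
proof -
  obtain p r where p: "p \<in> {a..b}" "F p = p" and r: "a < r" "r < p" "F (F r) = r"
    using cycle_step[OF cycle_0] by auto
  have uniq: "q = p" if "q \<in> {a..b}" "F q = q" for q
    using cycle_fixed_unique[OF cycle_0, of p q] p that by simp
  have Vin: "F z \<in> {a..b}" if "z \<in> {a..b}" for z using V(4) that by blast
  have gt: "z < F z" if z: "a \<le> z" "z < p" for z
  proof (rule ccontr)
    assume "\<not> z < F z"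
    then obtain q where "q \<in> {a..z}" "F q = q"
      using fixed_point_between[of a z F] continuous_on_subset[OF cont] z Vin[of a] V(2) by auto
    then show False using uniq[of q] z p by auto
  qed
  \<comment> \<open>Surjectivity on \<open>{a..b}\<close> yields a point right of \<open>p\<close>:
    a preimage of \<open>a\<close> cannot be left of \<open>p\<close>, where \<open>F\<close> moves
    right. So \<open>p\<close> is interior and neither end is fixed.\<close>
  have "a \<in> F ` {a..b}" using V by auto
  then obtain z where z: "z \<in> {a..b}" "F z = a" by auto
  have "\<not> z < p" using gt[of z] z by auto
  moreover have "z \<noteq> p" using z p r by auto
  ultimately have "z > p" by simp
  then have pb: "p < b" using z(1) by auto
  have "F b < b" using uniq[of b] Vin[of b] pb V(2) by (cases "F b = b") auto
  moreover have "a < F a" using gt[of a] r by auto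
  \<comment> \<open>Swapped ends would be the only pair of period 2, but \<open>r\<close> is another
    such point.\<close>
  moreover have "\<not> (F a = b \<and> F b = a)"
  proof
    assume ab: "F a = b \<and> F b = a"
    have "F r \<noteq> r" using uniq[of r] r p by auto
    then have "r = a \<or> r = F a"
      using cycle_two_periodic_unique[OF cycle_0, of a r] ab r pb p by auto
    then show False using ab r pb by auto
  qed
  ultimately show ?thesis using trapping_neighbourhood[OF cont, of a b] V r pb by auto
qed

lemma funpow_omega: "w \<in> omega_limit F x \<Longrightarrow> (F ^^ i) w \<in> omega_limit F x"
proof -
  have "F ` omega_limit F x = omega_limit F x"
    by (rule image_omega_limit[of "{a..b}"]) (use funpow_in_V[OF x] cont in auto)
  then have "F ` omega_limit F x \<subseteq> omega_limit F x" by simp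
  then show "w \<in> omega_limit F x \<Longrightarrow> (F ^^ i) w \<in> omega_limit F x" by (rule funpow_mem)
qed

text \<open>Pigeonhole by length: otherwise the \<open>2 ^ n\<close> segments between
  \<open>(F ^^ i) q\<close> and \<open>(F ^^ i) w\<close> would be disjoint, contained in
  \<open>{0..1}\<close> and each of length at least \<open>e\<close>.\<close>

lemma periodic_near_omega_limit:
  assumes e: "1 < 2 ^ n * e"
  shows "\<exists>q w. q \<in> {a..b} \<and> periodic_point F q (2 ^ n) \<and> w \<in> omega_limit F x \<and> \<bar>w - q\<bar> < e"
proof (rule ccontr)
  assume neg: "\<not> ?thesis"
  have e0: "e > 0" using e by (smt (verit) mult_nonneg_nonpos zero_le_power)
  obtain c d where c: "cycle n c d" using cycle_exists by blast
  have cd: "a \<le> c" "c \<le> d" "d \<le> b" "(F ^^ 2 ^ n) ` {c..d} \<subseteq> {c..d}" using c by (auto simp: cycle_def)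
  have sub: "{c..d} \<subseteq> {a..b}" using cd by auto
  have "(F ^^ 2 ^ n) c \<in> {c..d}" "(F ^^ 2 ^ n) d \<in> {c..d}" using cd by (auto simp: image_subset_iff)
  then obtain q where q: "q \<in> {c..d}" "(F ^^ 2 ^ n) q = q"
    using fixed_point_between[OF cont_funpow cd(2), of "2 ^ n"] by auto
  obtain k where k: "(F ^^ k) x \<in> {c..d}" using c by (auto simp: cycle_def)
  have orb: "(F ^^ (2 ^ n * j + k)) x \<in> {c..d}" for j
    using funpow_mem[OF cd(4) k, of j] by (simp add: funpow_mult funpow_add)
  have "filterlim (\<lambda>j. 2 ^ n * j + k) at_top sequentially"
    by (rule filterlim_subseq) (simp add: strict_mono_def)
  then obtain w where w: "w \<in> {c..d}" "w \<in> omega_limit F x"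
    using compact_orbit_limit_point[of "{c..d}" "\<lambda>j. 2 ^ n * j + k" F x] orb by auto
  define I where "I i = {min ((F ^^ i) q) ((F ^^ i) w)..max ((F ^^ i) q) ((F ^^ i) w)}" for i
  have len: "measure lborel (I i) \<ge> e" for i
  proof -
    have "(F ^^ i) q \<in> {a..b}" using funpow_in_V q(1) sub by blast
    moreover from this have "periodic_point F ((F ^^ i) q) (2 ^ n)"
      using periodic_point_funpow[OF cycle_period[OF c q], of i] V_subset by blast
    ultimately have "\<not> \<bar>(F ^^ i) w - (F ^^ i) q\<bar> < e" using neg funpow_omega[OF w(2), of i] by blast
    then show ?thesis by (auto simp: I_def min_def max_def)
  qed
  have Isub: "I i \<subseteq> (F ^^ i) ` {c..d}" for i
  proof
    fix y assume y: "y \<in> I i"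
    have "connected ((F ^^ i) ` {c..d})" using connected_continuous_image[OF cont_funpow] by simp
    moreover have "(F ^^ i) q \<in> (F ^^ i) ` {c..d}" "(F ^^ i) w \<in> (F ^^ i) ` {c..d}" using q(1) w(1) by blast+
    ultimately show "y \<in> (F ^^ i) ` {c..d}"
      using connectedD_interval[of "(F ^^ i) ` {c..d}" "(F ^^ i) q" "(F ^^ i) w" y]
        connectedD_interval[of "(F ^^ i) ` {c..d}" "(F ^^ i) w" "(F ^^ i) q" y] y
      by (simp add: I_def min_def max_def split: if_splits)
  qed
  have "disjoint_family_on I {..<2 ^ n}"
    unfolding disjoint_family_on_def
  proof (intro ballI impI)
    fix i j :: nat assume ij: "i \<in> {..<2 ^ n}" "j \<in> {..<2 ^ n}" "i \<noteq> j"
    have dis: "(F ^^ k) ` {c..d} \<inter> (F ^^ l) ` {c..d} = {}" if "k < l" "l < 2 ^ n" for k l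
      using c that by (simp add: cycle_def)
    have "(F ^^ i) ` {c..d} \<inter> (F ^^ j) ` {c..d} = {}"
      using dis[of i j] dis[of j i] ij by (cases "i < j") (simp_all add: Int_commute)
    then show "I i \<inter> I j = {}" using Int_mono[OF Isub[of i] Isub[of j]] by simp
  qed
  moreover have "I i \<in> sets lborel" "emeasure lborel (I i) \<noteq> \<infinity>" for i by (simp_all add: I_def)
  ultimately have "measure lborel (\<Union>i\<in>{..<2 ^ n}. I i) = (\<Sum>i<2 ^ n. measure lborel (I i))"
    by (intro measure_finite_Union) auto
  also have "\<dots> \<ge> (\<Sum>i<(2::nat) ^ n. e)" by (intro sum_mono len)
  finally have "measure lborel (\<Union>i\<in>{..<2 ^ n}. I i) \<ge> 2 ^ n * e" by simp
  moreover have "measure lborel (\<Union>i\<in>{..<2 ^ n}. I i) \<le> measure lborel {0..1::real}"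
  proof (rule measure_mono_fmeasurable)
    show "(\<Union>i\<in>{..<2 ^ n}. I i) \<subseteq> {0..1}"
    proof
      fix y assume "y \<in> (\<Union>i\<in>{..<2 ^ n}. I i)"
      then obtain i where "y \<in> I i" by blast
      then obtain z where "y = (F ^^ i) z" "z \<in> {c..d}" using subsetD[OF Isub] by blast
      then show "y \<in> {0..1}" using V_subset[OF funpow_in_V[of z i]] sub by blast
    qed
  qed (simp_all add: I_def fmeasurable_def)
  ultimately show False using e by simp
qed

end

section \<open>Chains\<close>

text \<open>A chain has at least one step and its errors are strictly below \<open>e\<close>.
  Strictness makes the reached set open and leaves the tolerance used in
  \<open>reach_control\<close>.\<close>

inductive reach :: "(real \<Rightarrow> real) \<Rightarrow> real \<Rightarrow> real \<Rightarrow> real \<Rightarrow> bool" for F e y where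
  first: "\<bar>z - F y\<bar> < e \<Longrightarrow> reach F e y z"
| extend: "reach F e y u \<Longrightarrow> \<bar>z - F u\<bar> < e \<Longrightarrow> reach F e y z"

lemma reach_trans: "reach F e u z \<Longrightarrow> reach F e y u \<Longrightarrow> reach F e y z"
  by (induction rule: reach.induct) (auto intro: reach.intros)

lemma reach_funpow: "reach F e y z \<Longrightarrow> e > 0 \<Longrightarrow> reach F e y ((F ^^ n) z)"
  by (induction n) (auto intro: reach.extend)

lemma reach_funpow_Suc: "e > 0 \<Longrightarrow> reach F e y ((F ^^ Suc n) y)"
  by (induction n) (auto intro: reach.intros)

lemma open_reach: "open {z. reach F e y z}"
  unfolding open_dist
proof safe
  fix z assume "reach F e y z"
  then obtain c where c: "\<bar>z - c\<bar> < e" "\<And>z'. \<bar>z' - c\<bar> < e \<Longrightarrow> reach F e y z'"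
    by (cases rule: reach.cases) (auto intro: reach.intros)
  have "reach F e y z'" if "dist z' z < e - \<bar>z - c\<bar>" for z'
    by (rule c(2)) (use that in \<open>simp add: dist_real_def\<close>)
  then show "\<exists>d>0. \<forall>z'. dist z' z < d \<longrightarrow> z' \<in> {z. reach F e y z}"
    using c(1) by (intro exI[of _ "e - \<bar>z - c\<bar>"]) simp
qed

text \<open>The error of the last step absorbs the distance to a limit point, so even the closure of
  the reached set is mapped into it.\<close>

lemma reach_image_closure:
  assumes F: "continuous_on UNIV F" and e: "e > 0" and z: "z \<in> closure {z. reach F e y z}"
  shows "reach F e y (F z)"
proof -
  have "isCont F z" using F continuous_on_eq_continuous_at by blast
  then obtain d where d: "d > 0" "\<And>u. \<bar>u - z\<bar> < d \<Longrightarrow> \<bar>F u - F z\<bar> < e"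
    using e unfolding continuous_at_eps_delta dist_real_def by blast
  obtain u where "reach F e y u" "dist u z < d" using z d(1) closure_approachable[of z] by auto
  then show ?thesis using d(2)[of u] reach.extend[of F e y u "F z"]
    by (simp add: dist_real_def abs_minus_commute)
qed

lemma reach_trapped:
  assumes "reach F e y z" "F ` {a'..b'} \<subseteq> {a' + e'..b' - e'}" "e \<le> e'" "y \<in> {a'..b'}"
  shows "z \<in> {a'..b'}"
  using assms(1)
proof induction
  case (first z)
  have "F y \<in> {a' + e'..b' - e'}" using assms by blast
  then show ?case using first assms(3) by auto
next
  case (extend u z)
  have "F u \<in> {a' + e'..b' - e'}" using extend.IH assms by blast
  then show ?case using extend assms(3) by auto
qed

lemma orbit_tendsto_of_subsequence:
  fixes h :: "real \<Rightarrow> real"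
  assumes h: "continuous_on UNIV h" and p: "h p = p" and M: "M > 0"
    and lim: "(\<lambda>j. (h ^^ (M * j)) y) \<longlonglongrightarrow> p"
  shows "(\<lambda>j. (h ^^ j) y) \<longlonglongrightarrow> p"
proof (rule tendstoI)
  fix e :: real assume e: "e > 0"
  show "\<forall>\<^sub>F n in sequentially. dist ((h ^^ n) y) p < e"
  proof (rule eventually_residues[OF M])
    fix i
    have "continuous_on UNIV (h ^^ i)" by (rule continuous_on_funpow) (use h in auto)
    from continuous_on_tendsto_compose[OF this lim]
    have "(\<lambda>j. (h ^^ i) ((h ^^ (M * j)) y)) \<longlonglongrightarrow> (h ^^ i) p" by simp
    moreover have "(h ^^ i) p = p" using p by (induction i) auto
    ultimately have "(\<lambda>j. (h ^^ (M * j + i)) y) \<longlonglongrightarrow> p" by (simp add: funpow_funpow add.commute)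
    then show "\<forall>\<^sub>F j in sequentially. dist ((h ^^ (M * j + i)) y) p < e" using e by (rule tendstoD)
  qed
qed

text \<open>Non-attractiveness is stated pointwise and for \<open>F\<close> on the whole line, where
  the attracting neighbourhoods constructed below live.\<close>

locale unique_repelling_orbits = unique_periodic_orbits +
  assumes nonattractive: "p \<in> {a..b} \<Longrightarrow> periodic_point F p (2 ^ n) \<Longrightarrow> d > 0 \<Longrightarrow>
    \<exists>y. \<bar>y - p\<bar> < d \<and> \<not> (\<lambda>j. ((F ^^ 2 ^ n) ^^ j) y) \<longlonglongrightarrow> p"
begin

lemma finite_periodic_points: "finite {q \<in> {a..b}. periodic_point F q (2 ^ n)}"
proof (cases "{q \<in> {a..b}. periodic_point F q (2 ^ n)} = {}")
  case False
  then obtain u where u: "u \<in> {a..b}" "periodic_point F u (2 ^ n)" by blast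
  have per: "(F ^^ 2 ^ n) u = u" using u by (simp add: periodic_point_def)
  have "{q \<in> {a..b}. periodic_point F q (2 ^ n)} \<subseteq> (\<lambda>i. (F ^^ i) u) ` {..<2 ^ n}"
  proof
    fix v assume "v \<in> {q \<in> {a..b}. periodic_point F q (2 ^ n)}"
    then obtain i where "v = (F ^^ i) u" using orbit_unique[of u v n] u by blast
    then have "v = (F ^^ (i mod 2 ^ n)) u" using funpow_mod_eq[OF per] by simp
    then show "v \<in> (\<lambda>i. (F ^^ i) u) ` {..<2 ^ n}" by simp
  qed
  then show ?thesis using finite_surj by blast
next
  case True
  then show ?thesis by (simp only: finite.emptyI)
qed

text \<open>The orbit of \<open>y\<close> accumulates at \<open>z\<close>; two of its points near
  \<open>z\<close> are joined to \<open>z\<close> inside the reached set and so share a component.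
  The iterate by their time difference maps the closure of this component onto a connected part of
  the reached set that meets the component, hence into it.\<close>

lemma reach_component:
  assumes e: "e > 0" and bdd: "{z. reach F e y z} \<subseteq> {a'..b'}"
  shows "\<exists>c d m. c < d \<and> 0 < m \<and> {c<..<d} \<subseteq> {z. reach F e y z} \<and> (F ^^ m) ` {c..d} \<subseteq> {c<..<d}"
proof -
  define R where "R = {z. reach F e y z}"
  \<comment> \<open>\<open>y\<close> itself may lie outside \<open>{0..1}\<close>; its images do
    not.\<close>
  have Fn: "(F ^^ n) y \<in> {min 0 y..max 1 y}" for n
  proof (cases n)
    case (Suc k)
    then show ?thesis using range01[of "(F ^^ k) y"] by auto
  qed simp
  obtain z where z: "z \<in> omega_limit F y"
    using omega_limit_nonempty[of "{min 0 y..max 1 y}" F y] Fn by auto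
  have seg: "closed_segment ((F ^^ n) y) z \<subseteq> R" if n: "n > 0" "dist ((F ^^ n) y) z < e" for n
  proof -
    obtain k where k: "n = Suc k" using n(1) by (cases n) auto
    have R: "reach F e y z'" if "dist z' ((F ^^ n) y) < e" for z'
    proof (cases k)
      case 0
      then show ?thesis using that k by (intro reach.first) (simp add: dist_real_def)
    next
      case (Suc l)
      then show ?thesis using that k reach_funpow_Suc[OF e, of F y l]
          reach.extend[of F e y "(F ^^ k) y" z'] by (simp add: dist_real_def)
    qed
    \<comment> \<open>The step that reaches \<open>(F ^^ n) y\<close> may use its error to aim at
      any point of the ball.\<close>
    have "closed_segment ((F ^^ n) y) z \<subseteq> ball ((F ^^ n) y) e"
      by (rule closed_segment_subset) (use n(2) e in \<open>auto simp: convex_ball\<close>)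
    then show ?thesis using R by (auto simp: R_def dist_commute subset_iff)
  qed
  obtain k1 where k1: "k1 \<ge> 1" "dist ((F ^^ k1) y) z < e" using omega_limitD[OF z e] by blast
  obtain k2 where k2: "k2 \<ge> k1 + 1" "dist ((F ^^ k2) y) z < e" using omega_limitD[OF z e] by blast
  define C where "C = connected_component_set R z"
  have inC: "closed_segment ((F ^^ n) y) z \<subseteq> C" if "n > 0" "dist ((F ^^ n) y) z < e" for n
    unfolding C_def by (rule connected_component_maximal) (use seg[OF that] in auto)
  have k1C: "(F ^^ k1) y \<in> C" and k2C: "(F ^^ k2) y \<in> C"
    using inC[of k1] inC[of k2] k1 k2 by (auto simp: subset_iff)
  have CR: "C \<subseteq> R" unfolding C_def by (rule connected_component_subset)
  have oC: "open C" unfolding C_def R_def by (rule open_connected_component[OF open_reach])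
  have "closure C \<subseteq> {a'..b'}" using CR bdd by (intro closure_minimal) (auto simp: R_def)
  then have "compact (closure C)"
    by (meson bounded_closed_interval bounded_subset closed_closure compact_eq_bounded_closed)
  moreover have conC: "connected (closure C)"
    unfolding C_def by (intro connected_imp_connected_closure connected_connected_component)
  ultimately obtain c d where cd: "closure C = {c..d}"
    using connected_compact_interval_1[of "closure C"] by auto
  have Cin: "C \<subseteq> {c<..<d}"
    using interior_maximal[OF closure_subset oC] by (simp add: cd)
  then have "c < d" using k1C by force
  define m where "m = k2 - k1"
  have m: "m > 0" "m + k1 = k2" using k2(1) by (auto simp: m_def)
  have "(F ^^ m) ` {c..d} \<subseteq> R"
  proof safe
    fix u assume "u \<in> {c..d}"
    then have "u \<in> closure R" using cd closure_mono[OF CR] by blast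
    then have "reach F e y (F u)" unfolding R_def by (rule reach_image_closure[OF cont e])
    then have "reach F e y ((F ^^ (m - 1)) (F u))" using e by (rule reach_funpow)
    moreover have "(F ^^ (m - 1)) (F u) = (F ^^ m) u" using m(1) by (cases m) (auto simp: funpow_swap1)
    ultimately show "(F ^^ m) u \<in> R" by (simp add: R_def)
  qed
  moreover have "connected ((F ^^ m) ` {c..d})" using connected_continuous_image[OF cont_funpow] by simp
  moreover have "(F ^^ k2) y \<in> (F ^^ m) ` {c..d}"
    using k1C closure_subset[of C] m(2) by (force simp: cd funpow_funpow intro!: image_eqI[of _ _ "(F ^^ k1) y"])
  ultimately have "(F ^^ m) ` {c..d} \<subseteq> connected_component_set R ((F ^^ k2) y)"
    by (intro connected_component_maximal)
  also have "\<dots> = C" using k2C unfolding C_def by (metis connected_component_eq)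
  finally have mC: "(F ^^ m) ` {c..d} \<subseteq> C" .
  \<comment> \<open>An open interval is the interior of its closure; this identifies
    \<open>C\<close> with \<open>{c<..<d}\<close>.\<close>
  have "convex C" unfolding C_def is_interval_convex_1[symmetric] is_interval_connected_1 by (rule connected_connected_component)
  then have "interior (closure C) = C" using oC by (simp add: convex_interior_closure interior_open)
  then have "C = {c<..<d}" by (simp add: cd)
  then have "{c<..<d} \<subseteq> {z. reach F e y z}" "(F ^^ m) ` {c..d} \<subseteq> {c<..<d}"
    using mC CR by (simp_all add: R_def)
  then show ?thesis using \<open>c < d\<close> m(1) by blast
qed

lemma reach_infinitely_many_periods:
  assumes e: "0 < e" "e \<le> e'" and trap: "F ` {a'..b'} \<subseteq> {a' + e'..b' - e'}"
    and trap2: "\<And>z. z \<in> {a'..b'} \<Longrightarrow> F (F z) \<in> {a..b}" and y: "y \<in> {a'..b'}"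
  shows "infinite {n. \<exists>q. q \<in> {a..b} \<and> periodic_point F q (2 ^ n) \<and> reach F e y q}"
proof
  define S where "S = {n. \<exists>q. q \<in> {a..b} \<and> periodic_point F q (2 ^ n) \<and> reach F e y q}"
  assume "finite {n. \<exists>q. q \<in> {a..b} \<and> periodic_point F q (2 ^ n) \<and> reach F e y q}"
  then obtain K where K: "\<forall>n\<in>S. n < K" unfolding S_def[symmetric] finite_nat_set_iff_bounded by blast
  have Rsub: "{z. reach F e y z} \<subseteq> {a'..b'}" using reach_trapped[OF _ trap e(2) y] by blast
  obtain c d m where cd: "c < d" "0 < m" "{c<..<d} \<subseteq> {z. reach F e y z}" "(F ^^ m) ` {c..d} \<subseteq> {c<..<d}"
    using reach_component[OF e(1) Rsub] by blast
  \<comment> \<open>The factor \<open>m\<close> keeps the interval invariant, and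
    \<open>2 ^ K\<close> is a multiple of every period \<open>2 ^ n\<close> with
    \<open>n < K\<close>. So \<open>F ^^ M\<close> fixes all periodic points of the interval and has
    no points of period 2 there.\<close>
  define M where "M = m * 2 ^ K"
  have M: "M > 0" using cd(2) by (simp add: M_def)
  have into: "(F ^^ (m * i)) z \<in> {c<..<d}" if z: "z \<in> {c..d}" "i > 0" for z i
  proof -
    have "(F ^^ m) ` {c..d} \<subseteq> {c..d}" using cd(4) by fastforce
    then have "((F ^^ m) ^^ (i - 1)) z \<in> {c..d}" using z(1) by (rule funpow_mem)
    then have "(F ^^ m) (((F ^^ m) ^^ (i - 1)) z) \<in> {c<..<d}" using cd(4) by blast
    moreover have "(F ^^ m) (((F ^^ m) ^^ (i - 1)) z) = (F ^^ (m * i)) z"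
      using z(2) by (cases i) (simp_all add: funpow_mult funpow_funpow)
    ultimately show ?thesis by simp
  qed
  have per: "z \<in> {a..b} \<and> (\<exists>n<K. periodic_point F z (2 ^ n))"
    if z: "z \<in> {c..d}" "(F ^^ (M * i)) z = z" "i > 0" for z i
  proof -
    have "z \<in> {c<..<d}" using into[OF z(1), of "2 ^ K * i"] z(2,3) by (simp add: M_def mult.assoc)
    then have r: "reach F e y z" using cd(3) by blast
    then have "F (F z) \<in> {a..b}" using trap2 Rsub by blast
    \<comment> \<open>Two steps lead into \<open>{a..b}\<close>, and the rest of a full turn stays
      there and ends at \<open>z\<close>. The turn is doubled so that 2 steps can be taken
      off.\<close>
    then have "(F ^^ (M * i * 2 - 2)) (F (F z)) \<in> {a..b}" by (rule funpow_in_V)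
    moreover have "(F ^^ (M * i * 2 - 2)) (F (F z)) = (F ^^ (M * i * 2)) z"
    proof -
      have "M * i * 2 = (M * i * 2 - 2) + 2" using M z(3) by (cases "M * i") auto
      then have "(F ^^ (M * i * 2)) z = (F ^^ (M * i * 2 - 2)) ((F ^^ 2) z)" by (metis funpow_funpow)
      then show ?thesis by (simp add: numeral_2_eq_2)
    qed
    ultimately have zV: "z \<in> {a..b}" using funpow_multiple_fixed[OF z(2), of 2] by simp
    obtain p where p: "periodic_point F z p"
      using exists_period[OF V_subset[OF zV] z(2)] M z(3) by auto
    then obtain n where n: "p = 2 ^ n" using period_pow2 by blast
    then have "n \<in> S" using zV p r unfolding S_def by blast
    then show ?thesis using K zV p n by blast
  qed
  define G where "G = F ^^ M"
  have Gpow: "G ^^ i = F ^^ (M * i)" for i by (simp add: G_def funpow_mult)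
  have fixG: "G z = z" if "n < K" "periodic_point F z (2 ^ n)" for z n
  proof -
    have "M = 2 ^ n * (2 ^ (K - n) * m)" using that(1)
      by (simp add: M_def power_add[symmetric] mult.assoc[symmetric] mult.commute)
    then show ?thesis using that(2) funpow_multiple_fixed[of "2 ^ n" F z] by (simp add: G_def periodic_point_def)
  qed
  have "\<exists>p\<in>{c<..<d}. G p = p \<and> (\<exists>e>0. \<forall>y. \<bar>y - p\<bar> < e \<longrightarrow> (\<lambda>j. (G ^^ j) y) \<longlonglongrightarrow> p)"
  proof (rule exists_attractive_fixed_point[OF _ cd(1)])
    show "continuous_on UNIV G" unfolding G_def by (rule cont_funpow)
    show "G ` {c..d} \<subseteq> {c<..<d}" using into[of _ "2 ^ K"] by (auto simp: G_def M_def)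
    have "{z \<in> {c..d}. G z = z} \<subseteq> (\<Union>n\<in>{..<K}. {q \<in> {a..b}. periodic_point F q (2 ^ n)})"
    proof
      fix z assume "z \<in> {z \<in> {c..d}. G z = z}"
      then have "z \<in> {a..b} \<and> (\<exists>n<K. periodic_point F z (2 ^ n))" using per[of z 1] by (simp add: G_def)
      then show "z \<in> (\<Union>n\<in>{..<K}. {q \<in> {a..b}. periodic_point F q (2 ^ n)})" by blast
    qed
    then show "finite {z \<in> {c..d}. G z = z}"
      by (rule finite_subset) (use finite_periodic_points in blast)
    show "G z = z" if "z \<in> {c..d}" "G (G z) = z" for z
    proof -
      have "(F ^^ (M * 2)) z = z" using that(2) by (simp add: G_def funpow_funpow mult_2_right)
      then show ?thesis using per[of z 2] that(1) fixG by auto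
    qed
  qed
  then obtain p r where p: "p \<in> {c<..<d}" "G p = p" "r > 0" "\<And>y. \<bar>y - p\<bar> < r \<Longrightarrow> (\<lambda>j. (G ^^ j) y) \<longlonglongrightarrow> p"
    by blast
  obtain n where n: "p \<in> {a..b}" "n < K" "periodic_point F p (2 ^ n)"
    using per[of p 1] p(1,2) by (auto simp: G_def)
  \<comment> \<open>\<open>G\<close> is an iterate of \<open>F ^^ 2 ^ n\<close>, which fixes
    \<open>p\<close>, so attraction under \<open>G\<close> passes to that map.\<close>
  have "(\<lambda>j. ((F ^^ 2 ^ n) ^^ j) y) \<longlonglongrightarrow> p" if "\<bar>y - p\<bar> < r" for y
  proof (rule orbit_tendsto_of_subsequence)
    have "M = 2 ^ n * (m * 2 ^ (K - n))" using n(2)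
      by (simp add: M_def power_add[symmetric] mult.left_commute)
    then have "(F ^^ 2 ^ n) ^^ (m * 2 ^ (K - n) * j) = G ^^ j" for j
      by (simp add: Gpow funpow_mult mult.assoc)
    then show "(\<lambda>j. ((F ^^ 2 ^ n) ^^ (m * 2 ^ (K - n) * j)) y) \<longlonglongrightarrow> p" using p(4)[OF that] by simp
  qed (use n(3) cd(2) cont_funpow in \<open>auto simp: periodic_point_def\<close>)
  then show False using nonattractive[OF n(1,3) p(3)] by blast
qed

text \<open>One jump from \<open>w\<close> onto the orbit of \<open>x\<close>, exact steps along it,
  and one jump off to \<open>w'\<close>. The bound \<open>k2 \<ge> k1 + 2\<close> keeps the two
  jumps apart.\<close>

lemma omega_limit_chain_transitive:
  assumes w: "w \<in> omega_limit F x" "w' \<in> omega_limit F x" and e: "e > 0"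
  shows "reach F e w w'"
proof -
  have "isCont F w" using cont continuous_on_eq_continuous_at by blast
  then obtain d where d: "d > 0" "\<And>u. \<bar>u - w\<bar> < d \<Longrightarrow> \<bar>F u - F w\<bar> < e"
    using e unfolding continuous_at_eps_delta dist_real_def by blast
  obtain k1 where k1: "dist ((F ^^ k1) x) w < d" using omega_limitD[OF w(1) d(1)] by blast
  obtain k2 where k2: "k2 \<ge> k1 + 2" "dist ((F ^^ k2) x) w' < e" using omega_limitD[OF w(2) e] by blast
  define l where "l = k2 - (k1 + 2)"
  have "k2 = Suc (l + Suc k1)" using k2(1) by (simp add: l_def)
  then have "(F ^^ k2) x = F ((F ^^ l) ((F ^^ Suc k1) x))" by (simp add: funpow_add funpow_swap1)
  then have "\<bar>w' - F ((F ^^ l) ((F ^^ Suc k1) x))\<bar> < e" using k2(2) by (simp add: dist_real_def abs_minus_commute)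
  moreover have "reach F e w ((F ^^ Suc k1) x)"
    using d(2)[of "(F ^^ k1) x"] k1 by (intro reach.first) (simp add: dist_real_def)
  ultimately show ?thesis using reach_funpow[OF _ e] reach.extend by blast
qed

lemma reach_omega_limit:
  assumes e: "0 < e" "e \<le> e'" and trap: "F ` {a'..b'} \<subseteq> {a' + e'..b' - e'}"
    and trap2: "\<And>z. z \<in> {a'..b'} \<Longrightarrow> F (F z) \<in> {a..b}" and y: "y \<in> {a'..b'}"
    and w: "w \<in> omega_limit F x"
  shows "reach F e y w"
proof -
  obtain n0 where n0: "(1 / 2) ^ n0 < e" using real_arch_pow_inv[of e "1/2"] e(1) by auto
  obtain n where n: "n > n0" "n \<in> {n. \<exists>q. q \<in> {a..b} \<and> periodic_point F q (2 ^ n) \<and> reach F e y q}"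
    using reach_infinitely_many_periods[OF e trap trap2 y] unfolding infinite_nat_iff_unbounded by blast
  then obtain q where q: "q \<in> {a..b}" "periodic_point F q (2 ^ n)" "reach F e y q" by blast
  have "(1 / 2) ^ n \<le> (1 / 2 :: real) ^ n0" using n(1) by (intro power_decreasing) auto
  then have "(1 / 2) ^ n < e" using n0 by (rule le_less_trans)
  then have "1 < 2 ^ n * e" by (simp add: power_one_over field_simps)
  then obtain q' w' where q': "q' \<in> {a..b}" "periodic_point F q' (2 ^ n)" "w' \<in> omega_limit F x" "\<bar>w' - q'\<bar> < e"
    using periodic_near_omega_limit by blast
  \<comment> \<open>The reached point \<open>q\<close> and the point \<open>q'\<close> near the
    omega-limit set lie on the same orbit. The chain is stopped one step before \<open>q'\<close>,
    and the error of the last step lands on \<open>w'\<close>.\<close>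
  obtain i where "q' = (F ^^ i) q" using orbit_unique q q' by blast
  then have rq': "reach F e y ((F ^^ (2 ^ n - 1)) q')" using reach_funpow[OF _ e(1)] q(3) by blast
  have Suc: "Suc (2 ^ n - 1) = 2 ^ n" by simp
  have "F ((F ^^ (2 ^ n - 1)) q') = (F ^^ Suc (2 ^ n - 1)) q'" by (simp only: funpow.simps comp_apply)
  also have "\<dots> = q'" unfolding Suc using q'(2) by (simp add: periodic_point_def)
  finally have "reach F e y w'" using reach.extend[OF rq'] q'(4) by simp
  then show ?thesis using reach_trans omega_limit_chain_transitive[OF q'(3) w e(1)] by blast
qed

end

section \<open>Noisy paths\<close>

text \<open>The realisation of the noise is an argument, so that a path restarted later is again a
  path, and a path up to a given time depends on finitely many noise values.\<close>

primrec noisy_path :: "(nat \<Rightarrow> real \<Rightarrow> real) \<Rightarrow> (nat \<Rightarrow> real) \<Rightarrow> real \<Rightarrow> nat \<Rightarrow> real" where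
  "noisy_path H s y 0 = y"
| "noisy_path H s y (Suc n) = H n (noisy_path H s y n) + s n"

lemma path_add: "noisy_path H s y (t + n) = noisy_path (\<lambda>i. H (t + i)) (\<lambda>i. s (t + i)) (noisy_path H s y t) n"
  by (induction n) simp_all

lemma path_cong: "(\<And>i. i < n \<Longrightarrow> s i = s' i) \<Longrightarrow> noisy_path H s y n = noisy_path H s' y n"
  by (induction n) simp_all

lemma proc_eq_path: "proc g \<xi> y n \<omega> = noisy_path (\<lambda>n. ext (g n)) (\<lambda>n. \<xi> n \<omega>) y n"
  by (induction n) simp_all

text \<open>A chain of \<open>F\<close> ending in the open set \<open>U\<close> is followed by every noisy path whose maps are
  close to \<open>F\<close> and whose noise is close to the errors \<open>c\<close> of the chain.\<close>

lemma reach_control: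
  assumes F: "continuous_on UNIV F" and "reach F d y z" and U: "open U" "z \<in> U"
  shows "\<exists>l c \<eta>. \<eta> > 0 \<and> l > 0 \<and> (\<forall>i<l. \<bar>c i\<bar> + \<eta> \<le> d) \<and>
    (\<forall>H s y'. \<bar>y' - y\<bar> < \<eta> \<longrightarrow> (\<forall>i<l. \<forall>v. \<bar>H i v - F v\<bar> < \<eta>) \<longrightarrow> (\<forall>i<l. \<bar>s i - c i\<bar> < \<eta>) \<longrightarrow>
      noisy_path H s y' l \<in> U)"
  using assms(2) U
proof (induction arbitrary: U rule: reach.induct)
  case (first z)
  obtain r where r: "r > 0" "\<And>v. \<bar>v - z\<bar> < r \<Longrightarrow> v \<in> U"
    using first.prems unfolding open_dist dist_real_def by blast
  have "isCont F y" using F continuous_on_eq_continuous_at by blast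
  then obtain h where h: "h > 0" "\<And>v. \<bar>v - y\<bar> < h \<Longrightarrow> \<bar>F v - F y\<bar> < r / 3"
    using r(1) unfolding continuous_at_eps_delta dist_real_def by (metis divide_pos_pos zero_less_numeral)
  \<comment> \<open>\<open>h\<close> serves the continuity of \<open>F\<close> at \<open>y\<close>;
    the thirds of \<open>r\<close> pay for starting point, map and noise; the last term, positive
    since chain errors are strict, keeps the noise window inside \<open>{-d..d}\<close>.\<close>
  define \<eta> where "\<eta> = min (min h (r / 3)) (d - \<bar>z - F y\<bar>)"
  have \<eta>: "\<eta> > 0" "\<eta> \<le> h" "\<eta> \<le> r / 3" "\<bar>z - F y\<bar> + \<eta> \<le> d"
    using h(1) r(1) first.hyps unfolding \<eta>_def by linarith+
  have "noisy_path H s y' (Suc 0) \<in> U"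
    if "\<bar>y' - y\<bar> < \<eta>" "\<forall>i<Suc 0. \<forall>v. \<bar>H i v - F v\<bar> < \<eta>" "\<forall>i<Suc 0. \<bar>s i - (z - F y)\<bar> < \<eta>" for H s y'
  proof -
    have "\<bar>F y' - F y\<bar> < r / 3" "\<bar>H 0 y' - F y'\<bar> < \<eta>" "\<bar>s 0 - (z - F y)\<bar> < \<eta>"
      using h(2)[of y'] that \<eta>(2) by auto
    then have "\<bar>H 0 y' + s 0 - z\<bar> < r" using \<eta>(3) by linarith
    then show ?thesis using r(2) by simp
  qed
  then show ?case using \<eta> by (intro exI[of _ "Suc 0"] exI[of _ "\<lambda>_. z - F y"] exI[of _ \<eta>]) blast
next
  case (extend u z)
  obtain r where r: "r > 0" "\<And>v. \<bar>v - z\<bar> < r \<Longrightarrow> v \<in> U"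
    using extend.prems unfolding open_dist dist_real_def by blast
  \<comment> \<open>The induction hypothesis is used with a target around \<open>u\<close> on which
    \<open>F\<close> varies by less than \<open>r / 3\<close>.\<close>
  have op: "open {v. \<bar>F v - F u\<bar> < r / 3}" using F by (intro open_Collect_less continuous_intros)
  have u: "u \<in> {v. \<bar>F v - F u\<bar> < r / 3}" using r(1) by simp
  obtain l c \<eta>0 where IH: "\<eta>0 > 0" "l > 0" "\<forall>i<l. \<bar>c i\<bar> + \<eta>0 \<le> d"
    "\<forall>H s y'. \<bar>y' - y\<bar> < \<eta>0 \<longrightarrow> (\<forall>i<l. \<forall>v. \<bar>H i v - F v\<bar> < \<eta>0) \<longrightarrow> (\<forall>i<l. \<bar>s i - c i\<bar> < \<eta>0) \<longrightarrow>
      noisy_path H s y' l \<in> {v. \<bar>F v - F u\<bar> < r / 3}"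
    using extend.IH[OF op u] by (elim exE conjE) (rule that)
  define \<eta> where "\<eta> = min (min \<eta>0 (r / 3)) (d - \<bar>z - F u\<bar>)"
  have \<eta>: "\<eta> > 0" "\<eta> \<le> \<eta>0" "\<eta> \<le> r / 3" "\<bar>z - F u\<bar> + \<eta> \<le> d"
    using IH(1) r(1) extend.hyps unfolding \<eta>_def by linarith+
  define c' where "c' = c(l := z - F u)"
  have "noisy_path H s y' (Suc l) \<in> U"
    if A: "\<bar>y' - y\<bar> < \<eta>" "\<forall>i<Suc l. \<forall>v. \<bar>H i v - F v\<bar> < \<eta>" "\<forall>i<Suc l. \<bar>s i - c' i\<bar> < \<eta>" for H s y'
  proof -
    have "\<bar>H i v - F v\<bar> < \<eta>0" if "i < l" for i v
    proof -
      have "\<bar>H i v - F v\<bar> < \<eta>" using A(2) that by simp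
      then show ?thesis using \<eta>(2) by simp
    qed
    moreover have "\<bar>s i - c i\<bar> < \<eta>0" if "i < l" for i
    proof -
      have "\<bar>s i - c' i\<bar> < \<eta>" using A(3) that by simp
      then show ?thesis using \<eta>(2) that by (simp add: c'_def)
    qed
    ultimately have "\<bar>F (noisy_path H s y' l) - F u\<bar> < r / 3" using IH(4)[rule_format, of y' H s] A(1) \<eta>(2) by simp
    moreover have "\<bar>H l (noisy_path H s y' l) - F (noisy_path H s y' l)\<bar> < \<eta>" using A(2) by simp
    moreover have "\<bar>s l - c' l\<bar> < \<eta>" using A(3) by blast
    then have "\<bar>s l - (z - F u)\<bar> < \<eta>" by (simp add: c'_def)
    ultimately have "\<bar>H l (noisy_path H s y' l) + s l - z\<bar> < r" using \<eta>(3) by linarith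
    then show ?thesis using r(2) by simp
  qed
  moreover have "\<bar>c' i\<bar> + \<eta> \<le> d" if "i < Suc l" for i
  proof (cases "i = l")
    case False
    then have "\<bar>c i\<bar> + \<eta>0 \<le> d" using IH(3) that by simp
    then show ?thesis using \<eta>(2) False by (simp add: c'_def)
  qed (use \<eta>(4) in \<open>simp add: c'_def\<close>)
  ultimately show ?case using \<eta>(1) by (intro exI[of _ "Suc l"] exI[of _ c'] exI[of _ \<eta>]) blast
qed

text \<open>Stated on a finite product, so that events of the past become preimages under the
  restricted noise and independence of index blocks applies.\<close>

lemma measurable_path_PiM:
  assumes H: "\<And>n. H n \<in> borel_measurable borel" and "k \<le> t"
  shows "(\<lambda>s. noisy_path H s x k) \<in> borel_measurable (PiM {..<t} (\<lambda>_. borel))"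
  using assms(2)
proof (induction k)
  case (Suc k)
  then have "(\<lambda>s. noisy_path H s x k) \<in> borel_measurable (PiM {..<t} (\<lambda>_. borel))" by simp
  from measurable_compose[OF this H[of k]]
  have 1: "(\<lambda>s. H k (noisy_path H s x k)) \<in> borel_measurable (PiM {..<t} (\<lambda>_. borel))" .
  have "(\<lambda>s. s k) \<in> borel_measurable (PiM {..<t} (\<lambda>_. borel))"
    by (rule measurable_component_singleton) (use Suc in simp)
  from borel_measurable_add[OF 1 this] show ?case by simp
qed simp

section \<open>Hitting probabilities under independent noise\<close>

context prob_space
begin

lemma measurable_path:
  fixes \<xi> :: "nat \<Rightarrow> 'a \<Rightarrow> real"
  assumes H: "\<And>n. H n \<in> borel_measurable borel" and \<xi>: "\<And>n. \<xi> n \<in> borel_measurable M"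
  shows "(\<lambda>\<omega>. noisy_path H (\<lambda>n. \<xi> n \<omega>) x k) \<in> borel_measurable M"
proof (induction k)
  case (Suc k)
  from measurable_compose[OF this H[of k]] show ?case using \<xi> by simp
qed simp

text \<open>One round of the hitting argument: given the past up to time \<open>t\<close>, the position selects a
  control word, and the later noise follows this word independently of the past.\<close>

lemma hitting_round:
  fixes \<xi> :: "nat \<Rightarrow> 'a \<Rightarrow> real" and m :: nat and x :: real
  assumes ind: "indep_vars (\<lambda>_. borel) \<xi> UNIV" and H: "\<And>n. H n \<in> borel_measurable borel"
    and meas: "N \<in> sets borel" "U \<in> sets borel" "\<And>i. B i \<in> sets borel" "\<And>i j. A i j \<in> sets borel"
    and cover: "N \<subseteq> (\<Union>i<m. B i)" and l: "\<And>i. i < m \<Longrightarrow> 0 < l i \<and> l i \<le> L"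
    and pos: "\<And>i. i < m \<Longrightarrow> q \<le> (\<Prod>j<l i. prob (\<xi> (t + j) -` A i j \<inter> space M))"
    and hit: "\<And>i v s. i < m \<Longrightarrow> v \<in> B i \<Longrightarrow> \<forall>j<l i. s j \<in> A i j \<Longrightarrow>
      noisy_path (\<lambda>j. H (t + j)) s v (l i) \<in> U"
    and T: "T \<le> t"
  defines "E \<equiv> \<lambda>t. {\<omega> \<in> space M. \<forall>k\<le>t. noisy_path H (\<lambda>n. \<xi> n \<omega>) x k \<in> N \<and>
    (T < k \<longrightarrow> noisy_path H (\<lambda>n. \<xi> n \<omega>) x k \<notin> U)}"
  shows "prob (E (t + L)) \<le> (1 - q) * prob (E t)"
proof -
  define X where "X k \<omega> = noisy_path H (\<lambda>n. \<xi> n \<omega>) x k" for k \<omega>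
  have \<xi>[measurable]: "\<xi> n \<in> borel_measurable M" for n using ind by (auto simp: indep_vars_def)
  have X[measurable]: "X k \<in> borel_measurable M" for k
    unfolding X_def using measurable_path[OF H \<xi>] by simp
  have E: "E t = {\<omega> \<in> space M. \<forall>k\<le>t. X k \<omega> \<in> N \<and> (T < k \<longrightarrow> X k \<omega> \<notin> U)}" for t
    by (simp add: E_def X_def)
  note meas[measurable]
  have Emeas[measurable]: "E t \<in> events" for t unfolding E by measurable
  have "range B \<subseteq> sets borel" using meas(3) by blast
  from sets.range_disjointed_sets[OF this] have dB: "disjointed B i \<in> sets borel" for i by blast
  note dB[measurable]
  \<comment> \<open>\<open>disjointed\<close> selects exactly one control word per position, so the
    \<open>Q i\<close> are disjoint parts of \<open>E t\<close> and their probabilities add up;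
    \<open>D i\<close> is the event that the noise fails to follow word \<open>i\<close>.\<close>
  define Q where "Q i = {\<omega> \<in> space M. \<omega> \<in> E t \<and> X t \<omega> \<in> disjointed B i}" for i
  define D where "D i = {\<omega> \<in> space M. \<exists>j<l i. \<xi> (t + j) \<omega> \<notin> A i j}" for i
  have Qm[measurable]: "Q i \<in> events" for i unfolding Q_def by measurable
  have Dm[measurable]: "D i \<in> events" for i unfolding D_def by measurable
  have sub: "E (t + L) \<subseteq> (\<Union>i<m. Q i \<inter> D i)"
  proof
    fix \<omega> assume w: "\<omega> \<in> E (t + L)"
    then have sp: "\<omega> \<in> space M" and Et: "\<omega> \<in> E t" by (auto simp: E)
    have "X t \<omega> \<in> N" using Et by (auto simp: E)
    then have "X t \<omega> \<in> (\<Union>i\<in>{0..<m}. B i)" using cover by (auto simp: atLeast0LessThan)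
    then have "X t \<omega> \<in> (\<Union>i\<in>{0..<m}. disjointed B i)" unfolding finite_UN_disjointed_eq .
    then obtain i where i: "i < m" "X t \<omega> \<in> disjointed B i" by auto
    then have iB: "X t \<omega> \<in> B i" using disjointed_subset[of B i] by blast
    have "\<omega> \<in> D i"
    proof (rule ccontr)
      assume "\<omega> \<notin> D i"
      then have "\<forall>j<l i. \<xi> (t + j) \<omega> \<in> A i j" using sp by (auto simp: D_def)
      from hit[OF i(1) iB this] have "X (t + l i) \<omega> \<in> U" by (simp add: X_def path_add)
      moreover have "T < t + l i" "t + l i \<le> t + L" using l[OF i(1)] T by auto
      ultimately show False using w by (auto simp: E)
    qed
    then show "\<omega> \<in> (\<Union>i<m. Q i \<inter> D i)" using i sp Et by (auto simp: Q_def)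
  qed
  \<comment> \<open>\<open>Q i\<close> is determined by the noise before time \<open>t\<close> and
    \<open>D i\<close> by the noise at times in \<open>{t..<t + l i}\<close>; both are pulled back
    from product spaces over these disjoint index sets.\<close>
  have indep: "prob (Q i \<inter> D i) = prob (Q i) * prob (D i)" for i
  proof -
    define QS where "QS = {s \<in> space (PiM {..<t} (\<lambda>_. borel :: real measure)).
      (\<forall>k\<le>t. noisy_path H s x k \<in> N \<and> (T < k \<longrightarrow> noisy_path H s x k \<notin> U)) \<and> noisy_path H s x t \<in> disjointed B i}"
    define DS where "DS = {s \<in> space (PiM {t..<t + l i} (\<lambda>_. borel :: real measure)). \<exists>j<l i. s (t + j) \<notin> A i j}"
    have p: "{s \<in> space (PiM {..<t} (\<lambda>_. borel :: real measure)). noisy_path H s x k \<in> S} \<in> sets (PiM {..<t} (\<lambda>_. borel))"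
      if "k \<le> t" "S \<in> sets borel" for k S
    proof -
      have "(\<lambda>s. noisy_path H s x k) \<in> borel_measurable (PiM {..<t} (\<lambda>_. borel))"
        using H that(1) by (rule measurable_path_PiM)
      from measurable_sets[OF this that(2)] show ?thesis by (simp add: vimage_def Int_def conj_commute)
    qed
    have p': "{s \<in> space (PiM {..<t} (\<lambda>_. borel :: real measure)). noisy_path H s x k \<notin> U} \<in> sets (PiM {..<t} (\<lambda>_. borel))"
      if "k \<le> t" for k
      using p[OF that, of "- U"] meas(2) by simp
    have "QS = {s \<in> space (PiM {..<t} (\<lambda>_. borel :: real measure)). noisy_path H s x t \<in> disjointed B i} \<inter>
      (\<Inter>k\<in>{..t}. {s \<in> space (PiM {..<t} (\<lambda>_. borel :: real measure)). noisy_path H s x k \<in> N}) \<inter>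
      (\<Inter>k\<in>{..t}. if T < k then {s \<in> space (PiM {..<t} (\<lambda>_. borel :: real measure)). noisy_path H s x k \<notin> U}
        else space (PiM {..<t} (\<lambda>_. borel)))"
      unfolding QS_def by (auto split: if_splits)
    moreover have "\<dots> \<in> sets (PiM {..<t} (\<lambda>_. borel))"
      by (intro sets.Int sets.finite_INT) (auto intro!: p p' dB meas)
    ultimately have QS: "QS \<in> sets (PiM {..<t} (\<lambda>_. borel))" by simp
    have c: "{s \<in> space (PiM {t..<t + l i} (\<lambda>_. borel :: real measure)). s (t + j) \<notin> A i j}
      \<in> sets (PiM {t..<t + l i} (\<lambda>_. borel))" if "j < l i" for j
    proof -
      have "(\<lambda>s. s (t + j)) \<in> borel_measurable (PiM {t..<t + l i} (\<lambda>_. borel :: real measure))"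
        by (rule measurable_component_singleton) (use that in simp)
      from measurable_sets[OF this, of "- A i j"] show ?thesis
        using meas(4) by (simp add: vimage_def Int_def conj_commute)
    qed
    have "DS = (\<Union>j\<in>{..<l i}. {s \<in> space (PiM {t..<t + l i} (\<lambda>_. borel :: real measure)). s (t + j) \<notin> A i j})"
      unfolding DS_def by auto
    then have DS: "DS \<in> sets (PiM {t..<t + l i} (\<lambda>_. borel))" using c by auto
    have iv: "indep_var (PiM {..<t} (\<lambda>_. borel)) (\<lambda>\<omega>. restrict (\<lambda>i. \<xi> i \<omega>) {..<t})
        (PiM {t..<t + l i} (\<lambda>_. borel)) (\<lambda>\<omega>. restrict (\<lambda>i. \<xi> i \<omega>) {t..<t + l i})"
      by (rule indep_var_restrict[OF ind]) auto
    have pc: "noisy_path H (restrict (\<lambda>i. \<xi> i \<omega>) {..<t}) x k = X k \<omega>" if "k \<le> t" for k \<omega>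
      unfolding X_def by (rule path_cong) (use that in auto)
    have 1: "(\<lambda>\<omega>. restrict (\<lambda>i. \<xi> i \<omega>) {..<t}) -` QS \<inter> space M = Q i"
      by (auto simp: QS_def Q_def E pc space_PiM)
    have 2: "(\<lambda>\<omega>. restrict (\<lambda>i. \<xi> i \<omega>) {t..<t + l i}) -` DS \<inter> space M = D i"
      by (auto simp: DS_def D_def space_PiM)
    have 3: "(\<lambda>\<omega>. (restrict (\<lambda>i. \<xi> i \<omega>) {..<t}, restrict (\<lambda>i. \<xi> i \<omega>) {t..<t + l i})) -` (QS \<times> DS) \<inter> space M
      = Q i \<inter> D i"
      unfolding 1[symmetric] 2[symmetric] by blast
    show ?thesis using indep_varD[OF iv QS DS] unfolding 3 1 2 .
  qed
  have Dle: "prob (D i) \<le> 1 - q" if i: "i < m" for i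
  proof -
    have "space M - D i = (\<Inter>n\<in>{t..<t + l i}. \<xi> n -` A i (n - t) \<inter> space M)"
    proof -
      have "(\<forall>j<l i. \<xi> (t + j) \<omega> \<in> A i j) \<longleftrightarrow> (\<forall>n\<in>{t..<t + l i}. \<xi> n \<omega> \<in> A i (n - t))" for \<omega>
        by (force simp: le_iff_add)
      then show ?thesis using l[OF i] by (auto simp: D_def)
    qed
    then have "prob (space M - D i) = (\<Prod>n\<in>{t..<t + l i}. prob (\<xi> n -` A i (n - t) \<inter> space M))"
      using indep_varsD[OF ind, of "{t..<t + l i}" "\<lambda>n. A i (n - t)"] l[OF i] meas(4) by simp
    also have "\<dots> = (\<Prod>j<l i. prob (\<xi> (t + j) -` A i j \<inter> space M))"
      by (rule prod.reindex_bij_witness[of _ "\<lambda>j. t + j" "\<lambda>n. n - t"]) auto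
    also have "\<dots> \<ge> q" using pos[OF i] .
    finally show ?thesis using prob_compl[OF Dm[of i]] by simp
  qed
  have "prob (E (t + L)) \<le> prob (\<Union>i<m. Q i \<inter> D i)"
    by (rule finite_measure_mono[OF sub]) measurable
  also have "\<dots> \<le> (\<Sum>i<m. prob (Q i \<inter> D i))"
    by (rule finite_measure_subadditive_finite) auto
  also have "\<dots> \<le> (\<Sum>i<m. prob (Q i) * (1 - q))"
    unfolding indep by (intro sum_mono mult_left_mono Dle) auto
  also have "\<dots> = (1 - q) * (\<Sum>i<m. prob (Q i))" by (simp add: sum_distrib_left mult.commute)
  also have "(\<Sum>i<m. prob (Q i)) = prob (\<Union>i<m. Q i)"
  proof (rule finite_measure_finite_Union[symmetric])
    show "disjoint_family_on Q {..<m}"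
      using disjoint_family_disjointed[of B] by (auto simp: disjoint_family_on_def Q_def)
  qed auto
  also have "(1 - q) * prob (\<Union>i<m. Q i) \<le> (1 - q) * prob (E t)"
  \<comment> \<open>Nonnegativity of \<open>1 - q\<close> is read off from
    \<open>prob (D 0)\<close>. If \<open>m = 0\<close>, then \<open>N\<close> is empty and so is
    \<open>E t\<close>.\<close>
  proof (cases "m = 0")
    case False
    then have "0 \<le> 1 - q" using Dle[of 0] measure_nonneg[of M "D 0"] by linarith
    then show ?thesis by (intro mult_left_mono finite_measure_mono) (auto simp: Q_def)
  next
    case True
    have "E t = {}" using cover True by (auto simp: E)
    then show ?thesis using True by simp
  qed
  finally show ?thesis .
qed

text \<open>Each block of length \<open>L\<close> shrinks the probability of having avoided
  \<open>U\<close> since time \<open>T\<close> by a fixed factor, so avoiding it forever has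
  probability 0. Starting no earlier than \<open>T0\<close> ensures that the control words
  work.\<close>

lemma AE_hits_infinitely_often:
  fixes \<xi> :: "nat \<Rightarrow> 'a \<Rightarrow> real" and m :: nat and x :: real
  assumes ind: "indep_vars (\<lambda>_. borel) \<xi> UNIV" and H: "\<And>n. H n \<in> borel_measurable borel"
    and meas: "N \<in> sets borel" "U \<in> sets borel" "\<And>i. B i \<in> sets borel" "\<And>i j. A i j \<in> sets borel"
    and cover: "N \<subseteq> (\<Union>i<m. B i)" and l: "\<And>i. i < m \<Longrightarrow> 0 < l i \<and> l i \<le> L" and q: "0 < q"
    and pos: "\<And>i t. i < m \<Longrightarrow> q \<le> (\<Prod>j<l i. prob (\<xi> (t + j) -` A i j \<inter> space M))"
    and hit: "\<And>i v s t. T0 \<le> t \<Longrightarrow> i < m \<Longrightarrow> v \<in> B i \<Longrightarrow> \<forall>j<l i. s j \<in> A i j \<Longrightarrow>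
      noisy_path (\<lambda>j. H (t + j)) s v (l i) \<in> U"
    and stay: "AE \<omega> in M. \<forall>k. noisy_path H (\<lambda>n. \<xi> n \<omega>) x k \<in> N"
  shows "AE \<omega> in M. \<forall>n. \<exists>k>n. noisy_path H (\<lambda>n. \<xi> n \<omega>) x k \<in> U"
proof (rule AE_all_countable[THEN iffD2], rule allI)
  fix n
  define T where "T = max n T0"
  define E where "E t = {\<omega> \<in> space M. \<forall>k\<le>t. noisy_path H (\<lambda>n. \<xi> n \<omega>) x k \<in> N \<and>
    (T < k \<longrightarrow> noisy_path H (\<lambda>n. \<xi> n \<omega>) x k \<notin> U)}" for t
  have \<xi>: "\<xi> n \<in> borel_measurable M" for n using ind by (auto simp: indep_vars_def)
  note [measurable] = measurable_path[OF H \<xi>] meas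
  have Em[measurable]: "E t \<in> events" for t unfolding E_def by measurable
  \<comment> \<open>Capped so that \<open>1 - q'\<close> is nonnegative and its powers tend to
    0.\<close>
  define q' where "q' = min q 1"
  have q': "0 < q'" "q' \<le> 1" "q' \<le> q" using q by (auto simp: q'_def)
  have round: "prob (E (t + L)) \<le> (1 - q') * prob (E t)" if "T \<le> t" for t
    unfolding E_def
  proof (rule hitting_round[OF ind H meas cover l])
    show "q' \<le> (\<Prod>j<l i. prob (\<xi> (t + j) -` A i j \<inter> space M))" if "i < m" for i
      using pos[OF that, of t] q'(3) by simp
    show "noisy_path (\<lambda>j. H (t + j)) s v (l i) \<in> U" if "i < m" "v \<in> B i" "\<forall>j<l i. s j \<in> A i j" for i v s
      by (rule hit) (use that \<open>T \<le> t\<close> in \<open>auto simp: T_def\<close>)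
  qed (use that in auto)
  have bound: "prob (E (T + r * L)) \<le> (1 - q') ^ r" for r
  proof (induction r)
    case (Suc r)
    have "prob (E (T + r * L + L)) \<le> (1 - q') * prob (E (T + r * L))" by (rule round) simp
    also have "\<dots> \<le> (1 - q') * (1 - q') ^ r" using Suc q' by (intro mult_left_mono) auto
    finally show ?case by (simp add: algebra_simps)
  qed simp
  define Z where "Z = {\<omega> \<in> space M. \<forall>k. noisy_path H (\<lambda>n. \<xi> n \<omega>) x k \<in> N \<and>
    (T < k \<longrightarrow> noisy_path H (\<lambda>n. \<xi> n \<omega>) x k \<notin> U)}"
  have Zm[measurable]: "Z \<in> events" unfolding Z_def by measurable
  have "prob Z \<le> (1 - q') ^ r" for r
    using finite_measure_mono[of Z "E (T + r * L)"] Em bound[of r] by (force simp: Z_def E_def)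
  moreover have "(\<lambda>r. (1 - q') ^ r) \<longlonglongrightarrow> 0" using q' by (intro LIMSEQ_power_zero) auto
  ultimately have "prob Z \<le> 0" by (intro LIMSEQ_le_const) auto
  then have "prob Z = 0" using measure_nonneg[of M Z] by linarith
  then have "AE \<omega> in M. \<omega> \<notin> Z" using prob_eq_0[OF Zm] by simp
  with stay AE_space show "AE \<omega> in M. \<exists>k>n. noisy_path H (\<lambda>n. \<xi> n \<omega>) x k \<in> U"
  proof eventually_elim
    case (elim \<omega>)
    then obtain k where "T < k" "noisy_path H (\<lambda>n. \<xi> n \<omega>) x k \<in> U" by (auto simp: Z_def)
    then show ?case by (intro exI[of _ k]) (simp add: T_def)
  qed
qed

end

section \<open>Uniform noise and recurrence\<close>

context prob_space
begin

lemma noise_prob: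
  fixes \<xi> :: "nat \<Rightarrow> 'a \<Rightarrow> real"
  assumes "noise M d \<xi>" "d > 0" "S \<in> sets borel"
  shows "prob (\<xi> n -` S \<inter> space M) = measure lborel ({-d..d} \<inter> S) / (2 * d)"
proof -
  have \<xi>: "\<xi> n \<in> measurable M lborel" and D: "distr M lborel (\<xi> n) = uniform_measure lborel {-d..d}"
    using assms(1) by (auto simp: noise_def)
  have "prob (\<xi> n -` S \<inter> space M) = measure (distr M lborel (\<xi> n)) S"
    using measure_distr[OF \<xi>, of S] assms(3) by simp
  also have "\<dots> = measure lborel ({-d..d} \<inter> S) / measure lborel {-d..d}"
    unfolding D by (rule measure_uniform_measure) (use assms in auto)
  finally show ?thesis using assms(2) by simp
qed

lemma noise_prob_interval:
  fixes \<xi> :: "nat \<Rightarrow> 'a \<Rightarrow> real"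
  assumes "noise M d \<xi>" "d > 0" "\<eta> > 0" "\<bar>c\<bar> + \<eta> \<le> d"
  shows "prob (\<xi> n -` {c - \<eta><..<c + \<eta>} \<inter> space M) = \<eta> / d"
proof -
  have "{-d..d} \<inter> {c - \<eta><..<c + \<eta>} = {c - \<eta><..<c + \<eta>}" using assms(4) by auto
  then show ?thesis using noise_prob[OF assms(1,2), of "{c - \<eta><..<c + \<eta>}" n] assms(3) by simp
qed

lemma AE_noise_bounded:
  fixes \<xi> :: "nat \<Rightarrow> 'a \<Rightarrow> real"
  assumes "noise M d \<xi>" "d > 0"
  shows "AE \<omega> in M. \<forall>n. \<xi> n \<omega> \<in> {-d..d}"
proof (rule AE_all_countable[THEN iffD2], rule allI)
  fix n
  have \<xi>: "\<xi> n \<in> borel_measurable M" using assms(1) by (auto simp: noise_def)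
  have "prob (\<xi> n -` {-d..d} \<inter> space M) = 1"
    using noise_prob[OF assms, of "{-d..d}" n] assms(2) by simp
  then have "AE \<omega> in M. \<omega> \<in> \<xi> n -` {-d..d} \<inter> space M"
    using prob_eq_1 measurable_sets[OF \<xi>, of "{-d..d}"] by simp
  then show "AE \<omega> in M. \<xi> n \<omega> \<in> {-d..d}" by eventually_elim auto
qed

text \<open>Compactness leaves finitely many control words. Their smallest tolerance fixes the time
  after which the maps are close enough, and the smallest probability of following a word is the
  uniform \<open>q\<close>. One half of the margin \<open>e\<close> covers the maps and the other
  half the noise, so almost surely the path never leaves \<open>{a..b}\<close>.\<close>

lemma AE_recurrent_if_reachable:
  fixes \<xi> :: "nat \<Rightarrow> 'a \<Rightarrow> real" and F :: "real \<Rightarrow> real" and x :: real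
  assumes F: "continuous_on UNIV F" and H: "\<And>n. H n \<in> borel_measurable borel"
    and trap: "F ` {a..b} \<subseteq> {a + e..b - e}"
    and close: "\<And>n v. \<bar>H n v - F v\<bar> \<le> e / 2"
    and unif: "\<And>\<eta>. \<eta> > 0 \<Longrightarrow> \<exists>T. \<forall>n\<ge>T. \<forall>v. \<bar>H n v - F v\<bar> < \<eta>"
    and d: "0 < d" "d < e / 2" and noise: "noise M d \<xi>"
    and reach: "\<And>y. y \<in> {a..b} \<Longrightarrow> reach F d y w"
    and U: "open U" "w \<in> U" and x: "x \<in> {a..b}"
  shows "AE \<omega> in M. \<forall>n. \<exists>k>n. noisy_path H (\<lambda>n. \<xi> n \<omega>) x k \<in> U"
proof -
  have ind: "indep_vars (\<lambda>_. borel) \<xi> UNIV" using noise by (simp add: noise_def)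
  define ctrl where "ctrl y p \<longleftrightarrow> (case p of (l, c, \<eta>) \<Rightarrow> \<eta> > 0 \<and> l > 0 \<and> (\<forall>i<l. \<bar>c i\<bar> + \<eta> \<le> d) \<and>
    (\<forall>H s y'. \<bar>y' - y\<bar> < \<eta> \<longrightarrow> (\<forall>i<l. \<forall>v. \<bar>H i v - F v\<bar> < \<eta>) \<longrightarrow> (\<forall>i<l. \<bar>s i - c i\<bar> < \<eta>) \<longrightarrow>
      noisy_path H s y' l \<in> U))" for y and p :: "nat \<times> (nat \<Rightarrow> real) \<times> real"
  have "\<forall>y\<in>{a..b}. \<exists>p. ctrl y p"
  proof
    fix y assume "y \<in> {a..b}"
    from reach_control[OF F reach[OF this] U] show "\<exists>p. ctrl y p"
      unfolding ctrl_def split_paired_Ex by simp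
  qed
  from bchoice[OF this] obtain p where p: "\<And>y. y \<in> {a..b} \<Longrightarrow> ctrl y (p y)" by blast
  define l where "l y = fst (p y)" for y
  define c where "c y = fst (snd (p y))" for y
  define \<eta> where "\<eta> y = snd (snd (p y))" for y
  have \<eta>: "\<eta> y > 0" and l: "l y > 0" and c: "\<And>i. i < l y \<Longrightarrow> \<bar>c y i\<bar> + \<eta> y \<le> d"
    and ctrl: "\<And>H s y'. \<bar>y' - y\<bar> < \<eta> y \<Longrightarrow> (\<And>i v. \<bar>H i v - F v\<bar> < \<eta> y) \<Longrightarrow>
      (\<And>i. i < l y \<Longrightarrow> \<bar>s i - c y i\<bar> < \<eta> y) \<Longrightarrow> noisy_path H s y' (l y) \<in> U"
    if "y \<in> {a..b}" for y
    using p[OF that] unfolding ctrl_def l_def c_def \<eta>_def by (simp_all add: case_prod_beta)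
  have "{a..b} \<subseteq> (\<Union>y\<in>{a..b}. {y - \<eta> y<..<y + \<eta> y})"
  proof
    fix y assume y: "y \<in> {a..b}"
    then have "y \<in> {y - \<eta> y<..<y + \<eta> y}" using \<eta>[OF y] by simp
    then show "y \<in> (\<Union>y\<in>{a..b}. {y - \<eta> y<..<y + \<eta> y})" using y by blast
  qed
  then obtain C where C: "C \<subseteq> {a..b}" "finite C" "{a..b} \<subseteq> (\<Union>y\<in>C. {y - \<eta> y<..<y + \<eta> y})"
    using compactE_image[of "{a..b}" "{a..b}" "\<lambda>y. {y - \<eta> y<..<y + \<eta> y}"] by auto
  obtain ys where ys: "set ys = C" using finite_list[OF C(2)] by blast
  define m where "m = length ys"
  have ysi: "ys ! i \<in> {a..b}" if "i < m" for i
    using that ys C(1) nth_mem[of i ys] unfolding m_def by blast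
  define \<eta>0 where "\<eta>0 = Min (insert 1 (\<eta> ` C))"
  have "\<eta>0 > 0" using C(1,2) \<eta> by (auto simp: \<eta>0_def)
  then obtain T where T: "\<And>n v. n \<ge> T \<Longrightarrow> \<bar>H n v - F v\<bar> < \<eta>0" using unif by blast
  have \<eta>0: "\<eta>0 \<le> \<eta> (ys ! i)" if "i < m" for i
  proof -
    have "ys ! i \<in> C" using that ys by (auto simp: m_def)
    then show ?thesis unfolding \<eta>0_def using C(2) by (intro Min_le) auto
  qed
  \<comment> \<open>A window of radius \<open>\<eta> y\<close> inside \<open>{-d..d}\<close> has
    probability \<open>\<eta> y / d\<close>, and the word of \<open>y\<close> has \<open>l y\<close>
    independent letters. As for \<open>\<eta>0\<close>, the inserted 1 makes the set
    nonempty.\<close>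
  define q where "q = Min (insert 1 ((\<lambda>y. (\<eta> y / d) ^ l y) ` C))"
  show ?thesis
  proof (rule AE_hits_infinitely_often[OF ind H, where N = "{a..b}" and U = U and m = m
        and B = "\<lambda>i. {ys ! i - \<eta> (ys ! i)<..<ys ! i + \<eta> (ys ! i)}"
        and A = "\<lambda>i j. {c (ys ! i) j - \<eta> (ys ! i)<..<c (ys ! i) j + \<eta> (ys ! i)}"
        and l = "\<lambda>i. l (ys ! i)" and L = "\<Sum>y\<in>C. l y" and q = q and ?T0.0 = T])
    show "U \<in> sets borel" using U(1) by simp
    show "{a..b} \<subseteq> (\<Union>i<m. {ys ! i - \<eta> (ys ! i)<..<ys ! i + \<eta> (ys ! i)})"
    proof
      fix v assume "v \<in> {a..b}"
      then obtain y where "y \<in> C" "v \<in> {y - \<eta> y<..<y + \<eta> y}" using C(3) by blast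
      moreover then obtain i where "i < m" "ys ! i = y" using ys by (auto simp: in_set_conv_nth m_def)
      ultimately show "v \<in> (\<Union>i<m. {ys ! i - \<eta> (ys ! i)<..<ys ! i + \<eta> (ys ! i)})" by blast
    qed
    show "0 < l (ys ! i) \<and> l (ys ! i) \<le> (\<Sum>y\<in>C. l y)" if "i < m" for i
    proof
      show "0 < l (ys ! i)" using l ysi[OF that] .
      have "ys ! i \<in> C" using that ys by (auto simp: m_def)
      then show "l (ys ! i) \<le> (\<Sum>y\<in>C. l y)" using C(2) by (intro member_le_sum) auto
    qed
    show "0 < q" using C(1,2) \<eta> d(1) by (auto simp: q_def subset_iff)
    show "q \<le> (\<Prod>j<l (ys ! i). prob (\<xi> (t + j) -`
        {c (ys ! i) j - \<eta> (ys ! i)<..<c (ys ! i) j + \<eta> (ys ! i)} \<inter> space M))" if i: "i < m" for i t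
    proof -
      have yC: "ys ! i \<in> C" using i ys by (auto simp: m_def)
      have "(\<Prod>j<l (ys ! i). prob (\<xi> (t + j) -`
        {c (ys ! i) j - \<eta> (ys ! i)<..<c (ys ! i) j + \<eta> (ys ! i)} \<inter> space M)) =
        (\<Prod>j<l (ys ! i). \<eta> (ys ! i) / d)"
        using c[OF ysi[OF i]] \<eta>[OF ysi[OF i]]
        by (intro prod.cong refl noise_prob_interval[OF noise d(1)]) auto
      moreover have "q \<le> (\<eta> (ys ! i) / d) ^ l (ys ! i)" unfolding q_def using C(2) yC by (intro Min_le) auto
      ultimately show ?thesis by simp
    qed
    show "noisy_path (\<lambda>j. H (t + j)) s v (l (ys ! i)) \<in> U"
      if "T \<le> t" "i < m" "v \<in> {ys ! i - \<eta> (ys ! i)<..<ys ! i + \<eta> (ys ! i)}"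
        "\<forall>j<l (ys ! i). s j \<in> {c (ys ! i) j - \<eta> (ys ! i)<..<c (ys ! i) j + \<eta> (ys ! i)}" for i v s t
    proof (rule ctrl[OF ysi[OF that(2)]])
      show "\<bar>v - ys ! i\<bar> < \<eta> (ys ! i)" using that(3) by (auto simp: abs_less_iff)
      show "\<bar>H (t + j) u - F u\<bar> < \<eta> (ys ! i)" for j u
        using T[of "t + j" u] \<eta>0[OF that(2)] that(1) by simp
      show "\<bar>s j - c (ys ! i) j\<bar> < \<eta> (ys ! i)" if "j < l (ys ! i)" for j
        using \<open>\<forall>j<l (ys ! i). _\<close> that by (auto simp: abs_less_iff)
    qed
    show "AE \<omega> in M. \<forall>k. noisy_path H (\<lambda>n. \<xi> n \<omega>) x k \<in> {a..b}"
      using AE_noise_bounded[OF noise d(1)]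
    proof eventually_elim
      case (elim \<omega>)
      show ?case
      proof
        fix k show "noisy_path H (\<lambda>n. \<xi> n \<omega>) x k \<in> {a..b}"
        proof (induction k)
          case (Suc k)
          let ?v = "noisy_path H (\<lambda>n. \<xi> n \<omega>) x k"
          have "F ?v \<in> {a + e..b - e}" using trap Suc by blast
          moreover have "\<bar>H k ?v - F ?v\<bar> \<le> e / 2" by (rule close)
          moreover have "\<xi> k \<omega> \<in> {-d..d}" using elim by blast
          ultimately have "a \<le> H k ?v + \<xi> k \<omega> \<and> H k ?v + \<xi> k \<omega> \<le> b"
            using d unfolding atLeastAtMost_iff abs_le_iff by linarith
          then show ?case by simp
        qed (use x in simp)
      qed
    qed
  qed auto
qed

end

section \<open>Transfer between interval maps and their extensions\<close>

lemma ext_eq: "z \<in> {0..1} \<Longrightarrow> ext f z = f z"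
  by (simp add: ext_def)

lemma abs_ext_diff_less:
  assumes "\<And>z. z \<in> {0..1} \<Longrightarrow> \<bar>f z - h z\<bar> < e"
  shows "\<bar>ext f v - ext h v\<bar> < e"
  unfolding ext_def by (rule assms) auto

lemma continuous_on_ext: "continuous_on {0..1} f \<Longrightarrow> continuous_on UNIV (ext f)"
  unfolding ext_def[abs_def]
  by (rule continuous_on_compose2[of "{0..1}" f]) (auto intro!: continuous_intros)

lemma ext_in: "f ` {0..1} \<subseteq> {0..1} \<Longrightarrow> ext f z \<in> {0..1}"
  unfolding ext_def by (rule subsetD[of "f ` {0..1}"]) auto

lemma funpow_ext:
  assumes "f ` {0..1} \<subseteq> {0..1}" "z \<in> {0..1}"
  shows "(ext f ^^ n) z = (f ^^ n) z"
  by (induction n) (use ext_eq[OF funpow_mem[OF assms]] in simp_all)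

lemma omega_limit_ext:
  assumes "f ` {0..1} \<subseteq> {0..1}" "z \<in> {0..1}"
  shows "omega_limit (ext f) z = omega_limit f z"
  by (simp add: omega_limit_def funpow_ext[OF assms])

lemma periodic_point_ext:
  assumes "f ` {0..1} \<subseteq> {0..1}"
  shows "periodic_point (ext f) p n \<longleftrightarrow> periodic_point f p n"
  using funpow_ext[OF assms] by (auto simp: periodic_point_def)

lemma omega_limit_funpow: "omega_limit F ((F ^^ k) x) = omega_limit F x"
proof (rule set_eqI)
  fix y
  have "(\<exists>n\<ge>N. dist ((F ^^ n) ((F ^^ k) x)) y < e) \<longleftrightarrow> (\<exists>n\<ge>N + k. dist ((F ^^ n) x) y < e)" for N e
  proof
    assume "\<exists>n\<ge>N. dist ((F ^^ n) ((F ^^ k) x)) y < e"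
    then obtain n where "n \<ge> N" "dist ((F ^^ (n + k)) x) y < e" by (auto simp: funpow_add)
    then show "\<exists>n\<ge>N + k. dist ((F ^^ n) x) y < e" by (intro exI[of _ "n + k"]) simp
  next
    assume "\<exists>n\<ge>N + k. dist ((F ^^ n) x) y < e"
    then obtain n where n: "n \<ge> N + k" "dist ((F ^^ n) x) y < e" by blast
    then have "(F ^^ (n - k)) ((F ^^ k) x) = (F ^^ n) x" by (simp add: funpow_funpow)
    then show "\<exists>n\<ge>N. dist ((F ^^ n) ((F ^^ k) x)) y < e" using n by (intro exI[of _ "n - k"]) simp
  qed
  note shift = this
  show "y \<in> omega_limit F ((F ^^ k) x) \<longleftrightarrow> y \<in> omega_limit F x"
  proof
    assume y: "y \<in> omega_limit F ((F ^^ k) x)"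
    have "\<exists>n\<ge>N. dist ((F ^^ n) x) y < e" if e: "e > 0" for e N
    proof -
      have "\<exists>n\<ge>N + k. dist ((F ^^ n) x) y < e" using omega_limitD[OF y e, of N] unfolding shift .
      then obtain n where "n \<ge> N + k" "dist ((F ^^ n) x) y < e" by blast
      then show ?thesis by (intro exI[of _ n]) simp
    qed
    then show "y \<in> omega_limit F x" unfolding omega_limit_def by blast
  next
    assume y: "y \<in> omega_limit F x"
    have "\<exists>n\<ge>N. dist ((F ^^ n) ((F ^^ k) x)) y < e" if "e > 0" for e N
      unfolding shift by (rule omega_limitD[OF y that])
    then show "y \<in> omega_limit F ((F ^^ k) x)" unfolding omega_limit_def by blast
  qed
qed

text \<open>Minimality yields surjectivity: the image of \<open>V\<close> is again a closed
  invariant interval and contains the image of \<open>W\<close>, which is \<open>W\<close>.\<close>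

lemma min_inv_interval_interval:
  assumes f: "continuous_on {0..1} f" "f ` {0..1} \<subseteq> {0..1}"
    and W: "W \<subseteq> {0..1}" "W \<noteq> {}" "f ` W = W"
  obtains a b where "0 \<le> a" "a \<le> b" "b \<le> 1" "min_inv_interval f W = {a..b}"
    "f ` {a..b} = {a..b}" "W \<subseteq> {a..b}"
proof -
  define J where "J = {J. (\<exists>a b. 0 \<le> a \<and> a \<le> b \<and> b \<le> 1 \<and> J = {a..b}) \<and> invariant f J \<and> W \<subseteq> J}"
  define V where "V = min_inv_interval f W"
  have VJ: "V = \<Inter>J" by (simp add: V_def min_inv_interval_def J_def)
  have "{0..1} \<in> J" using f(2) W(1) by (force simp: J_def invariant_def)
  then have V01: "V \<subseteq> {0..1}" unfolding VJ by blast
  have WV: "W \<subseteq> V" unfolding VJ J_def by blast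
  have "closed V" unfolding VJ by (rule closed_Inter) (auto simp: J_def)
  then have "compact V" using V01 by (meson bounded_closed_interval bounded_subset compact_eq_bounded_closed)
  moreover have "convex V" unfolding VJ by (rule convex_Inter) (auto simp: J_def)
  then have "connected V" by (rule convex_connected)
  ultimately obtain a b where ab: "V = {a..b}" using connected_compact_interval_1[of V] by auto
  have "V \<noteq> {}" using WV W(2) by blast
  then have ab01: "0 \<le> a" "a \<le> b" "b \<le> 1" using V01 ab by auto
  have inv: "f ` V \<subseteq> V"
  proof -
    have "f ` V \<subseteq> K" if "K \<in> J" for K
    proof -
      have "V \<subseteq> K" "f ` K \<subseteq> K" using that by (auto simp: VJ J_def invariant_def)
      then show ?thesis by blast
    qed
    then show ?thesis unfolding VJ by blast
  qed
  have fV: "continuous_on V f" using f(1) V01 continuous_on_subset by blast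
  have "compact (f ` V)" using compact_continuous_image[OF fV \<open>compact V\<close>] .
  moreover have "connected (f ` V)" using connected_continuous_image[OF fV \<open>connected V\<close>] .
  ultimately obtain c d where cd: "f ` V = {c..d}" using connected_compact_interval_1[of "f ` V"] by auto
  have "W \<subseteq> f ` V" using W(3) WV by blast
  moreover have "{c..d} \<noteq> {}" "{c..d} \<subseteq> {0..1}" unfolding cd[symmetric] using \<open>V \<noteq> {}\<close> inv V01 by blast+
  then have "0 \<le> c" "c \<le> d" "d \<le> 1" by simp_all
  moreover have "invariant f (f ` V)" using inv unfolding invariant_def by blast
  ultimately have "f ` V \<in> J" unfolding J_def cd by blast
  then have "V \<subseteq> f ` V" unfolding VJ by blast
  then have "f ` V = V" using inv by blast
  then show ?thesis using that[of a b] ab01 ab WV by (simp add: V_def)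
qed

text \<open>\<open>attractive_orbit\<close> concerns all points of an orbit, so attraction at one
  point has to be spread over the orbit: the neighbourhood of \<open>p\<close> is pulled back by
  \<open>F ^^ (m - j)\<close> and the convergence is pushed forward by
  \<open>F ^^ j\<close>.\<close>

lemma attractive_point_transfer:
  fixes F :: "real \<Rightarrow> real"
  assumes F: "continuous_on UNIV F" and m: "(F ^^ m) p = p" "j \<le> m" and d: "d > 0"
    and conv: "\<And>y. \<bar>y - p\<bar> < d \<Longrightarrow> (\<lambda>i. ((F ^^ m) ^^ i) y) \<longlonglongrightarrow> p"
  shows "attractive_point F ((F ^^ j) p) m"
proof -
  have cF: "continuous_on UNIV (F ^^ i)" for i by (rule continuous_on_funpow) (use F in auto)
  define U where "U = {y. \<bar>(F ^^ (m - j)) y - p\<bar> < d}"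
  have "open U" unfolding U_def using cF by (intro open_Collect_less continuous_intros) auto
  moreover have "(F ^^ j) p \<in> U" using m d by (simp add: U_def funpow_funpow)
  moreover have "(\<lambda>i. ((F ^^ m) ^^ i) y) \<longlonglongrightarrow> (F ^^ j) p" if "y \<in> U" for y
  proof -
    have "(\<lambda>i. ((F ^^ m) ^^ i) ((F ^^ (m - j)) y)) \<longlonglongrightarrow> p" using conv that by (simp add: U_def)
    from continuous_on_tendsto_compose[OF cF[of j] this]
    have "(\<lambda>i. (F ^^ j) (((F ^^ m) ^^ i) ((F ^^ (m - j)) y))) \<longlonglongrightarrow> (F ^^ j) p" by simp
    moreover have "(F ^^ j) (((F ^^ m) ^^ i) ((F ^^ (m - j)) y)) = ((F ^^ m) ^^ Suc i) y" for i
    proof -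
      have "j + (m * i + (m - j)) = m * Suc i" using m(2) by simp
      then show ?thesis unfolding funpow_mult funpow_funpow by (simp add: add.commute)
    qed
    ultimately have "(\<lambda>i. ((F ^^ m) ^^ Suc i) y) \<longlonglongrightarrow> (F ^^ j) p" by (simp only:)
    then show ?thesis by (rule LIMSEQ_imp_Suc)
  qed
  ultimately show ?thesis unfolding attractive_point_def by blast
qed

text \<open>An orbit that avoids \<open>{a..b}\<close> has no limit point in the open interval,
  which leaves at most the two ends.\<close>

lemma orbit_enters_interval:
  assumes "infinite (omega_limit F x)" "omega_limit F x \<subseteq> {a..b}"
  shows "\<exists>k. (F ^^ k) x \<in> {a..b}"
proof (rule ccontr)
  assume n: "\<nexists>k. (F ^^ k) x \<in> {a..b}"
  have "omega_limit F x \<subseteq> - {a<..<b}"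
  proof (rule omega_limit_subset[of _ 0])
    show "(F ^^ k) x \<in> - {a<..<b}" for k
    proof -
      have "(F ^^ k) x \<notin> {a..b}" using n by blast
      then show ?thesis by auto
    qed
  qed (intro closed_Compl open_greaterThanLessThan)
  then have "omega_limit F x \<subseteq> {a, b}" using assms(2) by force
  then show False using assms(1) finite_subset by blast
qed

theorem theorem4:
  fixes f :: "real \<Rightarrow> real" and g :: "nat \<Rightarrow> real \<Rightarrow> real"
    and W :: "real set" and M :: "'a measure"
  assumes "prob_space M"
    and "continuous_on {0..1} f" and "f ` {0..1} \<subseteq> {0..1}"
    and "type_two_infty f"
    and "maximal_omega_limit_set f W" and "infinite W"
    and "\<forall>n::nat. \<exists>!Orb. Orb \<subseteq> min_inv_interval f W \<and> periodic_orbit f Orb (2 ^ n)"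
    and "\<forall>n::nat. \<forall>Orb. Orb \<subseteq> min_inv_interval f W \<and> periodic_orbit f Orb (2 ^ n)
           \<longrightarrow> \<not> attractive_orbit f Orb (2 ^ n)"
    and "\<forall>n. continuous_on {0..1} (g n) \<and> g n ` {0..1} \<subseteq> {0..1}"
    and "uniform_limit {0..1} g f sequentially"
  shows "\<exists>K::nat. \<exists>\<delta>>0. \<forall>k>K. \<forall>x\<in>W. recurrent M (\<lambda>n. g (k + n)) \<delta> x"
proof -
  interpret prob_space M by fact
  note cf = assms(2) and f01 = assms(3)
  define F where "F = ext f"
  have F: "continuous_on UNIV F" unfolding F_def by (rule continuous_on_ext[OF cf])
  have F01: "F z \<in> {0..1}" for z unfolding F_def by (rule ext_in[OF f01])
  have Ff: "F z = f z" if "z \<in> {0..1}" for z using that by (simp add: F_def ext_eq)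
  have pow: "(F ^^ n) z = (f ^^ n) z" if "z \<in> {0..1}" for n z
    unfolding F_def by (rule funpow_ext[OF f01 that])
  have f01n: "(f ^^ n) z \<in> {0..1}" if "z \<in> {0..1}" for n z by (rule funpow_mem[OF f01 that])
  have per: "periodic_point F p n \<longleftrightarrow> periodic_point f p n" for p n
    unfolding F_def by (rule periodic_point_ext[OF f01])
  obtain x0 where x0: "x0 \<in> {0..1}" "W = omega_limit f x0"
    using assms(5) by (auto simp: maximal_omega_limit_set_def is_omega_limit_set_def)
  then have WF: "W = omega_limit F x0" by (simp add: F_def omega_limit_ext[OF f01])
  have orb: "(F ^^ n) x0 \<in> {0..1}" for n using pow[OF x0(1)] f01n[OF x0(1)] by simp
  have W01: "W \<subseteq> {0..1}" unfolding WF by (rule omega_limit_subset) (use orb in auto)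
  have "F ` W = W" unfolding WF by (rule image_omega_limit[of "{0..1}"]) (use orb F in auto)
  moreover have "F ` W = f ` W" by (rule image_cong) (use Ff W01 in auto)
  ultimately have fW: "f ` W = W" by simp
  have Wne: "W \<noteq> {}" using assms(6) by auto
  obtain a b where ab: "0 \<le> a" "a \<le> b" "b \<le> 1" and V: "min_inv_interval f W = {a..b}"
    and fV: "f ` {a..b} = {a..b}" and WV: "W \<subseteq> {a..b}"
    using min_inv_interval_interval[OF cf f01 W01 Wne fW] .
  have Vsub: "{a..b} \<subseteq> {0..1}" using ab by auto
  have FV: "F ` {a..b} = {a..b}" using fV Ff Vsub by (metis (no_types, lifting) image_cong subsetD)
  obtain k0 where k0: "(F ^^ k0) x0 \<in> {a..b}"
    using orbit_enters_interval[of F x0 a b] assms(6) WV unfolding WF by blast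
  \<comment> \<open>\<open>x0\<close> may lie outside \<open>V\<close>; a later point of its orbit
    has the same omega-limit set and lies inside.\<close>
  define x where "x = (F ^^ k0) x0"
  have Wx: "omega_limit F x = W" unfolding x_def WF by (rule omega_limit_funpow)
  have powV: "(f ^^ j) u \<in> {a..b}" if "u \<in> {a..b}" for u j
    by (rule funpow_mem[OF _ that]) (use fV in simp)
  have orbit: "{(f ^^ j) u | j. j < 2 ^ n} \<subseteq> min_inv_interval f W \<and>
      periodic_orbit f {(f ^^ j) u | j. j < 2 ^ n} (2 ^ n)"
    if "u \<in> {a..b}" "periodic_point f u (2 ^ n)" for u n
    using powV[OF that(1)] that(2) unfolding V periodic_orbit_def by blast
  interpret unique_repelling_orbits F a b x
  proof
    show "continuous_on UNIV F" by (rule F)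
    show "F z \<in> {0..1}" for z by (rule F01)
    show "0 \<le> a" "a \<le> b" "b \<le> 1" "F ` {a..b} = {a..b}" using ab FV by auto
    show "\<exists>n. d = 2 ^ n" if "periodic_point F q d" for q d
      using assms(4) that unfolding per type_two_infty_def by blast
    show "x \<in> {a..b}" using k0 by (simp add: x_def)
    show "infinite (omega_limit F x)" using assms(6) by (simp add: Wx)
    show "\<exists>i. v = (F ^^ i) u"
      if u: "u \<in> {a..b}" and v: "v \<in> {a..b}" and pu: "periodic_point F u (2 ^ n)"
        and pv: "periodic_point F v (2 ^ n)" for u v n
    proof -
      obtain Orb where Orb: "\<And>O'. O' \<subseteq> min_inv_interval f W \<and> periodic_orbit f O' (2 ^ n) \<Longrightarrow> O' = Orb"
        using assms(7)[rule_format, of n] by (rule ex1E) blast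
      have "{(f ^^ j) u | j. j < 2 ^ n} = {(f ^^ j) v | j. j < 2 ^ n}"
        using Orb[OF orbit[OF u pu[unfolded per]]] Orb[OF orbit[OF v pv[unfolded per]]] by simp
      moreover have "v \<in> {(f ^^ j) v | j. j < 2 ^ n}"
        by (rule CollectI, rule exI[of _ 0]) simp
      ultimately have "v \<in> {(f ^^ j) u | j. j < 2 ^ n}" by simp
      then obtain j where "v = (f ^^ j) u" by blast
      moreover have "u \<in> {0..1}" using u Vsub by blast
      ultimately show ?thesis using pow by metis
    qed
    show "\<exists>y. \<bar>y - p\<bar> < d \<and> \<not> (\<lambda>j. ((F ^^ 2 ^ n) ^^ j) y) \<longlonglongrightarrow> p"
      if p: "p \<in> {a..b}" and pp: "periodic_point F p (2 ^ n)" and d: "d > 0" for p n d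
    proof (rule ccontr)
      assume "\<nexists>y. \<bar>y - p\<bar> < d \<and> \<not> (\<lambda>j. ((F ^^ 2 ^ n) ^^ j) y) \<longlonglongrightarrow> p"
      then have conv: "(\<lambda>j. ((F ^^ 2 ^ n) ^^ j) y) \<longlonglongrightarrow> p" if "\<bar>y - p\<bar> < d" for y
        using that by blast
      have fixp: "(F ^^ 2 ^ n) p = p" using pp by (simp add: periodic_point_def)
      have "attractive_point f ((f ^^ j) p) (2 ^ n)" if "j < 2 ^ n" for j
      proof -
        have p01: "p \<in> {0..1}" using p Vsub by blast
        have "attractive_point F ((F ^^ j) p) (2 ^ n)"
          by (rule attractive_point_transfer[OF F fixp _ d conv]) (use that in auto)
        moreover have "((F ^^ 2 ^ n) ^^ i) y = ((f ^^ 2 ^ n) ^^ i) y" if "y \<in> {0..1}" for i y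
          unfolding funpow_mult by (rule pow[OF that])
        ultimately show ?thesis unfolding attractive_point_def pow[OF p01] by simp
      qed
      then have "attractive_orbit f {(f ^^ j) p | j. j < 2 ^ n} (2 ^ n)"
        unfolding attractive_orbit_def by blast
      then show False using assms(8) orbit[OF p pp[unfolded per]] by blast
    qed
  qed
  obtain a' b' e where trap: "a' < a" "b < b'" "0 < e" "F ` {a'..b'} \<subseteq> {a' + e..b' - e}"
    "\<And>z. z \<in> {a'..b'} \<Longrightarrow> F (F z) \<in> {a..b}" using trapping by blast
  have unif: "\<exists>T. \<forall>n\<ge>T. \<forall>v. \<bar>ext (g n) v - F v\<bar> < \<eta>" if "\<eta> > 0" for \<eta>
  proof -
    have "\<forall>\<^sub>F n in sequentially. \<forall>z\<in>{0..1}. dist (g n z) (f z) < \<eta>"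
      using assms(10) that by (simp add: uniform_limit_iff)
    then obtain T where "\<forall>n\<ge>T. \<forall>z\<in>{0..1}. \<bar>g n z - f z\<bar> < \<eta>"
      unfolding eventually_sequentially dist_real_def by blast
    then have "\<forall>n\<ge>T. \<forall>v. \<bar>ext (g n) v - F v\<bar> < \<eta>"
      unfolding F_def using abs_ext_diff_less by blast
    then show ?thesis by blast
  qed
  \<comment> \<open>Half of the trapping margin is reserved for the deviation of the maps from time
    \<open>K\<close> on; the other half bounds the noise.\<close>
  obtain K where K: "\<And>n v. n \<ge> K \<Longrightarrow> \<bar>ext (g n) v - F v\<bar> < e / 2"
    using unif[of "e / 2"] trap(3) by auto
  have "recurrent M (\<lambda>n. g (k + n)) (e / 2) w" if k: "k > K" and w: "w \<in> W" for k w
    unfolding recurrent_def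
  proof (intro conjI allI impI)
    show "w \<in> {0..1}" using w W01 by blast
    fix U d' \<xi> assume A: "open U \<and> w \<in> U \<and> 0 < d' \<and> d' < e / 2" and noise: "noise M d' \<xi>"
    define H where "H n = ext (g (k + n))" for n
    have Hm: "H n \<in> borel_measurable borel" for n
      unfolding H_def using assms(9) by (intro borel_measurable_continuous_onI continuous_on_ext) auto
    have wN: "w \<in> {a'..b'}" using w WV trap(1,2) by force
    have "AE \<omega> in M. \<forall>n. \<exists>j>n. noisy_path H (\<lambda>n. \<xi> n \<omega>) w j \<in> U"
    proof (rule AE_recurrent_if_reachable[OF F Hm trap(4)])
      show "\<bar>H n v - F v\<bar> \<le> e / 2" for n v
        unfolding H_def using K[of "k + n" v] k by simp
      show "\<exists>T. \<forall>n\<ge>T. \<forall>v. \<bar>H n v - F v\<bar> < \<eta>" if \<eta>: "\<eta> > 0" for \<eta>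
      proof -
        obtain T where "\<forall>n\<ge>T. \<forall>v. \<bar>ext (g n) v - F v\<bar> < \<eta>" using unif[OF \<eta>] by blast
        then have "\<forall>n\<ge>T. \<forall>v. \<bar>H n v - F v\<bar> < \<eta>" unfolding H_def by (simp add: trans_le_add2)
        then show ?thesis by blast
      qed
      \<comment> \<open>The noise level serves as the error bound of the chains; being below
        \<open>e\<close>, it keeps them in the trapping interval.\<close>
      show "reach F d' y w" if y: "y \<in> {a'..b'}" for y
        by (rule reach_omega_limit[OF _ _ trap(4,5) y]) (use A w trap(3) in \<open>auto simp: Wx\<close>)
    qed (use A noise wN in auto)
    then have ae: "AE \<omega> in M. \<forall>n\<ge>1. \<exists>j\<ge>n. proc (\<lambda>n. g (k + n)) \<xi> w j \<omega> \<in> U"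
      unfolding proc_eq_path H_def by eventually_elim (blast intro: less_imp_le)
    have "\<xi> n \<in> borel_measurable M" for n using noise by (simp add: noise_def)
    from measurable_path[OF Hm this]
    have [measurable]: "(\<lambda>\<omega>. proc (\<lambda>n. g (k + n)) \<xi> w j \<omega>) \<in> borel_measurable M" for j
      unfolding proc_eq_path H_def .
    have [measurable]: "U \<in> sets borel" using A by simp
    have "{\<omega> \<in> space M. \<forall>n\<ge>1. \<exists>j\<ge>n. proc (\<lambda>n. g (k + n)) \<xi> w j \<omega> \<in> U} \<in> events"
      by measurable
    then show "prob {\<omega> \<in> space M. \<forall>n\<ge>1. \<exists>j\<ge>n. proc (\<lambda>n. g (k + n)) \<xi> w j \<omega> \<in> U} = 1"
      by (rule prob_Collect_eq_1[THEN iffD2, OF _ ae])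
  qed
  then show ?thesis using trap(3) by (intro exI[of _ K] exI[of _ "e / 2"]) auto
qed

end
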